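(* For every integer $n\ge 0$, $$c\phi_7(7n+3)\equiv c\phi_7(7n+5)\equiv c\phi_7(7n+6)\equiv 0\pmod{7^3}.$$
   Context: A $k$-colored generalized Frobenius symbol is a two-row array with $d\ge 0$ columns whose entries are colored nonnegative integers $\ell_c$ ($\ell\ge 0$, color $c\in\{1,\dots,k\}$), each row strictly decreasing with respect to the total order $0_1\prec 0_2\prec\cdots\prec 0_k\prec 1_1\prec\cdots\prec 1_k\prec 2_1\prec\cdots$. It is a $k$-colored generalized Frobenius partition of $n=d+\sum(\text{integer values of all entries})$, and $c\phi_k(n)$ is the number of such partitions of $n$. *)

theory Defs
  imports "HOL-Number_Theory.Cong"
begin

text \<open>The pair \<open>(l, c)\<close> stands for the colored integer \<open>l\<^sub>c\<close>; colors are \<open>1, \<dots>, k\<close>.\<close>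

type_synonym colored = "nat \<times> nat"

definition colored_less :: "colored \<Rightarrow> colored \<Rightarrow> bool" where
  "colored_less x y \<longleftrightarrow> fst x < fst y \<or> (fst x = fst y \<and> snd x < snd y)"

definition frobenius_row :: "nat \<Rightarrow> colored list \<Rightarrow> bool" where
  "frobenius_row k r \<longleftrightarrow>
     (\<forall>x\<in>set r. snd x \<in> {1..k}) \<and> sorted_wrt (\<lambda>x y. colored_less y x) r"

definition frobenius_symbol :: "nat \<Rightarrow> colored list \<times> colored list \<Rightarrow> bool" where
  "frobenius_symbol k S \<longleftrightarrow>
     length (fst S) = length (snd S) \<and> frobenius_row k (fst S) \<and> frobenius_row k (snd S)"

definition frobenius_weight :: "colored list \<times> colored list \<Rightarrow> nat" where
  "frobenius_weight S =
     length (fst S) + sum_list (map fst (fst S)) + sum_list (map fst (snd S))"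

definition frobenius_partitions :: "nat \<Rightarrow> nat \<Rightarrow> (colored list \<times> colored list) set" where
  "frobenius_partitions k n = {S. frobenius_symbol k S \<and> frobenius_weight S = n}"

definition c_phi :: "nat \<Rightarrow> nat \<Rightarrow> nat" where
  "c_phi k n = card (frobenius_partitions k n)"

text \<open>The set counted by \<^const>\<open>c_phi\<close> is finite, so \<^const>\<open>card\<close> is a genuine count.\<close>

lemma finite_frobenius_partitions: "finite (frobenius_partitions k n)"
proof -
  define R where "R = {xs :: colored list. set xs \<subseteq> {0..n} \<times> {1..k} \<and> length xs \<le> n}"
  have fin: "finite R"
    unfolding R_def by (rule finite_lists_length_le) simp
  have row: "r \<in> R"
    if "frobenius_row k r" "length r \<le> n" "sum_list (map fst r) \<le> n" for r
  proof -
    have "fst x \<le> n" if "x \<in> set r" for x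
      using member_le_sum_list[of "fst x" "map fst r"] that \<open>sum_list (map fst r) \<le> n\<close> by force
    then show ?thesis
      using that by (force simp: R_def frobenius_row_def)
  qed
  have "frobenius_partitions k n \<subseteq> R \<times> R"
  proof
    fix S assume S: "S \<in> frobenius_partitions k n"
    have "fst S \<in> R" "snd S \<in> R"
      by (rule row; use S in \<open>simp add: frobenius_partitions_def frobenius_symbol_def frobenius_weight_def\<close>)+
    then show "S \<in> R \<times> R"
      by (cases S) simp
  qed
  then show ?thesis
    using fin by (meson finite_SigmaI finite_subset)
qed

end

theory Submission
  imports
    Defs
    "HOL-Computational_Algebra.Formal_Power_Series"
    "HOL-Computational_Algebra.Polynomial"
    "HOL-Library.Product_Lexorder"
begin

text \<open>
  Write \<open>E\<^sub>k = \<Prod>(1 - q\<^sup>k\<^sup>i)\<close>. The generating function of \<open>c\<phi>\<^sub>7\<close> is the constant term in \<open>z\<close> of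
  \<open>\<Prod>(1 + z q\<^sup>i\<^sup>+\<^sup>1)\<^sup>7 (1 + z\<^sup>-\<^sup>1 q\<^sup>i)\<^sup>7\<close>, which by Jacobi's triple product is \<open>\<theta> / E\<^sub>1\<^sup>7\<close>, where \<open>\<theta>\<close> is the
  theta series of the root lattice \<open>A\<^sub>6\<close>. Split \<open>\<theta>\<close> by the residue of \<open>\<Sum>j v\<^sub>j\<close> modulo 7 into
  \<open>N\<^sub>0 + 6 N\<^sub>1\<close>. Replacing the seven factors \<open>z\<close> by \<open>\<zeta>\<^sup>j z\<close> gives \<open>N\<^sub>0 - N\<^sub>1 = E\<^sub>1\<^sup>7 / E\<^sub>7\<close>. An isometry
  between cosets of lattices identifies the coefficients of \<open>N\<^sub>1\<close> with the numbers of 7-cores of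
  \<open>7n - 2\<close>, so that \<open>N\<^sub>1 = E\<^sub>1\<^sup>7 \<Sum>p(7n - 2) q\<^sup>n\<close>; this is Kolitsch's
  \<open>c\<phi>\<^sub>7(n) = p(n/7) + 7 p(7n - 2)\<close>. Ramanujan's 7-dissection of \<open>E\<^sub>1\<close> yields
  \<open>\<Sum>p(7n + 5) q\<^sup>n \<equiv> 7 E\<^sub>7\<^sup>2 E\<^sub>1\<^sup>3 (mod 49)\<close>, hence modulo \<open>7\<^sup>3\<close> the generating function of \<open>c\<phi>\<^sub>7\<close>
  is \<open>1/E\<^sub>7 + 49 q E\<^sub>7\<^sup>2 E\<^sub>1\<^sup>3\<close>. By Jacobi's formula for \<open>E\<^sub>1\<^sup>3\<close> no exponent 3, 5 or 6 modulo 7 occurs.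

  Infinite products are compared with finite ones modulo powers of \<open>q\<close>, and Laurent polynomials in
  \<open>z\<close> are shifted to polynomials, so a constant term becomes a middle coefficient.
\<close>

text \<open>The modulus 7^3 builds up in two stages. From N_0 + 6 N_1 = (N_0 - N_1) + 7 N_1, a first
  factor 7 comes from the symmetry of the six nonzero residues, so N_1 is needed only modulo 49;
  there it is already divisible by 7 because Ramanujan's p(7n + 5) is, and its next digit is the
  term whose support decides the theorem. The obstacle is the link between N_1 and cores. Completing
  the square with b = (-3, ..., 3), the 7-cores of 7n - 2 become the points w - b/7 of norm 2n,
  while N_1 counts integral points of norm 2n. Both families lie in cosets of the lattice of vectors
  with sum 0 and moment divisible by 7, but w - b/7 is not integral, so no signed permutation of
  coordinates can match them; an automorphism of the small lattice that moves A_6 is required. In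
  the dissection of E_1 only the class 2 part is explicit. The other three nonzero parts are
  controlled by two algebraic relations read off from E_1^3, which place them on a curve where the
  norm of E_1 can be computed by polynomial algebra.\<close>

unbundle fps_syntax

section \<open>Power series congruences and Euler products\<close>

lemma X_power_dvd_iff:
  fixes f :: "'a::comm_ring_1 fps"
  shows "fps_X ^ n dvd f \<longleftrightarrow> (\<forall>i<n. f $ i = 0)"
proof
  assume "fps_X ^ n dvd f"
  then show "\<forall>i<n. f $ i = 0"
    by (auto elim!: dvdE simp: fps_X_power_mult_nth)
next
  assume *: "\<forall>i<n. f $ i = 0"
  have "f = fps_X ^ n * fps_shift n f"
    by (rule fps_ext) (use * in \<open>auto simp: fps_X_power_mult_nth\<close>)
  then show "fps_X ^ n dvd f" by (rule dvdI)
qed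

lemma fps_unit_if_nth_0:
  fixes f :: "'a::comm_ring_1 fps"
  assumes "f $ 0 * c = 1"
  shows "f dvd 1"
  using fps_right_inverse[OF assms] by (metis dvdI)

lemma fps_eqI_X_adic:
  fixes f g :: "'a::comm_ring_1 fps"
  assumes "\<And>n. fps_X ^ n dvd f - g"
  shows "f = g"
proof (rule fps_ext)
  fix n show "f $ n = g $ n"
    using assms[of "Suc n"] unfolding X_power_dvd_iff by simp
qed

lemma dvd_diff_trans:
  fixes a b c :: "'a::comm_ring_1"
  assumes "d dvd a - b" "d dvd b - c"
  shows "d dvd a - c"
  using dvd_add[OF assms] by simp

lemma dvd_diff_sym:
  fixes a b :: "'a::comm_ring_1"
  assumes "d dvd a - b" shows "d dvd b - a"
  using assms by (metis dvd_minus_iff minus_diff_eq)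

lemma dvd_diff_mult:
  fixes a b c e :: "'a::comm_ring_1"
  assumes "d dvd a - b" "d dvd c - e"
  shows "d dvd a * c - b * e"
proof -
  have "a * c - b * e = (a - b) * c + b * (c - e)" by (simp add: algebra_simps)
  with assms show ?thesis by simp
qed

lemma dvd_diff_power:
  fixes a b :: "'a::comm_ring_1"
  assumes "d dvd a - b"
  shows "d dvd a ^ n - b ^ n"
  by (induction n) (auto intro: dvd_diff_mult assms)

lemma dvd_diff_prod:
  fixes f g :: "'b \<Rightarrow> 'a::comm_ring_1"
  assumes "\<And>i. i \<in> I \<Longrightarrow> d dvd f i - g i"
  shows "d dvd prod f I - prod g I"
  using assms by (induction I rule: infinite_finite_induct) (auto intro: dvd_diff_mult)

lemma dvd_diff_sum:
  fixes f g :: "'b \<Rightarrow> 'a::comm_ring_1"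
  assumes "\<And>i. i \<in> I \<Longrightarrow> d dvd f i - g i"
  shows "d dvd sum f I - sum g I"
  using dvd_sum[of I d "\<lambda>i. f i - g i"] assms by (simp add: sum_subtractf)

lemma unit_dvd_cancel:
  fixes f g d :: "'a::comm_ring_1"
  assumes "f dvd 1" "d dvd f * g"
  shows "d dvd g"
proof -
  obtain e where "1 = f * e" using assms(1) by (rule dvdE)
  then have "g = (f * g) * e" by (metis mult.commute mult.left_commute mult_1_right)
  with assms(2) show ?thesis by (metis dvd_mult2)
qed

definition qpoch :: "'a::comm_ring_1 \<Rightarrow> nat \<Rightarrow> 'a" where
  "qpoch q n = (\<Prod>i<n. 1 - q ^ Suc i)"

text \<open>The infinite product is read off diagonally: for \<open>k > 0\<close> the factors after
  the first \<open>n\<close> differ from 1 only beyond degree \<open>n\<close>, so coefficient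
  \<open>n\<close> is already final in the \<open>n\<close>-th partial product.\<close>

definition euler :: "nat \<Rightarrow> 'a::comm_ring_1 fps" where
  "euler k = Abs_fps (\<lambda>n. qpoch (fps_X ^ k) n $ n)"

lemma qpoch_0 [simp]: "qpoch q 0 = 1"
  and qpoch_Suc: "qpoch q (Suc n) = qpoch q n * (1 - q ^ Suc n)"
  by (simp_all add: qpoch_def)

lemma qpoch_nth_0:
  assumes "k > 0"
  shows "qpoch (fps_X ^ k :: 'a::comm_ring_1 fps) n $ 0 = 1"
  using assms by (induction n) (auto simp: qpoch_Suc fps_power_zeroth zero_power)

lemma qpoch_X_adic:
  assumes "k > 0" "n \<le> m"
  shows "fps_X ^ Suc n dvd qpoch (fps_X ^ k :: 'a::comm_ring_1 fps) m - qpoch (fps_X ^ k) n"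
  using assms(2)
proof (induction m rule: dec_induct)
  case (step m)
  have "Suc n \<le> k * Suc m" using step.hyps assms(1)
    by (metis Suc_le_mono le_trans mult.commute mult_le_mono2 nat_mult_1_right Suc_leI One_nat_def)
  then have "fps_X ^ Suc n dvd (fps_X ^ k) ^ Suc m * (qpoch (fps_X ^ k :: 'a fps) m)"
    by (metis dvd_mult2 le_imp_power_dvd power_mult)
  then have "fps_X ^ Suc n dvd qpoch (fps_X ^ k :: 'a fps) (Suc m) - qpoch (fps_X ^ k) m"
    by (simp add: qpoch_Suc right_diff_distrib mult.commute)
  then show ?case using step.IH by (rule dvd_diff_trans)
qed simp

lemma euler_X_adic:
  assumes "k > 0"
  shows "fps_X ^ Suc n dvd euler k - qpoch (fps_X ^ k :: 'a::comm_ring_1 fps) n"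
  unfolding X_power_dvd_iff
proof (intro allI impI)
  fix i assume "i < Suc n"
  then have "i \<le> n" by simp
  from qpoch_X_adic[OF assms this, where ?'a = 'a] show "(euler k - qpoch (fps_X ^ k :: 'a fps) n) $ i = 0"
    unfolding X_power_dvd_iff by (simp add: euler_def)
qed

lemma euler_nth_0 [simp]: "euler k $ 0 = 1"
  by (simp add: euler_def)

lemma euler_unit: "(euler k :: 'a::comm_ring_1 fps) dvd 1"
  by (rule fps_unit_if_nth_0[of _ 1]) simp

lemma qpoch_unit: "k > 0 \<Longrightarrow> qpoch (fps_X ^ k :: 'a::comm_ring_1 fps) n dvd 1"
  by (rule fps_unit_if_nth_0[of _ 1]) (simp add: qpoch_nth_0)

section \<open>The triple product identity\<close>

text \<open>The truncated product of 1 + s q^i z and 1 + t q^i / z, multiplied by z^b to clear the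
  inverse of z. Keeping \<open>s\<close> and \<open>t\<close> separate, tied only by
  \<open>s * t = q\<close>, lets one identity serve signs, roots of unity and all choices of
  exponents.\<close>

definition triple :: "'a::comm_ring_1 \<Rightarrow> 'a \<Rightarrow> 'a \<Rightarrow> nat \<Rightarrow> nat \<Rightarrow> 'a poly" where
  "triple s t q a b = (\<Prod>i<a. [:1, s * q ^ i:]) * (\<Prod>i<b. [:t * q ^ i, 1:])"

text \<open>The coefficient s^m q^(m(m-1)/2) of the bilateral series. For negative m it is rewritten
  by \<open>s * t = q\<close>, so that nothing has to be inverted.\<close>

definition theta_coeff :: "'a::comm_ring_1 \<Rightarrow> 'a \<Rightarrow> 'a \<Rightarrow> int \<Rightarrow> 'a" where
  "theta_coeff s t q m = (if m \<ge> 0 then s ^ nat m * q ^ (nat m choose 2)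
                                    else t ^ nat (- m) * q ^ (nat (- m) choose 2))"

lemma theta_coeff_0 [simp]: "theta_coeff s t q 0 = 1"
  by (simp add: theta_coeff_def numeral_2_eq_2)

lemma theta_coeff_of_nat: "theta_coeff s t q (int n) = s ^ n * q ^ (n choose 2)"
  by (simp add: theta_coeff_def)

lemma theta_coeff_minus_of_nat: "theta_coeff s t q (- int n) = t ^ n * q ^ (n choose 2)"
  by (cases "n = 0") (simp_all add: theta_coeff_def)

text \<open>Consecutive coefficients have ratio s q^m; the factor q^(a - m) clears the negative
  exponents.\<close>

lemma theta_coeff_up:
  assumes "s * t = q" "m \<le> int a"
  shows "s * q ^ a * theta_coeff s t q m = q ^ nat (int a - m) * theta_coeff s t q (m + 1)"
proof (cases "m \<ge> 0")
  case True
  then obtain n where m: "m = int n" by (metis nonneg_int_cases)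
  with assms have n: "n \<le> a" by simp
  then have "nat (int a - int n) = a - n" "q ^ a = q ^ (a - n) * q ^ n"
    by (simp, metis le_add_diff_inverse2 power_add)
  moreover have "theta_coeff s t q (int n + 1) = s ^ Suc n * q ^ (Suc n choose 2)"
    using theta_coeff_of_nat[of s t q "Suc n"] by (simp add: add.commute)
  moreover have "Suc n choose 2 = n + (n choose 2)" by (simp add: numeral_2_eq_2)
  ultimately show ?thesis
    by (simp add: m theta_coeff_of_nat power_add algebra_simps)
next
  case False
  define n where "n = nat (- m - 1)"
  have m: "m = - int (Suc n)" using False by (simp add: n_def)
  have e: "nat (int a - m) = a + Suc n" "m + 1 = - int n" using m by auto
  have "Suc n choose 2 = n + (n choose 2)" by (simp add: numeral_2_eq_2)
  then show ?thesis unfolding e unfolding m theta_coeff_minus_of_nat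
    by (simp add: power_add assms(1)[symmetric] algebra_simps power_mult_distrib)
qed

lemma theta_coeff_uminus: "theta_coeff s t q (- m) = theta_coeff t s q m"
  by (auto simp: theta_coeff_def)

lemma theta_coeff_down:
  assumes "s * t = q" "- m \<le> int b"
  shows "t * q ^ b * theta_coeff s t q m = q ^ nat (int b + m) * theta_coeff s t q (m - 1)"
  using theta_coeff_up[of t s q "- m" b] assms
  by (simp add: theta_coeff_uminus[of t s] mult.commute[of t s])
    (metis minus_diff_eq theta_coeff_uminus uminus_add_conv_diff)

lemma triple_Suc:
  "triple s t q (Suc a) b = [:1, s * q ^ a:] * triple s t q a b"
  "triple s t q a (Suc b) = [:t * q ^ b, 1:] * triple s t q a b"
  by (simp_all only: triple_def prod.lessThan_Suc mult_ac)

lemma degree_triple: "degree (triple s t q a b) \<le> a + b"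
proof (induction b)
  case 0
  show ?case
  proof (induction a)
    case (Suc a)
    have "degree (triple s t q (Suc a) 0) \<le> degree [:1, s * q ^ a:] + degree (triple s t q a 0)"
      unfolding triple_Suc by (rule degree_mult_le)
    also have "degree [:1, s * q ^ a:] \<le> 1" by simp
    finally show ?case using Suc by simp
  qed (simp add: triple_def)
next
  case (Suc b)
  have "degree (triple s t q a (Suc b)) \<le> degree [:t * q ^ b, 1:] + degree (triple s t q a b)"
    unfolding triple_Suc by (rule degree_mult_le)
  also have "degree [:t * q ^ b, 1:] \<le> 1" by simp
  finally show ?case using Suc by simp
qed

lemma coeff_linear_mult:
  "coeff ([:x, y:] * p) k = x * coeff p k + (if k = 0 then 0 else y * coeff p (k - 1))"
  by (cases k) simp_all

text \<open>One linear factor \<open>[:x, y:]\<close> is multiplied in. Here \<open>c k\<close>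
  stands for a q-binomial coefficient times \<open>g k\<close>, with denominators cleared because
  the ring has no division; the hypothesis \<open>step\<close> carries the q-Pascal rule.\<close>

lemma qbinomial_step:
  fixes q :: "'a::comm_ring_1"
  assumes c: "\<And>k. k \<le> M \<Longrightarrow> qpoch q k * qpoch q (M - k) * c k = qpoch q M * g k"
    and big: "\<And>k. k > M \<Longrightarrow> c k = 0"
    and k: "k \<le> Suc M"
    and base: "k = 0 \<Longrightarrow> x * g 0 = g' 0" "k = Suc M \<Longrightarrow> y * g M = g' (Suc M)"
    and step: "0 < k \<Longrightarrow> k \<le> M \<Longrightarrow>
      x * (1 - q ^ (Suc M - k)) * g k + y * (1 - q ^ k) * g (k - 1) = (1 - q ^ Suc M) * g' k"
  shows "qpoch q k * qpoch q (Suc M - k) * (x * c k + (if k = 0 then 0 else y * c (k - 1)))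
           = qpoch q (Suc M) * g' k"
proof -
  consider "k = 0" | "k = Suc M" | "0 < k" "k \<le> M" using k by linarith
  then show ?thesis
  proof cases
    case 1
    then show ?thesis
      using c[of 0] base(1) by (simp add: qpoch_Suc) (metis (no_types) mult.assoc mult.commute)
  next
    case 2
    then show ?thesis
      using c[of M] base(2) big[of "Suc M"] by (simp add: qpoch_Suc) (metis (no_types) mult.assoc mult.commute)
  next
    case 3
    then obtain j where j: "k = Suc j" by (cases k) auto
    have S: "Suc M - k = Suc (M - k)" "M - j = Suc (M - k)" using 3 j by auto
    have K: "qpoch q k = qpoch q j * (1 - q ^ k)" by (simp add: j qpoch_Suc)
    have "qpoch q k * qpoch q (Suc M - k) * (x * c k + y * c j)
        = x * (1 - q ^ (Suc M - k)) * (qpoch q k * qpoch q (M - k) * c k)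
          + y * (1 - q ^ k) * (qpoch q j * qpoch q (M - j) * c j)"
      unfolding S K qpoch_Suc by (simp add: algebra_simps del: power_Suc)
    also have "\<dots> = qpoch q M * (x * (1 - q ^ (Suc M - k)) * g k + y * (1 - q ^ k) * g j)"
      using c[of k] c[of j] 3 j by (simp add: algebra_simps)
    also have "\<dots> = qpoch q (Suc M) * g' k"
      using step[OF 3] j by (simp add: qpoch_Suc)
    finally show ?thesis using j by simp
  qed
qed

text \<open>Cauchy's q-binomial theorem: the coefficient is a q-binomial coefficient times a theta
  coefficient. Both kinds of linear factor are adjoined one at a time by
  \<open>qbinomial_step\<close>.\<close>

lemma finite_triple_product:
  assumes st: "s * t = q" and k: "k \<le> a + b"
  shows "qpoch q k * qpoch q (a + b - k) * coeff (triple s t q a b) k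
           = qpoch q (a + b) * theta_coeff s t q (int k - int b)"
  using k
proof (induction b arbitrary: k)
  case 0
  then show ?case
  proof (induction a arbitrary: k)
    case (Suc a)
    have "qpoch q k * qpoch q (Suc a - k) * (1 * coeff (triple s t q a 0) k +
            (if k = 0 then 0 else s * q ^ a * coeff (triple s t q a 0) (k - 1)))
           = qpoch q (Suc a) * theta_coeff s t q (int k)"
    proof (rule qbinomial_step[where g = "\<lambda>k. theta_coeff s t q (int k)"])
      show "coeff (triple s t q a 0) k = 0" if "k > a" for k
        using degree_triple[of s t q a 0] that by (intro coeff_eq_0) simp
      show "s * q ^ a * theta_coeff s t q (int a) = theta_coeff s t q (int (Suc a))"
        using theta_coeff_up[OF st, of "int a" a] by (simp add: add.commute)
      assume k: "0 < k" "k \<le> a"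
      have up0: "s * q ^ a * theta_coeff s t q (int (k - 1)) = q ^ (Suc a - k) * theta_coeff s t q (int k)"
        using theta_coeff_up[OF st, of "int (k - 1)" a] k
        by (simp add: of_nat_diff nat_diff_distrib)
      have pw: "q ^ Suc a = q ^ (Suc a - k) * q ^ k" using k by (simp flip: power_add)
      have up: "(1 - q ^ k) * (s * q ^ a * theta_coeff s t q (int (k - 1)))
          = (q ^ (Suc a - k) - q ^ Suc a) * theta_coeff s t q (int k)"
        unfolding up0 pw by (simp add: algebra_simps del: power_Suc)
      have "1 * (1 - q ^ (Suc a - k)) * theta_coeff s t q (int k)
          + s * q ^ a * (1 - q ^ k) * theta_coeff s t q (int (k - 1))
          = (1 - q ^ (Suc a - k)) * theta_coeff s t q (int k)
          + (1 - q ^ k) * (s * q ^ a * theta_coeff s t q (int (k - 1)))"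
        by (simp add: mult_ac)
      also have "\<dots> = (1 - q ^ Suc a) * theta_coeff s t q (int k)"
        unfolding up by (simp add: algebra_simps del: power_Suc)
      finally show "1 * (1 - q ^ (Suc a - k)) * theta_coeff s t q (int k)
          + s * q ^ a * (1 - q ^ k) * theta_coeff s t q (int (k - 1))
          = (1 - q ^ Suc a) * theta_coeff s t q (int k)" .
    qed (use Suc in auto)
    then show ?case by (simp only: triple_Suc coeff_linear_mult) simp
  qed (simp add: triple_def)
next
  case (Suc b)
  have "qpoch q k * qpoch q (Suc (a + b) - k) * (t * q ^ b * coeff (triple s t q a b) k +
            (if k = 0 then 0 else 1 * coeff (triple s t q a b) (k - 1)))
           = qpoch q (Suc (a + b)) * theta_coeff s t q (int k - int (Suc b))"
  proof (rule qbinomial_step[where g = "\<lambda>k. theta_coeff s t q (int k - int b)"])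
    show "coeff (triple s t q a b) k = 0" if "k > a + b" for k
      using degree_triple[of s t q a b] that by (intro coeff_eq_0) simp
    have down: "t * q ^ b * theta_coeff s t q (int k - int b) = q ^ k * theta_coeff s t q (int k - int (Suc b))" for k
      using theta_coeff_down[OF st, of "int k - int b" b] by (simp add: algebra_simps)
    show "t * q ^ b * theta_coeff s t q (int 0 - int b) = theta_coeff s t q (int 0 - int (Suc b))"
      using down[of 0] by simp
    assume k: "0 < k" "k \<le> a + b"
    have km: "int (k - 1) - int b = int k - int (Suc b)" using k by simp
    have pw: "q ^ Suc (a + b) = q ^ (Suc (a + b) - k) * q ^ k" using k by (simp flip: power_add)
    have "t * q ^ b * (1 - q ^ (Suc (a + b) - k)) * theta_coeff s t q (int k - int b)
        = (1 - q ^ (Suc (a + b) - k)) * (t * q ^ b * theta_coeff s t q (int k - int b))"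
      by (simp only: mult_ac)
    then show "t * q ^ b * (1 - q ^ (Suc (a + b) - k)) * theta_coeff s t q (int k - int b)
        + 1 * (1 - q ^ k) * theta_coeff s t q (int (k - 1) - int b)
        = (1 - q ^ Suc (a + b)) * theta_coeff s t q (int k - int (Suc b))"
      unfolding down km pw by (simp add: algebra_simps del: power_Suc)
  qed (use Suc in auto)
  then show ?case by (simp only: triple_Suc coeff_linear_mult) simp
qed

lemma nat_minus_1_le_choose_2: "n - 1 \<le> n choose 2"
proof (induction n)
  case (Suc n)
  have "Suc n choose 2 = n + (n choose 2)" by (simp add: numeral_2_eq_2)
  then show ?case by simp
qed simp

text \<open>The bound is |m| - 1 and not |m| because \<open>t\<close> may be 1 and \<open>q\<close>
  may be X: for m = -n only q^(n choose 2) is then left.\<close>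

lemma theta_coeff_X_adic:
  fixes s t q :: "'a::comm_ring_1 fps"
  assumes "fps_X dvd s" "fps_X dvd q"
  shows "fps_X ^ (nat \<bar>m\<bar> - 1) dvd theta_coeff s t q m"
proof (cases "m \<ge> 0")
  case True
  have "fps_X ^ (nat \<bar>m\<bar> - 1) dvd (fps_X ^ nat m :: 'a fps)"
    using True by (intro le_imp_power_dvd) simp
  also have "\<dots> dvd s ^ nat m" using assms(1) by (rule dvd_power_same)
  finally show ?thesis using True by (simp add: theta_coeff_def)
next
  case False
  have "fps_X ^ (nat \<bar>m\<bar> - 1) dvd (fps_X ^ (nat (- m) choose 2) :: 'a fps)"
    using False nat_minus_1_le_choose_2[of "nat (- m)"] by (intro le_imp_power_dvd) simp
  also have "\<dots> dvd q ^ (nat (- m) choose 2)" using assms(2) by (rule dvd_power_same)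
  finally show ?thesis using False by (simp add: theta_coeff_def)
qed

text \<open>Two precisions add up. With m = k - N, the Pochhammer factors agree with the Euler
  product to order N - |m| + 1, and the theta coefficient is divisible by q^(|m| - 1). Their sum is
  at least N for every k, even near the ends, where the first precision is poor.\<close>

lemma triple_product_X_adic:
  fixes s t :: "'a::comm_ring_1 fps"
  assumes "r > 0" "s * t = fps_X ^ r" "fps_X dvd s" and k: "k \<le> 2 * N"
  shows "fps_X ^ N dvd euler r * coeff (triple s t (fps_X ^ r) N N) k
                       - theta_coeff s t (fps_X ^ r) (int k - int N)"
proof -
  define m where "m = int k - int N"
  define e where "e = nat \<bar>m\<bar> - 1"
  define d where "d = Suc (N - nat \<bar>m\<bar>)"
  define Q where "Q = qpoch (fps_X ^ r :: 'a fps)"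
  define c where "c = coeff (triple s t (fps_X ^ r) N N) k"
  define g where "g = theta_coeff s t (fps_X ^ r) m"
  have Q_c: "Q k * Q (2 * N - k) * c = Q (2 * N) * g"
    using finite_triple_product[OF assms(2), of k N N] k
    by (simp add: Q_def c_def g_def m_def mult_2)
  have Q: "fps_X ^ d dvd euler r - Q i" if "N - nat \<bar>m\<bar> \<le> i" for i
  proof -
    have "fps_X ^ d dvd (fps_X ^ Suc i :: 'a fps)"
      using that by (intro le_imp_power_dvd) (simp add: d_def)
    also have "\<dots> dvd euler r - Q i"
      unfolding Q_def using assms(1) by (rule euler_X_adic)
    finally show ?thesis .
  qed
  have "fps_X ^ d dvd euler r * euler r - euler r * Q (2 * N)"
    "fps_X ^ d dvd euler r * euler r - Q k * Q (2 * N - k)"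
    using k by (intro dvd_diff_mult Q; auto simp: m_def)+
  then have "fps_X ^ d dvd euler r * Q (2 * N) - Q k * Q (2 * N - k)"
    using dvd_diff_trans[OF dvd_diff_sym] by blast
  moreover have "fps_X ^ e dvd g"
    unfolding e_def g_def using assms by (intro theta_coeff_X_adic) (auto simp: dvd_power)
  ultimately have "fps_X ^ d * fps_X ^ e dvd (euler r * Q (2 * N) - Q k * Q (2 * N - k)) * g"
    by (rule mult_dvd_mono)
  also have "(euler r * Q (2 * N) - Q k * Q (2 * N - k)) * g
      = euler r * (Q k * Q (2 * N - k) * c) - Q k * Q (2 * N - k) * g"
    unfolding Q_c by (simp add: algebra_simps)
  also have "\<dots> = Q k * (Q (2 * N - k) * (euler r * c - g))" by (simp add: algebra_simps)
  finally have "fps_X ^ (d + e) dvd Q k * (Q (2 * N - k) * (euler r * c - g))"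
    by (simp only: power_add)
  then have "fps_X ^ (d + e) dvd Q (2 * N - k) * (euler r * c - g)"
    unfolding Q_def by (rule unit_dvd_cancel[OF qpoch_unit[OF assms(1)]])
  then have "fps_X ^ (d + e) dvd euler r * c - g"
    unfolding Q_def by (rule unit_dvd_cancel[OF qpoch_unit[OF assms(1)]])
  moreover have "N \<le> d + e" using k by (simp add: d_def e_def m_def)
  ultimately show ?thesis
    unfolding c_def g_def m_def using dvd_trans[OF le_imp_power_dvd] by blast
qed

section \<open>Constant terms of products of triple products as lattice sums\<close>

lemma coeff_prod_eq_sum_PiE:
  fixes p :: "'b \<Rightarrow> 'a::comm_ring_1 poly"
  assumes "finite I" "\<And>j. j \<in> I \<Longrightarrow> degree (p j) \<le> D"
  shows "coeff (\<Prod>j\<in>I. p j) K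
    = (\<Sum>v | v \<in> PiE I (\<lambda>_. {..D}) \<and> sum v I = K. \<Prod>j\<in>I. coeff (p j) (v j))"
proof -
  have mon: "(\<Prod>j\<in>I. monom (coeff (p j) (v j)) (v j)) = monom (\<Prod>j\<in>I. coeff (p j) (v j)) (sum v I)" for v
    using assms(1) by (induction I) (auto simp: mult_monom)
  have "(\<Prod>j\<in>I. p j) = (\<Prod>j\<in>I. \<Sum>k\<le>D. monom (coeff (p j) k) k)"
    using assms(2) by (intro prod.cong refl) (simp add: poly_as_sum_of_monoms')
  also have "\<dots> = (\<Sum>v\<in>PiE I (\<lambda>_. {..D}). \<Prod>j\<in>I. monom (coeff (p j) (v j)) (v j))"
    by (rule prod_sum_PiE) (use assms in auto)
  finally have "coeff (\<Prod>j\<in>I. p j) K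
     = (\<Sum>v\<in>PiE I (\<lambda>_. {..D}). if sum v I = K then \<Prod>j\<in>I. coeff (p j) (v j) else 0)"
    by (simp add: coeff_sum mon)
  also have "\<dots> = (\<Sum>v | v \<in> PiE I (\<lambda>_. {..D}) \<and> sum v I = K. \<Prod>j\<in>I. coeff (p j) (v j))"
    using assms(1) by (simp add: sum.inter_filter[symmetric] finite_PiE conj_commute)
  finally show ?thesis .
qed

text \<open>Each factor carries the shift z^N, so the coefficient at \<open>card I * N\<close> is
  the constant term in z. Lowering every exponent by N turns the index tuples into integer vectors
  of sum 0, which is how the root lattice enters.\<close>

lemma const_term_X_adic:
  fixes s t :: "'b \<Rightarrow> 'a::comm_ring_1 fps"
  assumes "finite I" "r > 0" and st: "\<And>j. j \<in> I \<Longrightarrow> s j * t j = fps_X ^ r"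
    "\<And>j. j \<in> I \<Longrightarrow> fps_X dvd s j"
  shows "fps_X ^ N dvd
     euler r ^ card I * coeff (\<Prod>j\<in>I. triple (s j) (t j) (fps_X ^ r) N N) (card I * N)
     - (\<Sum>v | v \<in> PiE I (\<lambda>_. {- int N..int N}) \<and> sum v I = 0.
          \<Prod>j\<in>I. theta_coeff (s j) (t j) (fps_X ^ r) (v j))"
proof -
  define V where "V = {v. v \<in> PiE I (\<lambda>_. {..2 * N}) \<and> sum v I = card I * N}"
  define W where "W = {v. v \<in> PiE I (\<lambda>_. {- int N..int N}) \<and> sum v I = 0}"
  define f where "f v = (\<lambda>j\<in>I. int (v j) - int N)" for v
  define g where "g w = (\<lambda>j\<in>I. nat (w j + int N))" for w
  let ?T = "\<lambda>j. triple (s j) (t j) (fps_X ^ r) N N"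
  let ?G = "\<lambda>j. theta_coeff (s j) (t j) (fps_X ^ r)"
  have "coeff (\<Prod>j\<in>I. ?T j) (card I * N) = (\<Sum>v\<in>V. \<Prod>j\<in>I. coeff (?T j) (v j))"
    unfolding V_def using assms(1) degree_triple[where a = N and b = N]
    by (intro coeff_prod_eq_sum_PiE) (auto simp: mult_2)
  then have "euler r ^ card I * coeff (\<Prod>j\<in>I. ?T j) (card I * N)
      = (\<Sum>v\<in>V. \<Prod>j\<in>I. euler r * coeff (?T j) (v j))"
    by (simp add: sum_distrib_left prod.distrib)
  moreover have "fps_X ^ N dvd (\<Sum>v\<in>V. \<Prod>j\<in>I. euler r * coeff (?T j) (v j))
      - (\<Sum>v\<in>V. \<Prod>j\<in>I. ?G j (int (v j) - int N))"
    by (intro dvd_diff_sum dvd_diff_prod triple_product_X_adic assms) (auto simp: V_def PiE_def Pi_def)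
  moreover have "(\<Sum>v\<in>V. \<Prod>j\<in>I. ?G j (int (v j) - int N)) = (\<Sum>w\<in>W. \<Prod>j\<in>I. ?G j (w j))"
  proof (rule sum.reindex_bij_witness[of _ g f])
    fix v assume v: "v \<in> V"
    show "g (f v) = v"
      using v by (auto simp: V_def f_def g_def PiE_def extensional_def restrict_def fun_eq_iff)
    have "sum (f v) I = int (sum v I) - int (card I * N)"
      by (simp add: f_def sum_subtractf)
    also have "\<dots> = 0" using v by (simp add: V_def)
    finally show "f v \<in> W"
      using v by (auto simp: W_def V_def f_def PiE_def Pi_def)
    show "(\<Prod>j\<in>I. ?G j (f v j)) = (\<Prod>j\<in>I. ?G j (int (v j) - int N))"
      by (simp add: f_def)
  next
    fix w assume w: "w \<in> W"
    have ge: "w j + int N \<ge> 0" "w j \<le> int N" if "j \<in> I" for j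
      using w that by (fastforce simp: W_def PiE_def Pi_def)+
    show "f (g w) = w"
      using w ge(1) by (auto simp: W_def f_def g_def PiE_def extensional_def restrict_def fun_eq_iff)
    have "int (sum (g w) I) = (\<Sum>j\<in>I. w j + int N)"
      using ge(1) by (simp add: g_def)
    also have "\<dots> = int (card I * N)" using w by (simp add: W_def sum.distrib)
    finally have "sum (g w) I = card I * N" by linarith
    moreover have "nat (w j + int N) \<le> 2 * N" if "j \<in> I" for j
      using ge[OF that] by linarith
    ultimately show "g w \<in> V"
      by (auto simp: V_def g_def PiE_def Pi_def)
  qed
  ultimately show ?thesis unfolding W_def by simp
qed

text \<open>The natural number ((a + b) m^2 + (a - b) m) / 2, the power of q that accompanies z^m
  when \<open>s\<close> and \<open>t\<close> are constants times q^a and q^b.\<close>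

definition theta_exp :: "nat \<Rightarrow> nat \<Rightarrow> int \<Rightarrow> nat" where
  "theta_exp a b m = (if m \<ge> 0 then a * nat m + (a + b) * (nat m choose 2)
                               else b * nat (- m) + (a + b) * (nat (- m) choose 2))"

lemma two_times_choose_2: "2 * int (n choose 2) = int n * (int n - 1)"
proof (induction n)
  case (Suc n)
  have "Suc n choose 2 = n + (n choose 2)" by (simp add: numeral_2_eq_2)
  with Suc show ?case by (simp add: algebra_simps)
qed (simp add: numeral_2_eq_2)

lemma two_times_theta_exp:
  "2 * int (theta_exp a b m) = int (a + b) * m\<^sup>2 + (int a - int b) * m"
proof (cases "m \<ge> 0")
  case True
  then have "2 * int (theta_exp a b m) = 2 * (int a * m) + int (a + b) * (2 * int (nat m choose 2))"
    by (simp add: theta_exp_def algebra_simps)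
  then show ?thesis
    unfolding two_times_choose_2 using True by (simp add: algebra_simps power2_eq_square)
next
  case False
  then have "2 * int (theta_exp a b m) = 2 * (int b * (- m)) + int (a + b) * (2 * int (nat (- m) choose 2))"
    by (simp add: theta_exp_def algebra_simps)
  then show ?thesis
    unfolding two_times_choose_2 using False by (simp add: algebra_simps power2_eq_square)
qed

lemma theta_exp_ge:
  assumes "a > 0"
  shows "nat \<bar>m\<bar> - 1 \<le> theta_exp a b m"
proof (cases "m \<ge> 0")
  case True
  have "nat m \<le> a * nat m" using assms by simp
  then have "nat m \<le> a * nat m + (a + b) * (nat m choose 2)" by (rule trans_le_add1)
  then show ?thesis using True unfolding theta_exp_def by simp
next
  case False
  have "nat (- m) choose 2 \<le> (a + b) * (nat (- m) choose 2)" using assms by simp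
  then have "nat (- m) choose 2 \<le> b * nat (- m) + (a + b) * (nat (- m) choose 2)" by (rule trans_le_add2)
  then show ?thesis
    using False nat_minus_1_le_choose_2[of "nat (- m)"] unfolding theta_exp_def by simp
qed

lemma theta_coeff_monomial:
  "theta_coeff (fps_const u * fps_X ^ a) (fps_const u' * fps_X ^ b) (fps_X ^ (a + b)) m
     = fps_const (theta_coeff u u' 1 m) * (fps_X :: 'a::comm_ring_1 fps) ^ theta_exp a b m"
  by (simp add: theta_coeff_def theta_exp_def power_mult_distrib power_add fps_const_power add_mult_distrib
      mult.assoc flip: power_mult)

text \<open>Agreement to order N becomes an exact coefficient formula: \<open>theta_exp_ge\<close>
  forces |v j| <= n + 1 <= N on each contributing vector, so the box of exponents cuts nothing off.
  Positivity of \<open>a j\<close> gives this bound, while \<open>b j = 0\<close> stays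
  allowed.\<close>

lemma const_term_nth:
  fixes u u' :: "'b \<Rightarrow> 'a::comm_ring_1" and a b :: "'b \<Rightarrow> nat"
  assumes "finite I" "n < N" "r > 0"
    and "\<And>j. j \<in> I \<Longrightarrow> a j + b j = r" "\<And>j. j \<in> I \<Longrightarrow> a j > 0" "\<And>j. j \<in> I \<Longrightarrow> u j * u' j = 1"
  shows "(euler r ^ card I * coeff (\<Prod>j\<in>I. triple (fps_const (u j) * fps_X ^ a j)
            (fps_const (u' j) * fps_X ^ b j) (fps_X ^ r) N N) (card I * N)) $ n
     = (\<Sum>v | v \<in> PiE I (\<lambda>_. UNIV) \<and> sum v I = 0 \<and> (\<Sum>j\<in>I. theta_exp (a j) (b j) (v j)) = n.
          \<Prod>j\<in>I. theta_coeff (u j) (u' j) 1 (v j))"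
proof -
  define W where "W = {v. v \<in> PiE I (\<lambda>_. {- int N..int N}) \<and> sum v I = 0}"
  let ?s = "\<lambda>j. fps_const (u j) * fps_X ^ a j" and ?t = "\<lambda>j. fps_const (u' j) * fps_X ^ b j"
  have finW: "finite W" unfolding W_def using assms(1) by (auto intro: finite_subset[OF _ finite_PiE[of I "\<lambda>_. {- int N..int N}"]])
  have st: "?s j * ?t j = fps_X ^ r" if "j \<in> I" for j
  proof -
    have "?s j * ?t j = (fps_const (u j) * fps_const (u' j)) * (fps_X ^ a j * fps_X ^ b j)"
      by (simp only: mult_ac)
    also have "\<dots> = fps_X ^ r" using assms(4,6)[OF that] by (simp flip: power_add)
    finally show ?thesis .
  qed
  have mon: "(\<Prod>j\<in>I. theta_coeff (?s j) (?t j) (fps_X ^ r) (v j))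
      = fps_const (\<Prod>j\<in>I. theta_coeff (u j) (u' j) 1 (v j)) * fps_X ^ (\<Sum>j\<in>I. theta_exp (a j) (b j) (v j))" for v
  proof -
    have "(\<Prod>j\<in>I. theta_coeff (?s j) (?t j) (fps_X ^ r) (v j))
        = (\<Prod>j\<in>I. fps_const (theta_coeff (u j) (u' j) 1 (v j)) * fps_X ^ theta_exp (a j) (b j) (v j))"
    proof (rule prod.cong)
      fix j assume "j \<in> I"
      show "theta_coeff (?s j) (?t j) (fps_X ^ r) (v j)
          = fps_const (theta_coeff (u j) (u' j) 1 (v j)) * fps_X ^ theta_exp (a j) (b j) (v j)"
        using theta_coeff_monomial[of "u j" "a j" "u' j" "b j" "v j"] assms(4)[OF \<open>j \<in> I\<close>] by simp
    qed simp
    also have "\<dots> = fps_const (\<Prod>j\<in>I. theta_coeff (u j) (u' j) 1 (v j)) * fps_X ^ (\<Sum>j\<in>I. theta_exp (a j) (b j) (v j))"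
      using assms(1) by (induction I) (auto simp: power_add mult_ac simp flip: fps_const_mult)
    finally show ?thesis .
  qed
  have "fps_X ^ N dvd euler r ^ card I * coeff (\<Prod>j\<in>I. triple (?s j) (?t j) (fps_X ^ r) N N) (card I * N)
     - (\<Sum>v\<in>W. \<Prod>j\<in>I. theta_coeff (?s j) (?t j) (fps_X ^ r) (v j))"
    unfolding W_def using assms st by (intro const_term_X_adic) (auto simp: dvd_power dvd_mult)
  then have "(euler r ^ card I * coeff (\<Prod>j\<in>I. triple (?s j) (?t j) (fps_X ^ r) N N) (card I * N)) $ n
     = (\<Sum>v\<in>W. \<Prod>j\<in>I. theta_coeff (?s j) (?t j) (fps_X ^ r) (v j)) $ n"
    unfolding X_power_dvd_iff using assms(2) by simp
  also have "\<dots> = (\<Sum>v\<in>W. fps_const (\<Prod>j\<in>I. theta_coeff (u j) (u' j) 1 (v j)) * fps_X ^ (\<Sum>j\<in>I. theta_exp (a j) (b j) (v j))) $ n"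
    unfolding mon ..
  also have "\<dots> = (\<Sum>v\<in>W. if (\<Sum>j\<in>I. theta_exp (a j) (b j) (v j)) = n then \<Prod>j\<in>I. theta_coeff (u j) (u' j) 1 (v j) else 0)"
    unfolding fps_sum_nth by (intro sum.cong refl) simp
  also have "\<dots> = (\<Sum>v | v \<in> W \<and> (\<Sum>j\<in>I. theta_exp (a j) (b j) (v j)) = n.
     \<Prod>j\<in>I. theta_coeff (u j) (u' j) 1 (v j))"
    using finW by (simp add: sum.inter_filter)
  also have "{v \<in> W. (\<Sum>j\<in>I. theta_exp (a j) (b j) (v j)) = n} =
    {v. v \<in> PiE I (\<lambda>_. UNIV) \<and> sum v I = 0 \<and> (\<Sum>j\<in>I. theta_exp (a j) (b j) (v j)) = n}"
  proof -
    have "v j \<in> {- int N..int N}" if "(\<Sum>j\<in>I. theta_exp (a j) (b j) (v j)) = n" "j \<in> I" for v j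
    proof -
      have "nat \<bar>v j\<bar> - 1 \<le> theta_exp (a j) (b j) (v j)"
        using that assms(5) by (intro theta_exp_ge) auto
      also have "\<dots> \<le> n" using that assms(1) by (auto intro: member_le_sum)
      finally show ?thesis using assms(2) by auto
    qed
    then show ?thesis by (auto simp: W_def PiE_def Pi_def)
  qed
  finally show ?thesis .
qed

text \<open>The weight covers two specializations at z = 1 of the triple product:
  \<open>c m = 1\<close> gives its value, and \<open>c m = m\<close> the result of applying z
  d/dz.\<close>

lemma triple_weighted_sum_nth:
  fixes u u' :: "'a::comm_ring_1"
  assumes "n < N" "a > 0" "u * u' = 1"
  shows "(euler (a + b) * (\<Sum>k\<le>2 * N. fps_const (c (int k - int N)) *
            coeff (triple (fps_const u * fps_X ^ a) (fps_const u' * fps_X ^ b) (fps_X ^ (a + b)) N N) k)) $ n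
     = (\<Sum>m | theta_exp a b m = n. c m * theta_coeff u u' 1 m)"
proof -
  let ?s = "fps_const u * fps_X ^ a" and ?t = "fps_const u' * fps_X ^ b"
  let ?q = "fps_X ^ (a + b) :: 'a fps"
  have "?s * ?t = (fps_const u * fps_const u') * (fps_X ^ a * fps_X ^ b)"
    by (simp only: mult_ac)
  also have "\<dots> = ?q" using assms by (simp add: power_add)
  finally have st: "?s * ?t = ?q" .
  have "fps_X ^ N dvd (\<Sum>k\<le>2 * N. fps_const (c (int k - int N)) * (euler (a + b) * coeff (triple ?s ?t ?q N N) k))
      - (\<Sum>k\<le>2 * N. fps_const (c (int k - int N)) * theta_coeff ?s ?t ?q (int k - int N))"
    using assms st by (intro dvd_diff_sum dvd_diff_mult triple_product_X_adic) (auto simp: dvd_power dvd_mult)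
  moreover have "(\<Sum>k\<le>2 * N. fps_const (c (int k - int N)) * theta_coeff ?s ?t ?q (int k - int N))
      = (\<Sum>m\<in>{- int N..int N}. fps_const (c m) * theta_coeff ?s ?t ?q m)"
    by (rule sum.reindex_bij_witness[of _ "\<lambda>m. nat (m + int N)" "\<lambda>k. int k - int N"]) auto
  ultimately have "(\<Sum>k\<le>2 * N. fps_const (c (int k - int N)) * (euler (a + b) * coeff (triple ?s ?t ?q N N) k)) $ n
      = (\<Sum>m\<in>{- int N..int N}. fps_const (c m) * theta_coeff ?s ?t ?q m) $ n"
    unfolding X_power_dvd_iff using assms(1) by simp
  also have "\<dots> = (\<Sum>m\<in>{- int N..int N}. if theta_exp a b m = n then c m * theta_coeff u u' 1 m else 0)"
    unfolding fps_sum_nth theta_coeff_monomial by (intro sum.cong refl) simp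
  also have "\<dots> = (\<Sum>m | m \<in> {- int N..int N} \<and> theta_exp a b m = n. c m * theta_coeff u u' 1 m)"
    by (simp add: sum.inter_filter[symmetric] conj_commute)
  also have "{m. m \<in> {- int N..int N} \<and> theta_exp a b m = n} = {m. theta_exp a b m = n}"
  proof -
    have "m \<in> {- int N..int N}" if "theta_exp a b m = n" for m
      using theta_exp_ge[OF assms(2), of m b] assms(1) that by auto
    then show ?thesis by blast
  qed
  finally show ?thesis
    by (simp add: sum_distrib_left mult.left_commute)
qed

section \<open>Euler's pentagonal number theorem and Jacobi's formula for the cube\<close>

lemma theta_coeff_minus_1:
  "theta_coeff (- 1) (- 1) 1 m = (if even m then 1 else - 1 :: int)"
  by (auto simp: theta_coeff_def even_nat_iff minus_one_power_iff)

lemma poly_1_eq_sum_coeff: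
  fixes p :: "'a::comm_ring_1 poly"
  shows "degree p \<le> D \<Longrightarrow> poly p 1 = (\<Sum>k\<le>D. coeff p k)"
  by (subst poly_as_sum_of_monoms'[symmetric]) (simp_all add: poly_sum poly_monom)

lemma poly_pderiv_1_eq_sum_coeff:
  fixes p :: "'a::idom poly"
  assumes "degree p \<le> D"
  shows "poly (pderiv p) 1 = (\<Sum>k\<le>D. of_nat k * coeff p k)"
proof -
  have pderiv_sum: "pderiv (\<Sum>k\<in>A. f k) = (\<Sum>k\<in>A. pderiv (f k))" for A and f :: "nat \<Rightarrow> 'a poly"
    by (induction A rule: infinite_finite_induct) (auto simp: pderiv_add)
  have "pderiv p = (\<Sum>k\<le>D. monom (of_nat k * coeff p k) (k - 1))"
    by (subst poly_as_sum_of_monoms'[OF assms, symmetric])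
      (simp add: pderiv_sum pderiv_monom)
  then show ?thesis by (simp add: poly_sum poly_monom)
qed

lemma prod_lessThan_3:
  "(\<Prod>i<3 * n. f i) = (\<Prod>i<n. f (3 * i) * f (3 * i + 1) * f (3 * i + 2 :: nat))"
proof (induction n)
  case (Suc n)
  have "3 * Suc n = Suc (Suc (Suc (3 * n)))" by simp
  then have "(\<Prod>i<3 * Suc n. f i) = (\<Prod>i<3 * n. f i) * f (3 * n) * f (3 * n + 1) * f (3 * n + 2)"
    by (simp only: prod.lessThan_Suc) simp
  then show ?case using Suc by (simp add: mult.assoc)
qed simp

lemma fps_const_minus_1 [simp]: "fps_const (- 1 :: 'a::comm_ring_1) = - 1"
  by (metis fps_const_1_eq_1 fps_const_neg)

text \<open>At z = 1, with s = -q^2, t = -q and base q^3, the three families of factors are 1 - q^j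
  for j in the classes 0, 2 and 1 modulo 3; together they fill one Euler product.\<close>

theorem pentagonal_number_theorem:
  "euler 1 $ n = (\<Sum>m | m * (3 * m + 1) = 2 * int n. if even m then 1 else - 1 :: int)"
proof -
  define N where "N = Suc n"
  let ?s = "fps_const (- 1) * fps_X ^ 2 :: int fps" and ?t = "fps_const (- 1) * fps_X ^ 1 :: int fps"
  let ?q = "fps_X ^ (2 + 1) :: int fps"
  let ?T = "triple ?s ?t ?q N N"
  have "qpoch ?q N * poly ?T 1 = (\<Prod>i<N. (1 - ?q ^ Suc i) * (1 + ?s * ?q ^ i) * (?t * ?q ^ i + 1))"
    by (simp add: triple_def poly_prod qpoch_def prod.distrib mult.assoc)
  also have "\<dots> = (\<Prod>i<N. (1 - (fps_X ^ 1) ^ Suc (3 * i)) * (1 - (fps_X ^ 1) ^ Suc (3 * i + 1)) * (1 - (fps_X ^ 1) ^ Suc (3 * i + 2)))"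
  proof (intro prod.cong refl)
    fix i
    have Y: "?q ^ i = fps_X ^ (3 * i)" by (simp add: power_mult)
    show "(1 - ?q ^ Suc i) * (1 + ?s * ?q ^ i) * (?t * ?q ^ i + 1)
      = (1 - (fps_X ^ 1) ^ Suc (3 * i)) * (1 - (fps_X ^ 1) ^ Suc (3 * i + 1)) * (1 - (fps_X ^ 1) ^ Suc (3 * i + 2))"
      unfolding power_Suc Y by (simp add: mult_ac power2_eq_square power3_eq_cube)
  qed
  also have "\<dots> = qpoch (fps_X ^ 1) (3 * N)"
    unfolding qpoch_def prod_lessThan_3 ..
  finally have *: "qpoch ?q N * poly ?T 1 = qpoch (fps_X ^ 1) (3 * N)" .
  have "fps_X ^ Suc n dvd euler (2 + 1) * poly ?T 1 - qpoch ?q N * poly ?T 1"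
    by (intro dvd_diff_mult dvd_trans[OF le_imp_power_dvd euler_X_adic]) (auto simp: N_def)
  moreover have "fps_X ^ Suc n dvd euler 1 - qpoch (fps_X ^ 1 :: int fps) (3 * N)"
    by (rule dvd_trans[OF le_imp_power_dvd euler_X_adic]) (auto simp: N_def)
  ultimately have "fps_X ^ Suc n dvd euler (2 + 1) * poly ?T 1 - euler 1"
    unfolding * using dvd_diff_trans dvd_diff_sym by blast
  then have "euler 1 $ n = (euler (2 + 1) * poly ?T 1) $ n"
    unfolding X_power_dvd_iff by simp
  also have "poly ?T 1 = (\<Sum>k\<le>2 * N. fps_const ((\<lambda>_. 1) (int k - int N)) * coeff ?T k)"
    using degree_triple[of ?s ?t ?q N N] by (subst poly_1_eq_sum_coeff[of _ "2 * N"]) (auto simp: mult_2)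
  also have "(euler (2 + 1) * (\<Sum>k\<le>2 * N. fps_const ((\<lambda>_. 1) (int k - int N)) * coeff ?T k)) $ n
      = (\<Sum>m | theta_exp 2 1 m = n. 1 * theta_coeff (- 1) (- 1) 1 m)"
    by (rule triple_weighted_sum_nth) (auto simp: N_def)
  also have "{m. theta_exp 2 1 m = n} = {m. m * (3 * m + 1) = 2 * int n}"
  proof -
    have "theta_exp 2 1 m = n \<longleftrightarrow> m * (3 * m + 1) = 2 * int n" for m
      using two_times_theta_exp[of 2 1 m] by (auto simp: algebra_simps power2_eq_square)
    then show ?thesis by simp
  qed
  finally show ?thesis by (simp add: theta_coeff_minus_1)
qed

text \<open>With t = -1 the product contains the factor z - 1, so its derivative at z = 1 is the
  product of the remaining factors. Pairing m with -1 - m recovers Jacobi's coefficients (-1)^m (2m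
  + 1).\<close>

theorem jacobi_cube:
  "(euler 1 ^ 3) $ n = (\<Sum>m | m * (m + 1) = 2 * int n. if even m then m else - m :: int)"
proof -
  define N where "N = Suc n"
  let ?s = "fps_const (- 1) * fps_X ^ 1 :: int fps" and ?t = "fps_const (- 1) * fps_X ^ 0 :: int fps"
  let ?q = "fps_X ^ (1 + 0) :: int fps"
  let ?T = "triple ?s ?t ?q N N"
  define R where "R = (\<Prod>i<N. [:1, ?s * ?q ^ i:]) * (\<Prod>i<n. [:?t * ?q ^ Suc i, 1:])"
  have T: "?T = [:- 1, 1:] * R"
  proof -
    have "(\<Prod>i<N. [:?t * ?q ^ i, 1:]) = [:- 1, 1:] * (\<Prod>i<n. [:?t * ?q ^ Suc i, 1:])"
      unfolding N_def by (subst prod.lessThan_Suc_shift) simp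
    then show ?thesis unfolding triple_def R_def by (simp only: mult_ac)
  qed
  have "poly (pderiv ?T) 1 = poly R 1"
    unfolding T pderiv_mult by (simp add: pderiv_pCons)
  also have "\<dots> = qpoch ?q N * qpoch ?q n"
    by (simp add: R_def poly_prod qpoch_def)
  finally have R: "poly (pderiv ?T) 1 = qpoch ?q N * qpoch ?q n" .
  have deg: "degree ?T \<le> 2 * N"
    using degree_triple[of ?s ?t ?q N N] by (simp add: mult_2)
  \<comment> \<open>The weight k - N undoes the shift by z^N. The part with N is a multiple of the
    value at z = 1, which vanishes.\<close>
  have "(\<Sum>k\<le>2 * N. fps_const (int k - int N) * coeff ?T k)
      = (\<Sum>k\<le>2 * N. of_nat k * coeff ?T k) - of_nat N * (\<Sum>k\<le>2 * N. coeff ?T k)"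
    by (simp add: sum_distrib_left sum_subtractf[symmetric] left_diff_distrib[symmetric] fps_of_int[symmetric] fps_of_nat[symmetric] flip: fps_const_sub)
  also have "\<dots> = poly (pderiv ?T) 1 - of_nat N * poly ?T 1"
    by (simp only: poly_1_eq_sum_coeff[OF deg] poly_pderiv_1_eq_sum_coeff[OF deg])
  also have "poly ?T 1 = 0" unfolding T by simp
  finally have S: "(\<Sum>k\<le>2 * N. fps_const (int k - int N) * coeff ?T k) = qpoch ?q N * qpoch ?q n"
    using R by simp
  have "fps_X ^ Suc n dvd euler 1 - qpoch ?q i" if "i \<ge> n" for i
  proof -
    have "fps_X ^ Suc n dvd (fps_X ^ Suc i :: int fps)" using that by (intro le_imp_power_dvd) simp
    also have "\<dots> dvd euler (1 + 0) - qpoch ?q i" by (rule euler_X_adic) simp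
    finally show ?thesis by simp
  qed
  then have "fps_X ^ Suc n dvd euler 1 * (euler 1 * euler 1) - euler 1 * (qpoch ?q N * qpoch ?q n)"
    by (intro dvd_diff_mult) (auto simp: N_def simp del: power_Suc)
  then have "(euler 1 ^ 3) $ n = (euler (1 + 0) * (\<Sum>k\<le>2 * N. fps_const (int k - int N) * coeff ?T k)) $ n"
    unfolding X_power_dvd_iff S by (simp add: power3_eq_cube mult.assoc)
  also have "\<dots> = (\<Sum>m | theta_exp 1 0 m = n. m * theta_coeff (- 1) (- 1) 1 m)"
    by (rule triple_weighted_sum_nth[where c = "\<lambda>m. m"]) (auto simp: N_def)
  also have "{m. theta_exp 1 0 m = n} = {m. m * (m + 1) = 2 * int n}"
  proof -
    have "theta_exp 1 0 m = n \<longleftrightarrow> m * (m + 1) = 2 * int n" for m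
      using two_times_theta_exp[of 1 0 m] by (auto simp: algebra_simps power2_eq_square)
    then show ?thesis by simp
  qed
  finally show ?thesis by (simp add: theta_coeff_minus_1 if_distrib cong: if_cong)
qed

section \<open>Dissection modulo 7\<close>

lemma fps_compose_X_power_nth:
  fixes f :: "'a::comm_ring_1 fps"
  assumes "d > 0"
  shows "(f oo fps_X ^ d) $ n = (if d dvd n then f $ (n div d) else 0)"
proof -
  have "(f oo fps_X ^ d) $ n = (\<Sum>i=0..n. if n = d * i then f $ i else 0)"
    unfolding fps_compose_nth by (intro sum.cong refl) (simp flip: power_mult)
  also have "\<dots> = (\<Sum>i\<in>{i. i \<le> n \<and> n = d * i}. f $ i)"
    by (simp add: sum.inter_filter[symmetric] conj_commute)
  also have "{i. i \<le> n \<and> n = d * i} = (if d dvd n then {n div d} else {})"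
    using assms by auto
  finally show ?thesis by auto
qed

lemma euler_compose_X_power:
  assumes "d > 0" "k > 0"
  shows "euler k oo fps_X ^ d = (euler (k * d) :: int fps)"
proof (rule fps_ext)
  fix n
  have X0: "(fps_X ^ d :: int fps) $ 0 = 0" using assms by (simp add: fps_power_zeroth zero_power)
  have fac: "(1 - (fps_X ^ k) ^ i) oo fps_X ^ d = (1 - (fps_X ^ (k * d)) ^ i :: int fps)" for i
    using assms by (simp add: fps_compose_sub_distrib fps_compose_power[OF X0, symmetric] X0 mult_ac flip: power_mult)
  have comp: "qpoch (fps_X ^ k) n oo fps_X ^ d = (qpoch (fps_X ^ (k * d)) n :: int fps)"
    unfolding qpoch_def fps_compose_prod_distrib[OF X0] fac ..
  have eu: "euler l $ m = (qpoch (fps_X ^ l) n :: int fps) $ m" if "m \<le> n" "l > 0" for l m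
    using euler_X_adic[OF that(2), of n, where ?'a = int] that(1) unfolding X_power_dvd_iff by simp
  show "(euler k oo fps_X ^ d) $ n = (euler (k * d) :: int fps) $ n"
    using arg_cong[OF comp, of "\<lambda>f. f $ n"] assms eu[of n "k * d"] eu[of "n div d" k]
    by (simp add: fps_compose_X_power_nth split: if_splits)
qed

section \<open>Series supported on one residue class modulo 7\<close>

definition residue_class :: "nat \<Rightarrow> int fps \<Rightarrow> bool" where
  "residue_class r f \<longleftrightarrow> (\<forall>n. f $ n \<noteq> 0 \<longrightarrow> n mod 7 = r)"

definition part :: "nat \<Rightarrow> int fps \<Rightarrow> int fps" where
  "part r f = Abs_fps (\<lambda>n. if n mod 7 = r then f $ n else 0)"

lemma residue_class_mult:
  assumes "residue_class r f" "residue_class s g" "(r + s) mod 7 = t"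
  shows "residue_class t (f * g)"
  unfolding residue_class_def
proof (intro allI impI)
  fix n assume "(f * g) $ n \<noteq> 0"
  then have "(\<Sum>i=0..n. f $ i * g $ (n - i)) \<noteq> 0" by (simp add: fps_mult_nth)
  then obtain i where "i \<in> {0..n}" "f $ i * g $ (n - i) \<noteq> 0" by (rule sum.not_neutral_contains_not_neutral)
  then have i: "i \<le> n" "f $ i \<noteq> 0" "g $ (n - i) \<noteq> 0" by auto
  then have "i mod 7 = r" "(n - i) mod 7 = s" using assms by (auto simp: residue_class_def)
  then have "(r + s) mod 7 = (i + (n - i)) mod 7" by (metis mod_add_eq)
  then show "n mod 7 = t" using i assms(3) by simp
qed

lemma residue_class_add: "residue_class r f \<Longrightarrow> residue_class r g \<Longrightarrow> residue_class r (f + g)"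
  by (force simp: residue_class_def)

lemma residue_class_uminus: "residue_class r f \<Longrightarrow> residue_class r (- f)"
  by (simp add: residue_class_def)

lemma residue_class_diff: "residue_class r f \<Longrightarrow> residue_class r g \<Longrightarrow> residue_class r (f - g)"
  by (force simp: residue_class_def)

lemma residue_class_of_int: "residue_class 0 (numeral m)" "residue_class 0 1"
  by (auto simp: residue_class_def fps_numeral_nth)

lemma residue_class_power_0: "residue_class 0 f \<Longrightarrow> residue_class 0 (f ^ n)"
  by (induction n) (auto intro: residue_class_of_int residue_class_mult)

lemma residue_class_X_power: "residue_class (n mod 7) (fps_X ^ n)"
  by (simp add: residue_class_def)

lemma residue_class_part: "residue_class r (part r f)"
  by (simp add: residue_class_def part_def)

lemma part_if_residue_class: "residue_class s f \<Longrightarrow> part r f = (if r = s then f else 0)"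
  by (auto simp: residue_class_def part_def fps_eq_iff)

lemma part_add: "part r (f + g) = part r f + part r g"
  by (simp add: part_def fps_eq_iff)

lemma fps_eq_sum_parts: "f = part 0 f + part 1 f + part 2 f + part 3 f + part 4 f + part 5 f + part 6 f"
proof (rule fps_ext)
  fix n :: nat
  have "n mod 7 = 0 \<or> n mod 7 = 1 \<or> n mod 7 = 2 \<or> n mod 7 = 3 \<or> n mod 7 = 4 \<or> n mod 7 = 5 \<or> n mod 7 = 6"
    by linarith
  then show "f $ n = (part 0 f + part 1 f + part 2 f + part 3 f + part 4 f + part 5 f + part 6 f) $ n"
    by (auto simp: part_def)
qed

lemma part_mult:
  assumes f: "residue_class 0 f" and r: "r < 7"
  shows "part r (f * g) = f * part r g"
proof -
  have *: "part r (f * part s g) = (if r = s then f * part s g else 0)" if "s < 7" for r s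
    using residue_class_mult[OF f residue_class_part[of s g], of s] that part_if_residue_class by simp
  have "part r (f * g) = part r (f * (part 0 g + part 1 g + part 2 g + part 3 g + part 4 g + part 5 g + part 6 g))"
    by (subst fps_eq_sum_parts[of g]) (rule refl)
  also have "\<dots> = part r (f * part 0 g) + part r (f * part 1 g) + part r (f * part 2 g) + part r (f * part 3 g)
      + part r (f * part 4 g) + part r (f * part 5 g) + part r (f * part 6 g)"
    by (simp only: distrib_left part_add)
  also have "\<dots> = f * part r g"
  proof -
    have "r = 0 \<or> r = 1 \<or> r = 2 \<or> r = 3 \<or> r = 4 \<or> r = 5 \<or> r = 6" using r by linarith
    then show ?thesis by (elim disjE) (simp_all add: *)
  qed
  finally show ?thesis .
qed

lemma residue_class_inverse:
  assumes "residue_class 0 f" "f * g = 1"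
  shows "residue_class 0 g"
proof -
  have "f * part 0 g = part 0 (f * g)" using part_mult[OF assms(1)] by simp
  also have "\<dots> = f * g" using part_if_residue_class[OF residue_class_of_int(2)] assms(2) by simp
  finally have "f * part 0 g = f * g" .
  moreover have "f \<noteq> 0" using assms(2) by auto
  ultimately have "part 0 g = g" by simp
  then show ?thesis using residue_class_part[of 0 g] by simp
qed

lemma residue_class_euler:
  assumes "d > 0"
  shows "residue_class 0 (euler (7 * d))"
proof -
  have "residue_class 0 (euler 1 oo fps_X ^ (7 * d))"
    using assms by (auto simp: residue_class_def fps_compose_X_power_nth split: if_splits)
  then show ?thesis using euler_compose_X_power[of "7 * d" 1] assms by simp
qed

lemma int_mod_7: "int n mod 7 = int (n mod 7)"
  by (simp add: zmod_int)

text \<open>Here 24 n + 1 = (6 m + 1)^2. Classes 3, 4 and 6 would make 24 n + 1 a nonresidue modulo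
  7. Class 2 makes it divisible by 7, hence by 49: then m = 7 i + 1, n - 2 is 49 times the
  pentagonal number of i, and the sign flips because 7 i + 1 and i have opposite parity.\<close>

lemma euler_parts:
  "part 2 (euler 1) = - (fps_X ^ 2 * euler 49)"
  "part 3 (euler 1) = 0" "part 4 (euler 1) = 0" "part 6 (euler 1) = 0"
proof -
  \<comment> \<open>The factor 4 is the inverse of 2 modulo 7.\<close>
  have mod: "n mod 7 = 4 * ((m mod 7) * (3 * (m mod 7) + 1)) mod 7" if "m * (3 * m + 1) = 2 * n" for m n :: int
  proof -
    have "[n = 4 * (2 * n)] (mod 7)" by (simp add: cong_iff_dvd_diff)
    also have "[4 * (2 * n) = 4 * ((m mod 7) * (3 * (m mod 7) + 1))] (mod 7)"
      unfolding that[symmetric] by (intro cong_mult cong_add cong_refl) (auto simp: cong_def)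
    finally show ?thesis by (simp add: cong_def)
  qed
  have cases: "m mod 7 = 0 \<or> m mod 7 = 1 \<or> m mod 7 = 2 \<or> m mod 7 = 3 \<or> m mod 7 = 4 \<or> m mod 7 = 5 \<or> m mod 7 = 6" for m :: int
    by presburger
  have none: "euler 1 $ n = (0 :: int)" if "n mod 7 = 3 \<or> n mod 7 = 4 \<or> n mod 7 = 6" for n
  proof -
    have "{m. m * (3 * m + 1) = 2 * int n} = {}"
    proof (rule equals0I)
      fix m assume "m \<in> {m. m * (3 * m + 1) = 2 * int n}"
      then have "int n mod 7 = 4 * ((m mod 7) * (3 * (m mod 7) + 1)) mod 7" using mod by blast
      moreover have "int n mod 7 = 3 \<or> int n mod 7 = 4 \<or> int n mod 7 = 6"
        using that by (auto simp: int_mod_7)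
      ultimately show False using cases[of m] by (elim disjE) simp_all
    qed
    then show ?thesis unfolding pentagonal_number_theorem by simp
  qed
  show "part 3 (euler 1) = 0" "part 4 (euler 1) = 0" "part 6 (euler 1) = 0"
    using none by (auto simp: part_def fps_eq_iff)
  have "euler 1 $ n = (- (fps_X ^ 2 * euler 49) :: int fps) $ n" if n: "n mod 7 = 2" for n
  proof -
    have m1: "m mod 7 = 1" if "m * (3 * m + 1) = 2 * int n" for m
    proof -
      have "int n mod 7 = 2" using n by (simp add: int_mod_7)
      then show ?thesis using mod[OF that] cases[of m] by (elim disjE) simp_all
    qed
    show ?thesis
    proof (cases "49 dvd n - 2")
      case True
      moreover have "n \<ge> 2" using n by (metis mod_less_eq_dividend)
      ultimately obtain k where k: "n = 49 * k + 2" by (metis dvdE le_add_diff_inverse2)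
      have "euler 1 $ n = (\<Sum>m | m * (3 * m + 1) = 2 * int n. if even m then 1 else - 1 :: int)"
        by (rule pentagonal_number_theorem)
      also have "\<dots> = (\<Sum>i | i * (3 * i + 1) = 2 * int k. - (if even i then 1 else - 1))"
      proof (rule sum.reindex_bij_witness[of _ "\<lambda>i. 7 * i + 1" "\<lambda>m. m div 7"])
        fix m assume "m \<in> {m. m * (3 * m + 1) = 2 * int n}"
        then have m: "m * (3 * m + 1) = 2 * int n" by simp
        define i where "i = m div 7"
        have mi: "m = 7 * i + 1" using m1[OF m] by (simp add: i_def) presburger
        show "7 * (m div 7) + 1 = m" using mi by simp
        have "49 * (i * (3 * i + 1)) = 49 * (2 * int k)" using m unfolding mi k by (simp add: algebra_simps)
        then show "m div 7 \<in> {i. i * (3 * i + 1) = 2 * int k}" by (simp add: i_def)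
        show "- (if even (m div 7) then 1 else - 1 :: int) = (if even m then 1 else - 1)"
          unfolding i_def[symmetric] mi by simp
      next
        fix i assume "i \<in> {i. i * (3 * i + 1) = 2 * int k}"
        then have "49 * (i * (3 * i + 1)) = 49 * (2 * int k)" by simp
        then show "7 * i + 1 \<in> {m. m * (3 * m + 1) = 2 * int n}" by (simp add: k algebra_simps)
      qed simp
      also have "\<dots> = - (euler 1 $ k)" unfolding pentagonal_number_theorem by (simp only: sum_negf)
      also have "\<dots> = - (euler 49 $ (n - 2))"
        using euler_compose_X_power[of 49 1] fps_compose_X_power_nth[of 49 "euler 1 :: int fps" "n - 2"] by (simp add: k)
      finally show ?thesis using \<open>n \<ge> 2\<close> by (simp add: fps_X_power_mult_nth)
    next
      case False
      have "{m. m * (3 * m + 1) = 2 * int n} = {}"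
      proof (rule equals0I)
        fix m assume "m \<in> {m. m * (3 * m + 1) = 2 * int n}"
        then have m: "m * (3 * m + 1) = 2 * int n" by simp
        define i where "i = m div 7"
        have mi: "m = 7 * i + 1" using m1[OF m] by (simp add: i_def) presburger
        have "2 * (int n - 2) = 49 * (i * (3 * i + 1))" using m unfolding mi by (simp add: algebra_simps)
        then have "49 dvd int n - 2" by presburger
        moreover have "n \<ge> 2" using n by (metis mod_less_eq_dividend)
        ultimately show False using False by (metis int_dvd_int_iff of_nat_diff of_nat_numeral)
      qed
      moreover have "euler 49 $ (n - 2) = (0 :: int)"
        using euler_compose_X_power[of 49 1] fps_compose_X_power_nth[of 49 "euler 1 :: int fps" "n - 2"] False by simp
      ultimately show ?thesis unfolding pentagonal_number_theorem by (simp add: fps_X_power_mult_nth)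
    qed
  qed
  moreover have "residue_class 2 (fps_X ^ 2 * euler 49)"
    using residue_class_mult[OF residue_class_X_power[of 2] residue_class_euler[of 7], of 2] by simp
  ultimately show "part 2 (euler 1) = - (fps_X ^ 2 * euler 49)"
    by (auto simp: part_def fps_eq_iff residue_class_def)
qed

text \<open>Needed for m = 7 i + 3 in Jacobi's formula: it annihilates the contribution of the
  constant 3 and leaves a multiple of 7.\<close>

lemma sum_triangular_signs:
  "(\<Sum>m | m * (m + 1) = 2 * int n. if even m then 1 else - 1 :: int) = 0"
proof -
  define A where "A = {m. m * (m + 1) = 2 * int n}"
  have "(\<Sum>m\<in>A. if even m then 1 else - 1 :: int) = (\<Sum>m\<in>A. - (if even m then 1 else - 1))"
    by (rule sum.reindex_bij_witness[of _ "\<lambda>m. - 1 - m" "\<lambda>m. - 1 - m"]) (auto simp: A_def algebra_simps)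
  then show ?thesis by (simp add: sum_negf A_def)
qed

text \<open>Here 8 n + 1 = (2 m + 1)^2. Classes 2, 4 and 5 would give nonresidues modulo 7; class 6
  gives a square divisible by 49, with m = 7 i + 3. Each summand is then -7 times the summand for i
  minus 3 times a bare sign, and the signs cancel in total.\<close>

lemma euler_cube_parts:
  "part 2 (euler 1 ^ 3) = 0" "part 4 (euler 1 ^ 3) = 0" "part 5 (euler 1 ^ 3) = 0"
  "part 6 (euler 1 ^ 3) = - (7 * fps_X ^ 6 * euler 49 ^ 3)"
proof -
  have mod: "n mod 7 = 4 * ((m mod 7) * (m mod 7 + 1)) mod 7" if "m * (m + 1) = 2 * n" for m n :: int
  proof -
    have "[n = 4 * (2 * n)] (mod 7)" by (simp add: cong_iff_dvd_diff)
    also have "[4 * (2 * n) = 4 * ((m mod 7) * (m mod 7 + 1))] (mod 7)"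
      unfolding that[symmetric] by (intro cong_mult cong_add cong_refl) (auto simp: cong_def)
    finally show ?thesis by (simp add: cong_def)
  qed
  have cases: "m mod 7 = 0 \<or> m mod 7 = 1 \<or> m mod 7 = 2 \<or> m mod 7 = 3 \<or> m mod 7 = 4 \<or> m mod 7 = 5 \<or> m mod 7 = 6" for m :: int
    by presburger
  have none: "(euler 1 ^ 3) $ n = (0 :: int)" if "n mod 7 = 2 \<or> n mod 7 = 4 \<or> n mod 7 = 5" for n
  proof -
    have "{m. m * (m + 1) = 2 * int n} = {}"
    proof (rule equals0I)
      fix m assume "m \<in> {m. m * (m + 1) = 2 * int n}"
      then have "int n mod 7 = 4 * ((m mod 7) * (m mod 7 + 1)) mod 7" using mod by blast
      moreover have "int n mod 7 = 2 \<or> int n mod 7 = 4 \<or> int n mod 7 = 5"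
        using that by (auto simp: int_mod_7)
      ultimately show False using cases[of m] by (elim disjE) simp_all
    qed
    then show ?thesis unfolding jacobi_cube by simp
  qed
  show "part 2 (euler 1 ^ 3) = 0" "part 4 (euler 1 ^ 3) = 0" "part 5 (euler 1 ^ 3) = 0"
    using none by (auto simp: part_def fps_eq_iff)
  have cube49: "euler 49 ^ 3 = (euler 1 ^ 3 oo fps_X ^ 49 :: int fps)"
    using euler_compose_X_power[of 49 1] fps_compose_power[of "fps_X ^ 49" "euler 1 :: int fps" 3]
    by (simp add: fps_power_zeroth)
  have "(euler 1 ^ 3) $ n = (- (7 * fps_X ^ 6 * euler 49 ^ 3) :: int fps) $ n" if n: "n mod 7 = 6" for n
  proof -
    have n6: "n \<ge> 6" using n by (metis mod_less_eq_dividend)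
    have rhs: "(7 * fps_X ^ 6 * euler 49 ^ 3) $ n = 7 * (euler 49 ^ 3 :: int fps) $ (n - 6)"
      using n6 by (simp add: mult.assoc fps_X_power_mult_nth numeral_fps_const)
    have m1: "m mod 7 = 3" if "m * (m + 1) = 2 * int n" for m
    proof -
      have "int n mod 7 = 6" using n by (simp add: int_mod_7)
      then show ?thesis using mod[OF that] cases[of m] by (elim disjE) simp_all
    qed
    show ?thesis
    proof (cases "49 dvd n - 6")
      case True
      then obtain k where k: "n = 49 * k + 6" using n6 by (metis dvdE le_add_diff_inverse2)
      have "(euler 1 ^ 3) $ n = (\<Sum>m | m * (m + 1) = 2 * int n. if even m then m else - m :: int)"
        by (rule jacobi_cube)
      also have "\<dots> = (\<Sum>i | i * (i + 1) = 2 * int k. - 7 * (if even i then i else - i) - 3 * (if even i then 1 else - 1))"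
      proof (rule sum.reindex_bij_witness[of _ "\<lambda>i. 7 * i + 3" "\<lambda>m. m div 7"])
        fix m assume "m \<in> {m. m * (m + 1) = 2 * int n}"
        then have m: "m * (m + 1) = 2 * int n" by simp
        define i where "i = m div 7"
        have mi: "m = 7 * i + 3" using m1[OF m] by (simp add: i_def) presburger
        show "7 * (m div 7) + 3 = m" using mi by simp
        have "49 * (i * (i + 1)) = 49 * (2 * int k)" using m unfolding mi k by (simp add: algebra_simps)
        then show "m div 7 \<in> {i. i * (i + 1) = 2 * int k}" by (simp add: i_def)
        show "- 7 * (if even (m div 7) then m div 7 else - (m div 7)) - 3 * (if even (m div 7) then 1 else - 1 :: int)
            = (if even m then m else - m)"
          unfolding i_def[symmetric] mi by simp
      next
        fix i assume "i \<in> {i. i * (i + 1) = 2 * int k}"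
        then have "49 * (i * (i + 1)) = 49 * (2 * int k)" by simp
        then show "7 * i + 3 \<in> {m. m * (m + 1) = 2 * int n}" by (simp add: k algebra_simps)
      qed simp
      also have "\<dots> = - 7 * (\<Sum>i | i * (i + 1) = 2 * int k. if even i then i else - i)
          - 3 * (\<Sum>i | i * (i + 1) = 2 * int k. if even i then 1 else - 1)"
        by (simp only: sum_subtractf sum_distrib_left)
      also have "\<dots> = - 7 * (euler 1 ^ 3) $ k"
        unfolding sum_triangular_signs jacobi_cube by simp
      also have "(euler 1 ^ 3) $ k = (euler 49 ^ 3 :: int fps) $ (n - 6)"
        using fps_compose_X_power_nth[of 49 "euler 1 ^ 3 :: int fps" "n - 6"] by (simp add: k cube49)
      finally show ?thesis using rhs by simp
    next
      case False
      have "{m. m * (m + 1) = 2 * int n} = {}"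
      proof (rule equals0I)
        fix m assume "m \<in> {m. m * (m + 1) = 2 * int n}"
        then have m: "m * (m + 1) = 2 * int n" by simp
        define i where "i = m div 7"
        have mi: "m = 7 * i + 3" using m1[OF m] by (simp add: i_def) presburger
        have "2 * (int n - 6) = 49 * (i * (i + 1))" using m unfolding mi by (simp add: algebra_simps)
        then have "49 dvd int n - 6" by presburger
        then show False using False n6 by (metis int_dvd_int_iff of_nat_diff of_nat_numeral)
      qed
      moreover have "(euler 49 ^ 3 :: int fps) $ (n - 6) = 0"
        using fps_compose_X_power_nth[of 49 "euler 1 ^ 3 :: int fps" "n - 6"] False by (simp add: cube49)
      ultimately show ?thesis using rhs unfolding jacobi_cube by simp
    qed
  qed
  moreover have "residue_class 6 (7 * fps_X ^ 6 * euler 49 ^ 3)"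
  proof -
    have "residue_class 6 ((7 * euler 49 ^ 3) * fps_X ^ 6)"
      using residue_class_mult[OF residue_class_mult[OF residue_class_of_int(1)
          residue_class_power_0[OF residue_class_euler[of 7]]] residue_class_X_power[of 6], of 0 6] by simp
    then show ?thesis by (simp add: mult_ac)
  qed
  ultimately show "part 6 (euler 1 ^ 3) = - (7 * fps_X ^ 6 * euler 49 ^ 3)"
    by (auto simp: part_def fps_eq_iff residue_class_def)
qed

section \<open>Ramanujan's congruence for p(7n + 5) modulo 49\<close>

lemma numeral_dvd_fps_iff:
  fixes f :: "int fps"
  shows "numeral k dvd f \<longleftrightarrow> (\<forall>n. numeral k dvd f $ n)"
proof
  assume "numeral k dvd f"
  then show "\<forall>n. numeral k dvd f $ n"
    by (auto elim!: dvdE simp: numeral_fps_const)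
next
  assume *: "\<forall>n. numeral k dvd f $ n"
  have "f = numeral k * Abs_fps (\<lambda>n. f $ n div numeral k)"
    using * by (simp add: fps_eq_iff numeral_fps_const)
  then show "numeral k dvd f" by (rule dvdI)
qed

lemma add_power_7_mod_7:
  fixes a b :: "'a::idom"
  shows "7 dvd (a + b) ^ 7 - (a ^ 7 + b ^ 7)"
proof -
  have "(a + b) ^ 7 - (a ^ 7 + b ^ 7)
      = 7 * (a * b * (a ^ 5 + 3 * a ^ 4 * b + 5 * a ^ 3 * b ^ 2 + 5 * a ^ 2 * b ^ 3 + 3 * a * b ^ 4 + b ^ 5))"
    by algebra
  then show ?thesis by simp
qed

lemma diff_power_7_mod_7:
  fixes a b :: "'a::idom"
  shows "7 dvd (a - b) ^ 7 - (a ^ 7 - b ^ 7)"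
proof -
  have "(- b) ^ 7 = - (b ^ 7)" by simp
  then show ?thesis using add_power_7_mod_7[of a "- b"] by simp
qed

lemma euler_power_7: "7 dvd euler k ^ 7 - (euler (7 * k) :: int fps)" if "k > 0"
  unfolding numeral_dvd_fps_iff
proof
  fix n
  have "7 dvd (1 - (fps_X ^ k) ^ Suc i) ^ 7 - (1 - (fps_X ^ (7 * k)) ^ Suc i :: int fps)" for i
  proof -
    have "((fps_X ^ k) ^ Suc i) ^ 7 = ((fps_X ^ (7 * k)) ^ Suc i :: int fps)"
      by (simp only: power_mult[symmetric]) (simp add: algebra_simps)
    then show ?thesis using diff_power_7_mod_7[of "1 :: int fps" "(fps_X ^ k) ^ Suc i"] by simp
  qed
  then have "7 dvd (\<Prod>i<n. (1 - (fps_X ^ k) ^ Suc i) ^ 7) - (\<Prod>i<n. 1 - (fps_X ^ (7 * k)) ^ Suc i :: int fps)"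
    by (rule dvd_diff_prod)
  then have "7 dvd qpoch (fps_X ^ k) n ^ 7 - (qpoch (fps_X ^ (7 * k)) n :: int fps)"
    by (simp only: qpoch_def prod_power_distrib)
  then have "7 dvd (qpoch (fps_X ^ k) n ^ 7 - (qpoch (fps_X ^ (7 * k)) n :: int fps)) $ n"
    unfolding numeral_dvd_fps_iff by blast
  moreover have "(euler k ^ 7 :: int fps) $ n = (qpoch (fps_X ^ k) n ^ 7) $ n"
    using dvd_diff_power[OF euler_X_adic[OF that, of n, where ?'a = int], of 7] unfolding X_power_dvd_iff by simp
  moreover have "(euler (7 * k) :: int fps) $ n = qpoch (fps_X ^ (7 * k)) n $ n"
    using euler_X_adic[of "7 * k" n, where ?'a = int] that unfolding X_power_dvd_iff by simp
  ultimately show "7 dvd (euler k ^ 7 - (euler (7 * k) :: int fps)) $ n" by simp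
qed

text \<open>The second factor on the left is the product of the six conjugates of the first one under
  \<open>u \<mapsto> \<zeta> u\<close>, up to a power of \<open>p\<close>.\<close>

lemma norm_identity:
  fixes p u :: "'a::idom"
  assumes "u ^ 7 = p ^ 3 - p ^ 2"
  shows "(p ^ 2 - p * u - p * u ^ 2 + u ^ 5) *
     ((2 * p ^ 2 + 2 * p ^ 3 - p ^ 4 - 13 * p ^ 5 + 11 * p ^ 6)
      + (- 5 * p ^ 2 + 9 * p ^ 3 - 15 * p ^ 4 + 15 * p ^ 5 - 3 * p ^ 6) * u
      + (11 * p ^ 2 - 31 * p ^ 3 + 26 * p ^ 4 - 5 * p ^ 5 + p ^ 6) * u ^ 2
      + (- p - 8 * p ^ 2 + 18 * p ^ 3 - 11 * p ^ 4 + 5 * p ^ 5) * u ^ 3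
      + (3 * p + 3 * p ^ 2 - 12 * p ^ 3 + 12 * p ^ 4 - p ^ 5) * u ^ 4
      + (- 7 * p + 7 * p ^ 2 + 14 * p ^ 3 - 7 * p ^ 4) * u ^ 5
      + (1 + p + 17 * p ^ 2 - 10 * p ^ 3 + 2 * p ^ 4) * u ^ 6)
    = p ^ 3 * (p ^ 3 + 5 * p ^ 2 - 8 * p + 1) ^ 2" (is "?L = ?R")
proof -
  have "?L - ?R = (u ^ 7 - (p ^ 3 - p ^ 2)) *
    (- p + 17 * p ^ 2 - 55 * p ^ 3 + 22 * p ^ 4 + p ^ 6 - 2 * p * u - 9 * p ^ 2 * u + p ^ 3 * u
     - p ^ 4 * u + 3 * p ^ 5 * u + 3 * p * u ^ 2 + 3 * p ^ 2 * u ^ 2 - 12 * p ^ 3 * u ^ 2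
     + 12 * p ^ 4 * u ^ 2 - p ^ 5 * u ^ 2 - 7 * p * u ^ 3 + 7 * p ^ 2 * u ^ 3 + 14 * p ^ 3 * u ^ 3
     - 7 * p ^ 4 * u ^ 3 + u ^ 4 + p * u ^ 4 + 17 * p ^ 2 * u ^ 4 - 10 * p ^ 3 * u ^ 4 + 2 * p ^ 4 * u ^ 4)"
    by algebra
  then show ?thesis using assms by simp
qed

lemma part_numeral_mult: "part r (numeral k * f) = numeral k * part r f"
  by (simp add: part_def fps_eq_iff numeral_fps_const)

lemma part_mult3:
  assumes "residue_class r f" "residue_class s g" "residue_class t h"
  shows "part n (f * g * h) = (if n = (r + s + t) mod 7 then f * g * h else 0)"
proof -
  have "residue_class ((r + s + t) mod 7) (f * g * h)"
    by (rule residue_class_mult[OF residue_class_mult[OF assms(1,2) refl] assms(3)]) (simp add: mod_simps)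
  then show ?thesis by (rule part_if_residue_class)
qed

text \<open>The classes 0, 1, 2, 5 are those that occur in \<open>euler 1\<close>. Since parts 4 and
  6 of its cube are known from Jacobi's formula, the few triples of classes with sum 4 or 6 modulo 7
  yield two relations among the four pieces.\<close>

lemma cube_parts:
  assumes a: "residue_class 0 a" and b: "residue_class 1 b" and c: "residue_class 2 c" and d: "residue_class 5 d"
  shows "part 4 ((a + b + c + d) ^ 3) = 3 * (b * b * c) + 3 * (a * c * c) + 3 * (b * d * d)"
    and "part 6 ((a + b + c + d) ^ 3) = c * c * c + 6 * (a * b * d)"
proof -
  have exp: "(a + b + c + d) ^ 3 = a * a * a + b * b * b + c * c * c + d * d * d + 3 * (a * a * b)
      + 3 * (a * a * c) + 3 * (a * a * d) + 3 * (a * b * b) + 3 * (b * b * c) + 3 * (b * b * d) + 3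
      * (a * c * c) + 3 * (b * c * c) + 3 * (c * c * d) + 3 * (a * d * d) + 3 * (b * d * d) + 3 * (c
      * d * d) + 6 * (a * b * c) + 6 * (a * b * d) + 6 * (a * c * d) + 6 * (b * c * d)"
    by algebra
  note parts = part_add part_numeral_mult part_mult3[OF a a a] part_mult3[OF b b b] part_mult3[OF
      c c c] part_mult3[OF d d d] part_mult3[OF a a b] part_mult3[OF a a c] part_mult3[OF a a d]
      part_mult3[OF a b b] part_mult3[OF b b c] part_mult3[OF b b d] part_mult3[OF a c c]
      part_mult3[OF b c c] part_mult3[OF c c d] part_mult3[OF a d d] part_mult3[OF b d d]
      part_mult3[OF c d d] part_mult3[OF a b c] part_mult3[OF a b d] part_mult3[OF a c d]
      part_mult3[OF b c d]
  show "part 4 ((a + b + c + d) ^ 3) = 3 * (b * b * c) + 3 * (a * c * c) + 3 * (b * d * d)"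
    unfolding exp parts by simp
  show "part 6 ((a + b + c + d) ^ 3) = c * c * c + 6 * (a * b * d)"
    unfolding exp parts by simp
qed

text \<open>The unknown pieces of E_1 / E_49 are a, b, d in classes 0, 1, 5, next to the known -q^2.
  Normalizing by b through b = -q B, u = q / B and p = a / B^2 turns the class 6 relation a b d =
  -q^6 into d = B^2 u^5 / p, and the class 4 relation into u^7 = p^3 - p^2, a model of the Klein
  quartic. The series \<open>p'\<close> is the inverse of p.\<close>

lemma euler_dissection:
  obtains B p u p' :: "int fps"
  where "residue_class 0 B" "residue_class 0 p" "residue_class 1 u"
    "B $ 0 = 1" "p $ 0 = 1" "u * B = fps_X" "p * p' = 1" "u ^ 7 = p ^ 3 - p ^ 2"
    "euler 1 = euler 49 * B ^ 2 * (p - u - u ^ 2 + u ^ 5 * p')"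
proof -
  obtain I where I: "euler 49 * I = (1 :: int fps)"
    using euler_unit[of 49, where ?'a = int] by (metis dvdE)
  have clsE: "residue_class 0 (euler 49)" using residue_class_euler[of 7] by simp
  have clsI: "residue_class 0 I" using residue_class_inverse[OF clsE I] .
  define S where "S = I * euler 1"
  define a b d where "a = part 0 S" and "b = part 1 S" and "d = part 5 S"
  have S_parts: "part r S = I * part r (euler 1)" if "r < 7" for r
    unfolding S_def by (rule part_mult[OF clsI that])
  have "part 2 S = I * - (fps_X ^ 2 * euler 49)"
    using S_parts[of 2] unfolding euler_parts(1) by simp
  also have "\<dots> = - (fps_X ^ 2 * (euler 49 * I))" by (simp add: mult_ac)
  finally have "part 2 S = - (fps_X ^ 2)" using I by simp
  moreover have "part 3 S = 0" "part 4 S = 0" "part 6 S = 0"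
    using S_parts[of 3] S_parts[of 4] S_parts[of 6] euler_parts by simp_all
  ultimately have S: "S = a + b - fps_X ^ 2 + d"
    using fps_eq_sum_parts[of S] unfolding a_def b_def d_def by simp
  have ca: "residue_class 0 a" and cb: "residue_class 1 b" and cd: "residue_class 5 d"
    by (simp_all add: a_def b_def d_def residue_class_part)
  define c where "c = - (fps_X ^ 2 :: int fps)"
  have cc: "residue_class 2 c"
    unfolding c_def using residue_class_uminus[OF residue_class_X_power[of 2]] by simp
  have S3: "S ^ 3 = I ^ 3 * euler 1 ^ 3" by (simp add: S_def power_mult_distrib)
  have S_sum: "S = a + b + c + d" by (simp add: S c_def)
  have S3_parts: "part r (S ^ 3) = I ^ 3 * part r (euler 1 ^ 3)" if "r < 7" for r
    unfolding S3 by (rule part_mult[OF residue_class_power_0[OF clsI] that])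
  have "part 4 (S ^ 3) = 0" using S3_parts[of 4] euler_cube_parts(2) by simp
  then have "3 * (b * b * c + a * c * c + b * d * d) = 0"
    using cube_parts(1)[OF ca cb cc cd] by (simp add: S_sum algebra_simps)
  then have rel4: "b * b * c + a * c * c + b * d * d = 0" by (metis mult_eq_0_iff zero_neq_numeral)
  have "part 6 (S ^ 3) = I ^ 3 * - (7 * fps_X ^ 6 * euler 49 ^ 3)"
    using S3_parts[of 6] euler_cube_parts(4) by simp
  also have "\<dots> = - 7 * fps_X ^ 6 * (euler 49 * I) ^ 3" by (simp add: power_mult_distrib mult_ac)
  finally have "c * c * c + 6 * (a * b * d) = - 7 * fps_X ^ 6"
    using cube_parts(2)[OF ca cb cc cd] I by (simp add: S_sum)
  moreover have "c * c * c = - (fps_X ^ 6)" by (simp add: c_def flip: power_add)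
  ultimately have "6 * (a * b * d) = 6 * (- (fps_X ^ 6))" by algebra
  then have rel6: "a * b * d = - (fps_X ^ 6)" by (metis mult_cancel_left zero_neq_numeral)

  define B where "B = fps_shift 1 (- b)"
  have b0: "b $ 0 = 0" using cb by (force simp: residue_class_def)
  have bB: "b = - (fps_X * B)"
    by (rule fps_ext) (use b0 in \<open>auto simp: B_def\<close>)
  have cB: "residue_class 0 B"
    unfolding residue_class_def
  proof (intro allI impI)
    fix n assume "B $ n \<noteq> 0"
    then have "Suc n mod 7 = 1" using cb by (simp add: B_def residue_class_def)
    then show "n mod 7 = 0" by presburger
  qed
  have I0: "I $ 0 = 1" using arg_cong[OF I, of "\<lambda>f. f $ 0"] by simp
  have I1: "I $ 1 = 0" using clsI by (force simp: residue_class_def)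
  have "euler 1 $ 1 = (- 1 :: int)" by (simp add: euler_def qpoch_def)
  then have "S $ 1 = - 1" using I0 I1 by (simp add: S_def fps_mult_nth)
  then have B0: "B $ 0 = 1" by (simp add: B_def b_def part_def)
  have a0: "a $ 0 = 1" using I0 by (simp add: a_def part_def S_def fps_mult_nth)
  obtain B' where B': "B * B' = 1" using fps_unit_if_nth_0[of B 1] B0 by (metis dvdE mult_1_right)
  have cB': "residue_class 0 B'" using residue_class_inverse[OF cB B'] .
  have B'0: "B' $ 0 = 1" using arg_cong[OF B', of "\<lambda>f. f $ 0"] B0 by simp
  define u where "u = fps_X * B'"
  define p where "p = a * B' ^ 2"
  have p0: "p $ 0 = 1" using a0 B'0 by (simp add: p_def power2_eq_square)
  obtain p' where p': "p * p' = 1" using fps_unit_if_nth_0[of p 1] p0 by (metis dvdE mult_1_right)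
  have uB: "u * B = fps_X" using B' by (simp add: u_def mult_ac)
  have aB: "a = B ^ 2 * p"
  proof -
    have "B ^ 2 * p = a * (B * B') ^ 2" by (simp add: p_def power_mult_distrib mult_ac)
    then show ?thesis using B' by simp
  qed
  have nz: "B \<noteq> 0" "u \<noteq> 0" "p \<noteq> 0" "a \<noteq> 0" using B0 uB p0 a0 by auto
  have dB: "d = B ^ 2 * u ^ 5 * p'"
  proof -
    have "(a * b) * d = (a * b) * (B ^ 2 * u ^ 5 * p')"
    proof -
      have "(a * b) * (B ^ 2 * u ^ 5 * p') = - ((u * B) ^ 6) * (p * p')"
        unfolding bB aB uB[symmetric] by (simp add: algebra_simps eval_nat_numeral)
      also have "\<dots> = - (fps_X ^ 6)" using uB p' by simp
      finally show ?thesis using rel6 by simp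
    qed
    moreover have "a * b \<noteq> 0" using nz bB by auto
    ultimately show ?thesis by simp
  qed
  have "u ^ 4 * B ^ 6 * (p - 1 - u ^ 7 * p' ^ 2) = 0"
    using rel4 unfolding dB aB bB c_def uB[symmetric] by (simp add: algebra_simps eval_nat_numeral)
  then have "p - 1 = u ^ 7 * p' ^ 2" using nz by simp
  then have "p ^ 2 * (p - 1) = u ^ 7 * (p * p') ^ 2" by (simp add: power_mult_distrib mult_ac)
  then have "u ^ 7 = p ^ 2 * (p - 1)" using p' by simp
  then have u7: "u ^ 7 = p ^ 3 - p ^ 2"
    by (simp add: right_diff_distrib power2_eq_square power3_eq_cube)
  have "euler 1 = euler 49 * S"
    using I by (simp add: S_def mult.assoc[symmetric])
  also have "S = B ^ 2 * (p - u - u ^ 2 + u ^ 5 * p')"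
    unfolding S dB aB bB uB[symmetric] by (simp add: algebra_simps power2_eq_square)
  finally have "euler 1 = euler 49 * B ^ 2 * (p - u - u ^ 2 + u ^ 5 * p')" by (simp add: mult.assoc)
  moreover have "residue_class 0 p"
    unfolding p_def using residue_class_mult[OF ca residue_class_power_0[OF cB']] by simp
  moreover have "residue_class 1 u"
    unfolding u_def using residue_class_mult[OF residue_class_X_power[of 1] cB'] by simp
  ultimately show ?thesis using that cB B0 p0 uB p' u7 by blast
qed


text \<open>Multiplying by the conjugates under u -> \<zeta> u writes 1 / E_1 as K / D with D in
  class 0. As u lies in class 1, part 5 of the partition series is the u^5 term of K divided by D,
  and its coefficient \<open>k5\<close> is divisible by 7. What remains is to evaluate the quotient
  by 7 once more modulo 7.\<close>

lemma euler_inverse_part_5: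
  obtains P W :: "int fps"
  where "euler 1 * P = 1" "part 5 P = 7 * W" "7 dvd W - fps_X ^ 5 * euler 49 ^ 2 * euler 7 ^ 3"
proof -
  obtain B p u p' :: "int fps" where
    cls: "residue_class 0 B" "residue_class 0 p" "residue_class 1 u"
    and nth0: "B $ 0 = 1" "p $ 0 = 1" and uB: "u * B = fps_X" and p': "p * p' = 1"
    and u7: "u ^ 7 = p ^ 3 - p ^ 2"
    and E: "euler 1 = euler 49 * B ^ 2 * (p - u - u ^ 2 + u ^ 5 * p')"
    by (rule euler_dissection)
  obtain P where P: "euler 1 * P = (1 :: int fps)"
    using euler_unit[of 1, where ?'a = int] by (metis dvdE)
  define h where "h = p ^ 3 + 5 * p ^ 2 - 8 * p + 1"
  define k0 where "k0 = 2 * p ^ 2 + 2 * p ^ 3 - p ^ 4 - 13 * p ^ 5 + 11 * p ^ 6"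
  define k1 where "k1 = - 5 * p ^ 2 + 9 * p ^ 3 - 15 * p ^ 4 + 15 * p ^ 5 - 3 * p ^ 6"
  define k2 where "k2 = 11 * p ^ 2 - 31 * p ^ 3 + 26 * p ^ 4 - 5 * p ^ 5 + p ^ 6"
  define k3 where "k3 = - p - 8 * p ^ 2 + 18 * p ^ 3 - 11 * p ^ 4 + 5 * p ^ 5"
  define k4 where "k4 = 3 * p + 3 * p ^ 2 - 12 * p ^ 3 + 12 * p ^ 4 - p ^ 5"
  define k5 where "k5 = - 7 * p + 7 * p ^ 2 + 14 * p ^ 3 - 7 * p ^ 4"
  define k6 where "k6 = 1 + p + 17 * p ^ 2 - 10 * p ^ 3 + 2 * p ^ 4"
  define K where "K = k0 + k1 * u + k2 * u ^ 2 + k3 * u ^ 3 + k4 * u ^ 4 + k5 * u ^ 5 + k6 * u ^ 6"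
  have nz: "p \<noteq> 0" using nth0 by auto
  have norm: "(p ^ 2 - p * u - p * u ^ 2 + u ^ 5) * K = p ^ 3 * h ^ 2"
    unfolding K_def k0_def k1_def k2_def k3_def k4_def k5_def k6_def h_def
    using norm_identity[OF u7] by simp
  have pE: "p * euler 1 = euler 49 * B ^ 2 * (p ^ 2 - p * u - p * u ^ 2 + u ^ 5)"
  proof -
    have "p * euler 1 = euler 49 * B ^ 2 * (p ^ 2 - p * u - p * u ^ 2 + u ^ 5 * (p * p'))"
      unfolding E by (simp add: algebra_simps power2_eq_square)
    then show ?thesis using p' by simp
  qed
  have KP: "K = euler 49 * B ^ 2 * p ^ 2 * h ^ 2 * P"
  proof -
    have "p * K = (euler 1 * P) * (p * K)" using P by simp
    also have "\<dots> = (p * euler 1) * K * P" by (simp add: mult_ac)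
    also have "\<dots> = euler 49 * B ^ 2 * ((p ^ 2 - p * u - p * u ^ 2 + u ^ 5) * K) * P"
      unfolding pE by (simp add: mult_ac)
    also have "\<dots> = p * (euler 49 * B ^ 2 * p ^ 2 * h ^ 2 * P)"
      unfolding norm by (simp add: mult_ac eval_nat_numeral)
    finally show ?thesis using nz by simp
  qed
  define D where "D = euler 49 * B ^ 2 * p ^ 2 * h ^ 2"
  note cls0 = residue_class_power_0 residue_class_of_int residue_class_add residue_class_diff residue_class_uminus
  have mult0: "residue_class 0 (f * g)" if "residue_class 0 f" "residue_class 0 g" for f g
    using residue_class_mult[OF that] by simp
  have clsh: "residue_class 0 h" unfolding h_def by (intro cls0 mult0 cls)
  have clsE: "residue_class 0 (euler 49)" using residue_class_euler[of 7] by simp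
  have clsD: "residue_class 0 D" unfolding D_def by (intro cls0 mult0 cls clsh clsE)
  have "residue_class 0 k0" "residue_class 0 k1" "residue_class 0 k2" "residue_class 0 k3"
    "residue_class 0 k4" "residue_class 0 k5" "residue_class 0 k6"
    unfolding k0_def k1_def k2_def k3_def k4_def k5_def k6_def
    by (intro cls0 mult0 cls | (subst mult_minus_left; intro cls0 mult0 cls))+
  note k = this
  have upow: "residue_class (n mod 7) (u ^ n)" for n
  proof (induction n)
    case 0
    then show ?case using residue_class_of_int(2) by simp
  next
    case (Suc n)
    have "(1 + n mod 7) mod 7 = Suc n mod 7" by presburger
    then show ?case using residue_class_mult[OF cls(3) Suc] by simp
  qed
  have ku: "part 5 (f * u ^ n) = (if n mod 7 = 5 then f * u ^ n else 0)" if "residue_class 0 f" for f n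
    using part_if_residue_class[OF residue_class_mult[OF that upow refl]] by auto
  have "part 5 K = k5 * u ^ 5"
    unfolding K_def part_add
    using ku[OF k(1), of 0] ku[OF k(2), of 1] ku[OF k(3), of 2] ku[OF k(4), of 3] ku[OF k(5), of 4]
      ku[OF k(6), of 5] ku[OF k(7), of 6] by simp
  then have W0: "D * part 5 P = k5 * u ^ 5"
    using part_mult[OF clsD, of 5 P] KP by (simp add: D_def)
  \<comment> \<open>Modulo 7 the cofactor is - p h, so one factor p h cancels against the p^2 h^2 in
    \<open>D\<close>.\<close>
  have k5: "k5 = 7 * (p * (7 * p * (p - 1) - h))"
    unfolding k5_def h_def by algebra
  have unit0: "f dvd 1" if "f $ 0 = 1 \<or> f $ 0 = - 1" for f :: "int fps"
    using fps_unit_if_nth_0[of f 1] fps_unit_if_nth_0[of f "- 1"] that by auto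
  have h0: "h $ 0 = - 1" unfolding h_def using nth0 by (simp add: fps_power_zeroth fps_numeral_nth)
  have D0: "D $ 0 = 1" unfolding D_def using nth0 h0 by (simp add: fps_power_zeroth)
  have "7 dvd D * part 5 P" unfolding W0 k5 by simp
  then have "7 dvd part 5 P" using unit_dvd_cancel unit0 D0 by blast
  then obtain W where W: "part 5 P = 7 * W" by (rule dvdE)
  have "7 * (D * W) = 7 * (p * (7 * p * (p - 1) - h) * u ^ 5)"
    using W0 unfolding W k5 by (simp add: mult_ac)
  then have DW: "D * W = p * (7 * p * (p - 1) - h) * u ^ 5" by simp
  \<comment> \<open>Chosen so that E_49 x W agrees with q^5 modulo 7. The minus sign compensates
    h(0) = -1 and gives \<open>x\<close> the constant term 1.\<close>
  define x where "x = - (B ^ 7 * p * h)"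
  have "(p * h) * (euler 49 * x * W - fps_X ^ 5) = - (B ^ 5) * (D * W) - p * h * (u * B) ^ 5"
    unfolding x_def D_def uB by (simp add: algebra_simps eval_nat_numeral)
  also have "\<dots> = 7 * (- (B ^ 5 * u ^ 5 * p ^ 2 * (p - 1)))"
    unfolding DW by (simp add: algebra_simps eval_nat_numeral)
  finally have "7 dvd (p * h) * (euler 49 * x * W - fps_X ^ 5)" by simp
  moreover have "p * h dvd 1" using nth0 h0 by (intro unit0) simp
  ultimately have xW: "7 dvd euler 49 * x * W - fps_X ^ 5"
    using unit_dvd_cancel by blast

  \<comment> \<open>Modulo 7 the norm of \<open>euler 1\<close> is its seventh power, which identifies \<open>x\<close> up to sign.\<close>
  have E7: "7 dvd (euler 1) ^ 7 - (euler 7 :: int fps)" "7 dvd (euler 7) ^ 7 - (euler 49 :: int fps)"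
    using euler_power_7[of 1] euler_power_7[of 7] by simp_all
  have "7 dvd (p - u - u ^ 2 + u ^ 5 * p') ^ 7 - (p * h) ^ 2"
  proof -
    have "7 dvd (p - u - u ^ 2 + u ^ 5 * p') ^ 7 - ((p - u - u ^ 2) ^ 7 + (u ^ 5 * p') ^ 7)"
      by (rule add_power_7_mod_7)
    moreover have "7 dvd (p - u - u ^ 2) ^ 7 - ((p - u) ^ 7 - (u ^ 2) ^ 7)" by (rule diff_power_7_mod_7)
    moreover have "7 dvd (p - u) ^ 7 - (p ^ 7 - u ^ 7)" by (rule diff_power_7_mod_7)
    ultimately have "7 dvd ((p - u - u ^ 2 + u ^ 5 * p') ^ 7 - ((p - u - u ^ 2) ^ 7 + (u ^ 5 * p') ^ 7))
       + ((p - u - u ^ 2) ^ 7 - ((p - u) ^ 7 - (u ^ 2) ^ 7)) + ((p - u) ^ 7 - (p ^ 7 - u ^ 7))"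
      by (intro dvd_add)
    then have frob: "7 dvd (p - u - u ^ 2 + u ^ 5 * p') ^ 7 - (p ^ 7 - u ^ 7 - (u ^ 2) ^ 7 + (u ^ 5 * p') ^ 7)"
      by (simp add: algebra_simps)
    have pow: "(u ^ 2) ^ 7 = (u ^ 7) ^ 2" "(u ^ 5 * p') ^ 7 = (u ^ 7) ^ 5 * p' ^ 7"
      by (simp_all flip: power_mult add: power_mult_distrib)
    have pow5: "(u ^ 7) ^ 5 * p' ^ 7 = p ^ 3 * (p - 1) ^ 5"
    proof -
      have "u ^ 7 = p ^ 2 * (p - 1)" unfolding u7 by (simp add: algebra_simps eval_nat_numeral)
      then have "(u ^ 7) ^ 5 * p' ^ 7 = p ^ 3 * (p - 1) ^ 5 * (p * p') ^ 7"
        by (simp add: power_mult_distrib mult_ac flip: power_mult power_add)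
      then show ?thesis using p' by simp
    qed
    have "p ^ 7 - u ^ 7 - (u ^ 7) ^ 2 + p ^ 3 * (p - 1) ^ 5 - (p * h) ^ 2
        = 7 * (2 * p ^ 3 - 10 * p ^ 4 + 10 * p ^ 5 - 2 * p ^ 7)"
      unfolding u7 h_def by algebra
    then have "7 dvd p ^ 7 - u ^ 7 - (u ^ 7) ^ 2 + p ^ 3 * (p - 1) ^ 5 - (p * h) ^ 2" by (rule dvdI)
    then show ?thesis by (rule dvd_diff_trans[OF frob[unfolded pow pow5]])
  qed
  then have "7 dvd euler 49 ^ 7 * B ^ 14 * ((p - u - u ^ 2 + u ^ 5 * p') ^ 7 - (p * h) ^ 2)"
    by (rule dvd_mult)
  also have "euler 49 ^ 7 * B ^ 14 * ((p - u - u ^ 2 + u ^ 5 * p') ^ 7 - (p * h) ^ 2)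
      = euler 1 ^ 7 - euler 49 ^ 7 * x ^ 2"
  proof -
    have "euler 1 ^ 7 = euler 49 ^ 7 * B ^ 14 * (p - u - u ^ 2 + u ^ 5 * p') ^ 7"
      unfolding E power_mult_distrib by (simp flip: power_mult)
    moreover have "x ^ 2 = B ^ 14 * (p * h) ^ 2"
      by (simp add: x_def power_mult_distrib flip: power_mult)
    ultimately show ?thesis by (simp only: right_diff_distrib mult.assoc)
  qed
  finally have "7 dvd euler 49 ^ 7 * x ^ 2 - euler 7"
    using dvd_diff_trans[OF dvd_diff_sym E7(1)] by blast
  \<comment> \<open>One more factor E_49, congruent to E_7^7, makes both sides squares, of E_49^4 x
    and of E_7^4.\<close>
  then have "7 dvd (euler 49 ^ 7 * x ^ 2) * euler 49 - euler 7 * euler 7 ^ 7"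
    by (rule dvd_diff_mult[OF _ dvd_diff_sym[OF E7(2)]])
  then have "7 dvd (euler 49 ^ 4 * x - euler 7 ^ 4) * (euler 49 ^ 4 * x + euler 7 ^ 4)"
    by (simp add: algebra_simps eval_nat_numeral)
  \<comment> \<open>This settles the sign. The sum G of the two roots has constant term 2, which is
    invertible only modulo 7; 4 G - 7 is congruent to 4 G and has constant term 1, so it is a unit
    over the integers.\<close>
  then have "7 dvd 4 * ((euler 49 ^ 4 * x - euler 7 ^ 4) * (euler 49 ^ 4 * x + euler 7 ^ 4))
      - 7 * (euler 49 ^ 4 * x - euler 7 ^ 4)"
    by (rule dvd_diff[OF dvd_mult dvd_triv_left])
  moreover have "4 * (F * G) - 7 * F = (4 * G - 7) * F" for F G :: "int fps"
    by (simp add: algebra_simps)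
  ultimately have "7 dvd (4 * (euler 49 ^ 4 * x + euler 7 ^ 4) - 7) * (euler 49 ^ 4 * x - euler 7 ^ 4)"
    by (simp only:)
  moreover have "4 * (euler 49 ^ 4 * x + euler 7 ^ 4) - 7 dvd (1 :: int fps)"
    using nth0 h0 by (intro unit0) (simp add: x_def fps_power_zeroth numeral_fps_const)
  ultimately have x: "7 dvd euler 49 ^ 4 * x - euler 7 ^ 4"
    using unit_dvd_cancel by blast

  \<comment> \<open>Modulo 7, W is q^5 / (E_49 x) = q^5 E_49^3 / E_7^4, and replacing one E_49 by
    E_7^7 gives q^5 E_49^2 E_7^3. The combination below is this computation without
    denominators.\<close>
  have "7 dvd euler 49 ^ 3 * euler 7 ^ 3 * (euler 49 * x * W - fps_X ^ 5)
      - W * euler 7 ^ 3 * (euler 49 ^ 4 * x - euler 7 ^ 4) - W * (euler 7 ^ 7 - euler 49)"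
    by (intro dvd_diff dvd_mult xW x E7)
  also have "euler 49 ^ 3 * euler 7 ^ 3 * (euler 49 * x * W - fps_X ^ 5)
      - W * euler 7 ^ 3 * (euler 49 ^ 4 * x - euler 7 ^ 4) - W * (euler 7 ^ 7 - euler 49)
      = euler 49 * (W - fps_X ^ 5 * euler 49 ^ 2 * euler 7 ^ 3)"
    by (simp add: algebra_simps eval_nat_numeral)
  finally have "7 dvd W - fps_X ^ 5 * euler 49 ^ 2 * euler 7 ^ 3"
    by (rule unit_dvd_cancel[OF euler_unit])
  then show ?thesis using that P W by blast
qed

section \<open>Theta series of the root lattice\<close>

text \<open>The vectors of norm \<open>2n\<close> in the root lattice \<open>A\<^sub>6\<close>. Since their coordinates sum to 0,
  \<open>moment v\<close> is also the pairing of \<open>v\<close> with the Weyl vector \<open>(-3, \<dots>, 3)\<close>.\<close>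

definition shell :: "nat \<Rightarrow> (nat \<Rightarrow> int) set" where
  "shell n = {v. v \<in> PiE {..<7} (\<lambda>_. UNIV) \<and> sum v {..<7} = 0 \<and> (\<Sum>j<7. (v j)\<^sup>2) = 2 * int n}"

definition moment :: "(nat \<Rightarrow> int) \<Rightarrow> int" where
  "moment v = (\<Sum>j<7. int j * v j)"

definition shell_count :: "nat \<Rightarrow> int \<Rightarrow> nat" where
  "shell_count n r = card {v \<in> shell n. moment v mod 7 = r}"

lemma finite_shell: "finite (shell n)"
proof (rule finite_subset)
  show "finite (PiE {..<7::nat} (\<lambda>_. {- 2 * int n..2 * int n}))"
    by (intro finite_PiE) auto
  show "shell n \<subseteq> PiE {..<7} (\<lambda>_. {- 2 * int n..2 * int n})"
  proof
    fix v assume v: "v \<in> shell n"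
    have "v j \<in> {- 2 * int n..2 * int n}" if "j < 7" for j
    proof -
      have "\<bar>v j\<bar> \<le> \<bar>v j\<bar> * \<bar>v j\<bar>"
        using mult_left_mono[of 1 "\<bar>v j\<bar>" "\<bar>v j\<bar>"] by (cases "v j = 0") auto
      also have "\<dots> = (v j)\<^sup>2" by (simp add: power2_eq_square)
      also have "\<dots> \<le> (\<Sum>j<7. (v j)\<^sup>2)"
        using that by (intro member_le_sum) auto
      also have "\<dots> = 2 * int n" using v by (simp add: shell_def)
      finally show ?thesis by (simp add: abs_le_iff)
    qed
    then show "v \<in> PiE {..<7} (\<lambda>_. {- 2 * int n..2 * int n})"
      using v by (auto simp: shell_def PiE_def Pi_def)
  qed
qed

lemma sum_theta_exp_1_0:
  assumes "sum v {..<7::nat} = 0"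
  shows "(\<Sum>j<7. theta_exp 1 0 (v j)) = n \<longleftrightarrow> (\<Sum>j<7. (v j)\<^sup>2) = 2 * int n"
proof -
  have "2 * int (\<Sum>j<7::nat. theta_exp 1 0 (v j)) = (\<Sum>j<7::nat. 2 * int (theta_exp 1 0 (v j)))"
    by (simp only: of_nat_sum sum_distrib_left)
  also have "\<dots> = (\<Sum>j<7. (v j)\<^sup>2)"
    using assms by (simp only: two_times_theta_exp sum.distrib) simp
  finally show ?thesis by linarith
qed

lemma theta_coeff_1 [simp]: "theta_coeff 1 1 1 m = 1"
  by (simp add: theta_coeff_def)

lemma shell_theta_series:
  assumes "n < N"
  shows "(euler 1 ^ 7 * coeff (triple fps_X 1 fps_X N N ^ 7) (7 * N)) $ n = int (card (shell n))"
proof -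
  have "(euler 1 ^ card {..<7::nat} * coeff (\<Prod>j<7::nat. triple (fps_const (1::int) * fps_X ^ 1)
            (fps_const 1 * fps_X ^ 0) (fps_X ^ 1) N N) (card {..<7::nat} * N)) $ n
     = (\<Sum>v | v \<in> PiE {..<7} (\<lambda>_. UNIV) \<and> sum v {..<7} = 0 \<and> (\<Sum>j<7::nat. theta_exp 1 0 (v j)) = n.
          \<Prod>j<7::nat. theta_coeff 1 1 1 (v j))"
    using assms by (intro const_term_nth) auto
  also have "{v. v \<in> PiE {..<7} (\<lambda>_. UNIV) \<and> sum v {..<7} = 0 \<and> (\<Sum>j<7::nat. theta_exp 1 0 (v j)) = n} = shell n"
    unfolding shell_def using sum_theta_exp_1_0 by blast
  finally show ?thesis by simp
qed

lemma prod_lessThan_7: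
  "(\<Prod>j<7::nat. f j) = f 0 * f 1 * f 2 * f 3 * f 4 * f 5 * (f 6 :: 'a::comm_monoid_mult)"
  by (simp add: eval_nat_numeral)

lemma sum_lessThan_7:
  "(\<Sum>j<7::nat. f j) = f 0 + f 1 + f 2 + f 3 + f 4 + f 5 + (f 6 :: 'a::comm_monoid_add)"
  by (simp add: eval_nat_numeral)

section \<open>Weighting the lattice by seventh roots of unity\<close>

definition \<zeta> :: complex where "\<zeta> = cis (2 * pi / 7)"

lemma zeta_power_7: "\<zeta> ^ 7 = 1"
  by (simp add: \<zeta>_def DeMoivre)

lemma zeta_neq_0: "\<zeta> \<noteq> 0" by (simp add: \<zeta>_def)

lemma zeta_neq_1: "\<zeta> \<noteq> 1"
proof
  assume "\<zeta> = 1"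
  then have "Im \<zeta> = 0" by simp
  moreover have "sin (2 * pi / 7) > 0" by (rule sin_gt_zero) (use pi_gt_zero in auto)
  ultimately show False by (simp add: \<zeta>_def)
qed

lemma zeta_sum: "1 + \<zeta> + \<zeta> ^ 2 + \<zeta> ^ 3 + \<zeta> ^ 4 + \<zeta> ^ 5 + \<zeta> ^ 6 = 0"
proof -
  have "(\<zeta> - 1) * (1 + \<zeta> + \<zeta> ^ 2 + \<zeta> ^ 3 + \<zeta> ^ 4 + \<zeta> ^ 5 + \<zeta> ^ 6) = \<zeta> ^ 7 - 1"
    by (simp add: algebra_simps eval_nat_numeral)
  then show ?thesis using zeta_neq_1 zeta_power_7 by simp
qed

text \<open>Derived from the two relations on z alone, since it is applied to constants of a
  polynomial ring over power series. Factors for z^j and z^(7-j) are paired; the periods c1, c2, c3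
  have elementary symmetric functions -1, -2, 1, those of the roots of x^3 + x^2 - 2x - 1.\<close>

lemma prod_add_root_of_unity_7:
  fixes a b z :: "'a::comm_ring_1"
  assumes z7: "z ^ 7 = 1" and sum: "1 + z + z ^ 2 + z ^ 3 + z ^ 4 + z ^ 5 + z ^ 6 = 0"
  shows "(a + b) * (a + z * b) * (a + z ^ 2 * b) * (a + z ^ 3 * b) * (a + z ^ 4 * b)
      * (a + z ^ 5 * b) * (a + z ^ 6 * b) = a ^ 7 + b ^ 7"
proof -
  define c1 c2 c3 where "c1 = z + z ^ 6" and "c2 = z ^ 2 + z ^ 5" and "c3 = z ^ 3 + z ^ 4"
  have red: "z * z ^ 6 = 1" "z ^ 2 * z ^ 5 = 1" "z ^ 3 * z ^ 4 = 1"
    using z7 by (simp_all flip: power_add power_Suc)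
  have hi: "z ^ 8 = z" "z ^ 9 = z ^ 2" "z ^ 10 = z ^ 3" "z ^ 11 = z ^ 4" "z ^ 12 = z ^ 5" "z ^ 13 = z ^ 6"
    "z ^ 14 = 1" "z ^ 15 = z"
    using power_add[of z 7] z7 power_add[of z 14 1] power_add[of z 7 7] by (simp_all add: numeral_eq_Suc)
  have c: "c1 + c2 + c3 = - 1"
    using sum unfolding c1_def c2_def c3_def by (simp add: algebra_simps eq_neg_iff_add_eq_0)
  have m12: "c1 * c2 = c1 + c3" and m13: "c1 * c3 = c2 + c3" and m23: "c2 * c3 = c1 + c2"
    unfolding c1_def c2_def c3_def
    by (simp_all add: ring_distribs flip: power_add power_Suc power_Suc2) (simp_all add: hi z7 add_ac)
  have c11: "c1 * c1 = c2 + 2"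
    unfolding c1_def c2_def
    by (simp add: ring_distribs flip: power_add power_Suc power_Suc2) (simp add: hi z7 power2_eq_square)
  have pair: "(a + y * b) * (a + y' * b) = a * a + (y + y') * (a * b) + b * b" if "y * y' = 1" for y y'
  proof -
    have "(a + y * b) * (a + y' * b) = a * a + (y + y') * (a * b) + (y * y') * (b * b)"
      by (simp add: algebra_simps)
    then show ?thesis using that by simp
  qed
  define s t where "s = a * a + b * b" and "t = a * b"
  have "(a + b) * (a + z * b) * (a + z ^ 2 * b) * (a + z ^ 3 * b) * (a + z ^ 4 * b)
      * (a + z ^ 5 * b) * (a + z ^ 6 * b)
    = (a + b) * ((a + z * b) * (a + z ^ 6 * b)) * ((a + z ^ 2 * b) * (a + z ^ 5 * b))
        * ((a + z ^ 3 * b) * (a + z ^ 4 * b))"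
    by (simp only: mult_ac)
  also have "\<dots> = (a + b) * ((s + c1 * t) * (s + c2 * t) * (s + c3 * t))"
    unfolding pair[OF red(1)] pair[OF red(2)] pair[OF red(3)] c1_def c2_def c3_def s_def t_def
    by (simp only: mult.assoc add_ac)
  also have "(s + c1 * t) * (s + c2 * t) * (s + c3 * t) = s * s * s + (c1 + c2 + c3) * (s * s * t)
      + (c1 * c2 + c1 * c3 + c2 * c3) * (s * t * t) + (c1 * (c2 * c3)) * (t * t * t)"
    by (simp add: algebra_simps)
  also have "c1 * c2 + c1 * c3 + c2 * c3 = - 2"
  proof -
    have "c1 * c2 + c1 * c3 + c2 * c3 = 2 * (c1 + c2 + c3)"
      unfolding m12 m13 m23 by (simp add: algebra_simps)
    then show ?thesis using c by simp
  qed
  also have "c1 * (c2 * c3) = 1"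
    using c by (simp only: m23 distrib_left c11 m12) (simp add: algebra_simps eq_neg_iff_add_eq_0)
  also have "c1 + c2 + c3 = - 1" by (rule c)
  also have "(a + b) * (s * s * s + - 1 * (s * s * t) + - 2 * (s * t * t) + 1 * (t * t * t)) = a ^ 7 + b ^ 7"
    unfolding s_def t_def by (simp add: algebra_simps eval_nat_numeral)
  finally show ?thesis .
qed

lemma prod_add_power_root_of_unity_7:
  fixes a b z :: "'a::comm_ring_1"
  assumes "z ^ 7 = 1" "1 + z + z ^ 2 + z ^ 3 + z ^ 4 + z ^ 5 + z ^ 6 = 0"
  shows "(\<Prod>j<7::nat. a + z ^ j * b) = a ^ 7 + b ^ 7"
    and "(\<Prod>j<7::nat. a + z ^ (7 - j) * b) = a ^ 7 + b ^ 7"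
  using prod_add_root_of_unity_7[OF assms, of a b] by (simp_all add: prod_lessThan_7 assms(1) mult_ac)

lemma coeff_pcompose_monom:
  assumes "d > 0"
  shows "coeff (pcompose p (monom (1::'a::comm_ring_1) d)) (d * k) = coeff p k"
proof (induction p arbitrary: k)
  case (pCons a p)
  show ?case
    using assms pCons by (cases k) (simp_all add: pcompose_pCons coeff_monom_mult coeff_pCons split: nat.split)
qed simp

text \<open>The product of 1 + \<zeta>^j y over j is 1 + y^7, and likewise for the inverse powers,
  so the seven twisted products collapse to a single one in z^7 and q^7. The inverse of \<zeta>^j is
  written \<zeta>^(7 - j).\<close>

lemma triple_prod_roots_of_unity:
  "(\<Prod>j<7::nat. triple (fps_const (\<zeta> ^ j) * fps_X ^ 1) (fps_const (\<zeta> ^ (7 - j)) * fps_X ^ 0) (fps_X ^ 1) N N)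
     = pcompose (triple (fps_X ^ 7) 1 (fps_X ^ 7) N N) (monom 1 7)"
proof -
  define Z where "Z = [:fps_const \<zeta>:]"
  have Zp: "Z ^ j = [:fps_const (\<zeta> ^ j):]" for j
    by (induction j) (simp_all add: Z_def mult.commute)
  have Z7: "Z ^ 7 = 1" by (simp add: Zp zeta_power_7)
  have Zs: "1 + Z + Z ^ 2 + Z ^ 3 + Z ^ 4 + Z ^ 5 + Z ^ 6 = 0"
  proof -
    have "1 + Z + Z ^ 2 + Z ^ 3 + Z ^ 4 + Z ^ 5 + Z ^ 6
        = [:fps_const (1 + \<zeta> + \<zeta> ^ 2 + \<zeta> ^ 3 + \<zeta> ^ 4 + \<zeta> ^ 5 + \<zeta> ^ 6):]"
      by (simp only: Zp) (simp add: Z_def one_pCons flip: fps_const_add)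
    then show ?thesis by (simp add: zeta_sum)
  qed
  have M: "monom 1 7 = [:0, 1 :: complex fps:] ^ 7" by (simp add: monom_altdef)
  have "(\<Prod>j<7::nat. [:1, fps_const (\<zeta> ^ j) * fps_X ^ 1 * (fps_X ^ 1) ^ i:])
      = pcompose [:1, fps_X ^ 7 * (fps_X ^ 7) ^ i:] (monom 1 7)" for i
  proof -
    have "[:1, fps_const (\<zeta> ^ j) * fps_X ^ 1 * (fps_X ^ 1) ^ i:] = 1 + Z ^ j * [:0, fps_X * fps_X ^ i:]" for j
      by (simp add: Zp one_pCons mult.assoc)
    then have "(\<Prod>j<7::nat. [:1, fps_const (\<zeta> ^ j) * fps_X ^ 1 * (fps_X ^ 1) ^ i:])
        = 1 ^ 7 + [:0, fps_X * fps_X ^ i:] ^ 7"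
      using prod_add_power_root_of_unity_7(1)[OF Z7 Zs, of 1 "[:0, fps_X * fps_X ^ i:]"]
      by (simp only:)
    also have "[:0, fps_X * fps_X ^ i:] = [:0, 1 :: complex fps:] * [:fps_X * fps_X ^ i:]" by simp
    also have "1 ^ 7 + ([:0, 1:] * [:fps_X * fps_X ^ i:]) ^ 7 = (1 :: complex fps poly) + monom 1 7 * [:(fps_X * fps_X ^ i) ^ 7:]"
      by (simp only: power_mult_distrib M poly_const_pow power_one)
    also have "\<dots> = pcompose [:1, fps_X ^ 7 * (fps_X ^ 7) ^ i:] (monom 1 7)"
      by (simp add: pcompose_pCons one_pCons power_mult_distrib flip: power_mult) (simp add: mult.commute)
    finally show ?thesis .
  qed
  moreover have "(\<Prod>j<7::nat. [:fps_const (\<zeta> ^ (7 - j)) * fps_X ^ 0 * (fps_X ^ 1) ^ i, 1:])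
      = pcompose [:1 * (fps_X ^ 7) ^ i, 1:] (monom 1 7)" for i
  proof -
    have "[:fps_const (\<zeta> ^ (7 - j)) * fps_X ^ 0 * (fps_X ^ 1) ^ i, 1:] = [:0, 1:] + Z ^ (7 - j) * [:fps_X ^ i:]" for j
      by (simp add: Zp)
    then have "(\<Prod>j<7::nat. [:fps_const (\<zeta> ^ (7 - j)) * fps_X ^ 0 * (fps_X ^ 1) ^ i, 1:])
        = [:0, 1:] ^ 7 + [:fps_X ^ i:] ^ 7"
      using prod_add_power_root_of_unity_7(2)[OF Z7 Zs, of "[:0, 1:]" "[:fps_X ^ i:]"]
      by (simp only:)
    also have "\<dots> = pcompose [:1 * (fps_X ^ 7) ^ i, 1:] (monom 1 7)"
      by (simp add: pcompose_pCons M poly_const_pow add.commute mult.commute flip: power_mult)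
    finally show ?thesis .
  qed
  ultimately show ?thesis
    unfolding triple_def prod.distrib pcompose_mult pcompose_prod
    by (subst (1 2) prod.swap) simp
qed

lemma theta_coeff_power_int:
  fixes u :: "'a::field"
  assumes "u * u' = 1"
  shows "theta_coeff u u' 1 m = u powi m"
proof -
  have "u' = inverse u" using assms by (metis inverse_unique)
  then show ?thesis by (simp add: theta_coeff_def power_int_def)
qed

lemma prod_power_int:
  fixes z :: "'a::field"
  assumes "z \<noteq> 0"
  shows "(\<Prod>j\<in>I. z powi f j) = z powi (\<Sum>j\<in>I. f j)"
  by (induction I rule: infinite_finite_induct) (auto simp: power_int_add assms)

lemma zeta_power_int: "\<zeta> powi m = \<zeta> ^ nat (m mod 7)"
proof -
  have "\<zeta> powi m = \<zeta> powi (7 * (m div 7) + m mod 7)" by simp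
  also have "\<dots> = (\<zeta> powi 7) powi (m div 7) * \<zeta> powi (m mod 7)"
    by (simp only: power_int_add[OF disjI1[OF zeta_neq_0]] power_int_mult)
  also have "\<zeta> powi 7 = 1" using zeta_power_7 by simp
  finally show ?thesis by (simp add: power_int_def)
qed

text \<open>One constant term is computed twice. Factor by factor it is the weighted lattice sum
  divided by E_1^7; after the collapse to z^7 and q^7 it is 1 / E_7.\<close>

lemma root_of_unity_theta_series:
  "euler 7 * Abs_fps (\<lambda>n. \<Sum>v\<in>shell n. \<zeta> ^ nat (moment v mod 7)) = euler 1 ^ 7"
proof (rule fps_eqI_X_adic)
  fix N
  define T where "T = (\<Prod>j<7::nat. triple (fps_const (\<zeta> ^ j) * fps_X ^ 1)
      (fps_const (\<zeta> ^ (7 - j)) * fps_X ^ 0) (fps_X ^ 1) N N)"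
  define \<Theta> where "\<Theta> = Abs_fps (\<lambda>n. \<Sum>v\<in>shell n. \<zeta> ^ nat (moment v mod 7))"
  have unit: "\<zeta> ^ j * \<zeta> ^ (7 - j) = 1" if "j < 7" for j
    using that zeta_power_7 by (simp flip: power_add)
  have "(euler 1 ^ 7 * coeff T (7 * N)) $ n = \<Theta> $ n" if "n < N" for n
  proof -
    have "(euler 1 ^ card {..<7::nat} * coeff T (card {..<7::nat} * N)) $ n
      = (\<Sum>v | v \<in> PiE {..<7} (\<lambda>_. UNIV) \<and> sum v {..<7} = 0 \<and> (\<Sum>j<7::nat. theta_exp 1 0 (v j)) = n.
          \<Prod>j<7::nat. theta_coeff (\<zeta> ^ j) (\<zeta> ^ (7 - j)) 1 (v j))"
      unfolding T_def using that unit by (intro const_term_nth) auto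
    also have "{v. v \<in> PiE {..<7} (\<lambda>_. UNIV) \<and> sum v {..<7} = 0 \<and> (\<Sum>j<7::nat. theta_exp 1 0 (v j)) = n} = shell n"
      unfolding shell_def using sum_theta_exp_1_0 by blast
    also have "(\<Sum>v\<in>shell n. \<Prod>j<7::nat. theta_coeff (\<zeta> ^ j) (\<zeta> ^ (7 - j)) 1 (v j))
        = (\<Sum>v\<in>shell n. \<Prod>j<7::nat. \<zeta> powi (int j * v j))"
      by (intro sum.cong prod.cong refl)
        (simp add: theta_coeff_power_int[OF unit] power_int_mult)
    also have "\<dots> = \<Theta> $ n"
      unfolding prod_power_int[OF zeta_neq_0] unfolding moment_def[symmetric] zeta_power_int \<Theta>_def by simp
    finally show ?thesis by simp
  qed
  then have "fps_X ^ N dvd \<Theta> - euler 1 ^ 7 * coeff T (7 * N)"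
    unfolding X_power_dvd_iff by simp
  then have "fps_X ^ N dvd euler 7 * \<Theta> - euler 7 * (euler 1 ^ 7 * coeff T (7 * N))"
    by (intro dvd_diff_mult) auto
  moreover have "coeff T (7 * N) = coeff (triple (fps_X ^ 7) 1 (fps_X ^ 7) N N) N"
    unfolding T_def triple_prod_roots_of_unity by (simp add: coeff_pcompose_monom)
  moreover have "fps_X ^ N dvd euler 7 * coeff (triple (fps_X ^ 7) 1 (fps_X ^ 7) N N) N - (1 :: complex fps)"
    using triple_product_X_adic[of 7 "fps_X ^ 7" "1 :: complex fps" N N] by (simp add: dvd_power)
  then have "fps_X ^ N dvd euler 1 ^ 7 * (euler 7 * coeff (triple (fps_X ^ 7) 1 (fps_X ^ 7) N N) N) - euler 1 ^ 7 * (1 :: complex fps)"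
    by (intro dvd_diff_mult) auto
  ultimately show "fps_X ^ N dvd euler 7 * \<Theta> - euler 1 ^ 7"
    by (auto simp: mult.left_commute intro: dvd_diff_trans)
qed

section \<open>Symmetry of the nonzero moment classes\<close>

definition dilate :: "nat \<Rightarrow> (nat \<Rightarrow> int) \<Rightarrow> nat \<Rightarrow> int" where
  "dilate s v = (\<lambda>j\<in>{..<7}. v (s * j mod 7))"

lemma coprime_7:
  assumes "s \<in> {1..6::nat}"
  shows "coprime s 7"
proof -
  have "\<not> 7 dvd s" using assms by (auto dest: dvd_imp_le)
  then show ?thesis using prime_imp_coprime[of 7 s] by (simp add: coprime_commute)
qed

lemma bij_betw_times_mod_7:
  assumes "s \<in> {1..6::nat}"
  shows "bij_betw (\<lambda>j. s * j mod 7) {..<7} {..<7}"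
proof -
  have "coprime s 7" using assms by (rule coprime_7)
  then have "inj_on (\<lambda>j. s * j mod 7) {..<7}"
    by (auto intro!: inj_onI simp: cong_def[symmetric] cong_mult_lcancel_nat cong_less_modulus_unique_nat)
  then show ?thesis
    using endo_inj_surj[of "{..<7}" "\<lambda>j. s * j mod 7"] by (auto simp: bij_betw_def image_subset_iff)
qed

text \<open>Reindexing by k = s j modulo 7 only permutes coordinates, so sum and norm survive, while
  the moment is divided by s modulo 7.\<close>

lemma dilate_shell:
  assumes s: "s \<in> {1..6::nat}" and v: "v \<in> shell n"
  shows "dilate s v \<in> shell n" and "[int s * moment (dilate s v) = moment v] (mod 7)"
proof -
  have sum: "(\<Sum>j<7. g (dilate s v j)) = (\<Sum>j<7. g (v j))" for g :: "int \<Rightarrow> int"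
    using sum.reindex_bij_betw[OF bij_betw_times_mod_7[OF s], of "\<lambda>j. g (v j)"]
    by (simp add: dilate_def)
  show "dilate s v \<in> shell n"
    using v sum[of "\<lambda>x. x"] sum[of "\<lambda>x. x\<^sup>2"] by (simp add: shell_def dilate_def)
  have "int s * moment (dilate s v) = (\<Sum>j<7. int (s * j) * v (s * j mod 7))"
    by (simp add: moment_def dilate_def sum_distrib_left mult.assoc)
  also have "[\<dots> = (\<Sum>j<7. int (s * j mod 7) * v (s * j mod 7))] (mod 7)"
    by (intro cong_sum cong_mult) (auto simp: cong_def zmod_int)
  also have "(\<Sum>j<7. int (s * j mod 7) * v (s * j mod 7)) = moment v"
    using sum.reindex_bij_betw[OF bij_betw_times_mod_7[OF s], of "\<lambda>j. int j * v j"]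
    by (simp add: moment_def)
  finally show "[int s * moment (dilate s v) = moment v] (mod 7)" .
qed

lemma inj_on_dilate:
  assumes s: "s \<in> {1..6::nat}"
  shows "inj_on (dilate s) (shell n)"
proof (rule inj_onI)
  fix v w assume vw: "v \<in> shell n" "w \<in> shell n" "dilate s v = dilate s w"
  have "v k = w k" if "k < 7" for k
  proof -
    have "k \<in> (\<lambda>j. s * j mod 7) ` {..<7}"
      using bij_betw_imp_surj_on[OF bij_betw_times_mod_7[OF s]] that by simp
    then obtain j where "j < 7" "k = s * j mod 7" by auto
    then show ?thesis using fun_cong[OF vw(3), of j] by (simp add: dilate_def)
  qed
  then show "v = w"
    using vw(1,2) by (intro PiE_ext[of v "{..<7}" "\<lambda>_. UNIV" w]) (auto simp: shell_def)
qed

lemma shell_count_le: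
  assumes s: "s \<in> {1..6::nat}" and r': "[int s * r = r'] (mod 7)" and "r \<in> {0..<7}" "r' \<in> {0..<7}"
  shows "shell_count n r' \<le> shell_count n r"
  unfolding shell_count_def
proof (rule card_inj_on_le[of "dilate s"])
  show "inj_on (dilate s) {v \<in> shell n. moment v mod 7 = r'}"
    using inj_on_dilate[OF s, of n] by (rule inj_on_subset) auto
  show "finite {v \<in> shell n. moment v mod 7 = r}" using finite_shell by simp
  have "coprime (int s) 7"
    using coprime_7[OF s] by (metis coprime_int_iff of_nat_numeral)
  show "dilate s ` {v \<in> shell n. moment v mod 7 = r'} \<subseteq> {v \<in> shell n. moment v mod 7 = r}"
  proof safe
    fix v assume v: "v \<in> shell n" "r' = moment v mod 7"
    show "dilate s v \<in> shell n" using dilate_shell(1)[OF s v(1)] .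
    have "[int s * moment (dilate s v) = int s * r] (mod 7)"
      using dilate_shell(2)[OF s v(1)] r' v(2) by (simp add: cong_def)
    then have "[moment (dilate s v) = r] (mod 7)"
      using \<open>coprime (int s) 7\<close> by (simp add: cong_mult_lcancel)
    then show "moment (dilate s v) mod 7 = r"
      using assms(3) by (simp add: cong_def)
  qed
qed

lemma shell_count_eq:
  assumes "r \<in> {1,2,3,4,5,6}"
  shows "shell_count n r = shell_count n 1"
proof -
  \<comment> \<open>\<open>s r\<close> is the inverse of \<open>r\<close> modulo 7; dilating by
    \<open>r\<close> gives one inequality and by its inverse the other.\<close>
  define s :: "int \<Rightarrow> nat" where "s r = (if r = 1 then 1 else if r = 2 then 4 else if r = 3 then 5
    else if r = 4 then 2 else if r = 5 then 3 else 6)" for r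
  have "shell_count n r \<le> shell_count n 1"
    by (rule shell_count_le[of "nat r"]) (use assms in \<open>auto simp: cong_def\<close>)
  moreover have "shell_count n 1 \<le> shell_count n r"
    by (rule shell_count_le[of "s r"]) (use assms in \<open>auto simp: cong_def s_def\<close>)
  ultimately show ?thesis by simp
qed

lemma sum_shell_by_moment:
  fixes g :: "int \<Rightarrow> 'a::comm_ring_1"
  shows "(\<Sum>v\<in>shell n. g (moment v mod 7))
    = of_nat (shell_count n 0) * g 0 + of_nat (shell_count n 1) * (g 1 + g 2 + g 3 + g 4 + g 5 + g 6)"
proof -
  have "(\<Sum>v\<in>shell n. g (moment v mod 7))
      = (\<Sum>r\<in>{0,1,2,3,4,5,6}. \<Sum>v\<in>{v \<in> shell n. moment v mod 7 = r}. g (moment v mod 7))"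
  proof (rule sum.group[symmetric])
    show "(\<lambda>v. moment v mod 7) ` shell n \<subseteq> {0,1,2,3,4,5,6}"
    proof
      fix x assume "x \<in> (\<lambda>v. moment v mod 7) ` shell n"
      then have "0 \<le> x" "x < 7" by auto
      then show "x \<in> {0,1,2,3,4,5,6}" by (simp; presburger)
    qed
  qed (auto simp: finite_shell)
  also have "\<dots> = (\<Sum>r\<in>{0,1,2,3,4,5,6}. of_nat (shell_count n r) * g r)"
    by (intro sum.cong refl) (simp add: shell_count_def)
  also have "\<dots> = of_nat (shell_count n 0) * g 0 + of_nat (shell_count n 1) * (g 1 + g 2 + g 3 + g 4 + g 5 + g 6)"
  proof -
    have "shell_count n 2 = shell_count n 1" "shell_count n 3 = shell_count n 1"
      "shell_count n 4 = shell_count n 1" "shell_count n 5 = shell_count n 1"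
      "shell_count n 6 = shell_count n 1"
      by (rule shell_count_eq; simp)+
    then show ?thesis by (simp add: distrib_left add_ac)
  qed
  finally show ?thesis .
qed

lemma card_shell: "card (shell n) = shell_count n 0 + 6 * shell_count n 1"
proof -
  have "int (card (shell n)) = int (shell_count n 0 + 6 * shell_count n 1)"
    using sum_shell_by_moment[of "\<lambda>_. 1 :: int" n] by simp
  then show ?thesis by linarith
qed

text \<open>Roots of unity force complex coefficients. This embedding is multiplicative and
  injective, so the identity obtained there descends to integer series.\<close>

definition fps_complex :: "int fps \<Rightarrow> complex fps" where
  "fps_complex f = Abs_fps (\<lambda>n. of_int (f $ n))"

lemma fps_complex_mult: "fps_complex (f * g) = fps_complex f * fps_complex g"
  by (simp add: fps_complex_def fps_eq_iff fps_mult_nth)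

lemma fps_complex_1: "fps_complex 1 = 1"
  by (simp add: fps_complex_def fps_eq_iff)

lemma fps_complex_power: "fps_complex (f ^ n) = fps_complex f ^ n"
  by (induction n) (simp_all add: fps_complex_mult fps_complex_1)

lemma fps_complex_qpoch: "fps_complex (qpoch (fps_X ^ k) n) = qpoch (fps_X ^ k) n"
proof (induction n)
  case (Suc n)
  have "fps_complex (1 - (fps_X ^ k) ^ Suc n) = 1 - (fps_X ^ k) ^ Suc n"
    by (simp add: fps_complex_def fps_eq_iff flip: power_mult power_add)
  then show ?case unfolding qpoch_Suc fps_complex_mult Suc by simp
qed (simp add: fps_complex_1)

lemma fps_complex_euler: "fps_complex (euler k) = euler k"
proof (rule fps_ext)
  fix n
  show "fps_complex (euler k) $ n = euler k $ n"
    using arg_cong[OF fps_complex_qpoch[of k n], of "\<lambda>f. f $ n"]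
    by (simp add: fps_complex_def euler_def)
qed

lemma shell_count_diff_series:
  "euler 7 * Abs_fps (\<lambda>n. int (shell_count n 0) - int (shell_count n 1)) = (euler 1 ^ 7 :: int fps)"
proof -
  have "(\<Sum>v\<in>shell n. \<zeta> ^ nat (moment v mod 7)) = of_int (int (shell_count n 0) - int (shell_count n 1))" for n
  proof -
    have "\<zeta> + \<zeta> ^ 2 + \<zeta> ^ 3 + \<zeta> ^ 4 + \<zeta> ^ 5 + \<zeta> ^ 6 = - 1"
      using zeta_sum by (simp add: algebra_simps eq_neg_iff_add_eq_0)
    then show ?thesis
      using sum_shell_by_moment[of "\<lambda>r. \<zeta> ^ nat r" n] by simp
  qed
  then have "fps_complex (euler 7 * Abs_fps (\<lambda>n. int (shell_count n 0) - int (shell_count n 1)))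
      = fps_complex (euler 1 ^ 7)"
    using root_of_unity_theta_series
    by (simp add: fps_complex_mult fps_complex_power fps_complex_euler) (simp add: fps_complex_def)
  then show ?thesis by (simp add: fps_complex_def fps_eq_iff)
qed

section \<open>Seven-cores and an exceptional isometry\<close>

text \<open>In the parametrization of Garvan, Kim and Stanton these vectors are the 7-cores of \<open>n\<close>.\<close>

definition core_vecs :: "nat \<Rightarrow> (nat \<Rightarrow> int) set" where
  "core_vecs n = {v. v \<in> PiE {..<7} (\<lambda>_. UNIV) \<and> sum v {..<7} = 0
     \<and> 7 * (\<Sum>j<7. (v j)\<^sup>2) - 2 * moment v = 2 * int n}"

lemma prod_lessThan_7_times:
  fixes n :: nat
  shows "(\<Prod>i<7 * n. f i) = (\<Prod>i<n. \<Prod>j<7. f (7 * i + j) :: 'a::comm_monoid_mult)"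
proof (induction n)
  case (Suc n)
  have "(\<Prod>i<m + k. f i) = (\<Prod>i<m. f i) * (\<Prod>j<k. f (m + j))" for m k
    by (induction k) (simp_all add: mult.assoc)
  from this[of "7 * n" 7] have "(\<Prod>i<7 * Suc n. f i) = (\<Prod>i<7 * n. f i) * (\<Prod>j<7. f (7 * n + j))"
    by (simp add: add.commute)
  then show ?case using Suc by simp
qed simp

text \<open>The exponents 7 i + 7 - j run through all positive integers and 7 i + j through all
  natural numbers, so the seven products of base q^7 interleave to one of base q. In the first
  family the order within a block is reversed, whence j -> 6 - j.\<close>

lemma triple_prod_residues:
  "(\<Prod>j<7::nat. triple (fps_const 1 * fps_X ^ (7 - j)) (fps_const 1 * fps_X ^ j) (fps_X ^ 7) N N)
     = (triple (fps_X ^ 1) 1 (fps_X ^ 1) (7 * N) (7 * N) :: int fps poly)"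
proof -
  have "(\<Prod>j<7::nat. [:1, fps_const 1 * fps_X ^ (7 - j) * (fps_X ^ 7) ^ i:])
      = (\<Prod>j<7. [:1, fps_X ^ 1 * (fps_X ^ 1) ^ (7 * i + j) :: int fps:])" for i
  proof (rule prod.reindex_bij_witness[of _ "\<lambda>j. 6 - j" "\<lambda>j. 6 - j"])
    fix j :: nat assume "j \<in> {..<7}"
    then have "7 - j + 7 * i = Suc (7 * i + (6 - j))" by auto
    then have "fps_X ^ (7 - j) * fps_X ^ (7 * i) = (fps_X * fps_X ^ (7 * i + (6 - j)) :: int fps)"
      by (metis power_Suc power_add)
    then show "[:1, fps_X ^ 1 * (fps_X ^ 1) ^ (7 * i + (6 - j)) :: int fps:]
        = [:1, fps_const 1 * fps_X ^ (7 - j) * (fps_X ^ 7) ^ i:]"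
      by (simp flip: power_mult)
  qed auto
  moreover have "(\<Prod>j<7::nat. [:fps_const 1 * fps_X ^ j * (fps_X ^ 7) ^ i, 1:])
      = (\<Prod>j<7. [:1 * (fps_X ^ 1) ^ (7 * i + j), 1 :: int fps:])" for i
    by (intro prod.cong refl) (simp add: power_add mult.commute flip: power_mult)
  ultimately show ?thesis
    unfolding triple_def prod.distrib prod_lessThan_7_times
    by (subst (1 2) prod.swap) simp
qed

lemma sum_theta_exp_core:
  assumes "sum v {..<7::nat} = 0"
  shows "(\<Sum>j<7. theta_exp (7 - j) j (v j)) = n \<longleftrightarrow> 7 * (\<Sum>j<7. (v j)\<^sup>2) - 2 * moment v = 2 * int n"
proof -
  have "2 * int (\<Sum>j<7. theta_exp (7 - j) j (v j)) = (\<Sum>j<7. 2 * int (theta_exp (7 - j) j (v j)))"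
    by (simp only: of_nat_sum sum_distrib_left)
  also have "\<dots> = (\<Sum>j<7. 7 * (v j)\<^sup>2 + 7 * v j - 2 * (int j * v j))"
    by (intro sum.cong refl) (simp add: two_times_theta_exp of_nat_diff algebra_simps)
  also have "\<dots> = 7 * (\<Sum>j<7. (v j)\<^sup>2) + 7 * sum v {..<7} - 2 * moment v"
    by (simp add: sum.distrib sum_subtractf sum_distrib_left moment_def)
  finally show ?thesis using assms by linarith
qed

text \<open>Again one constant term in two ways: as a lattice sum it is the core series divided by
  E_7^7, and after interleaving it is 1 / E_1.\<close>

lemma core_series: "euler 1 * Abs_fps (\<lambda>n. int (card (core_vecs n))) = euler 7 ^ 7"
proof (rule fps_eqI_X_adic)
  fix N
  define T where "T = (\<Prod>j<7::nat. triple (fps_const 1 * fps_X ^ (7 - j))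
      (fps_const 1 * fps_X ^ j) (fps_X ^ 7) N N :: int fps poly)"
  define \<Theta> where "\<Theta> = Abs_fps (\<lambda>n. int (card (core_vecs n)))"
  have "(euler 7 ^ 7 * coeff T (7 * N)) $ n = \<Theta> $ n" if "n < N" for n
  proof -
    have "(euler 7 ^ card {..<7::nat} * coeff T (card {..<7::nat} * N)) $ n
      = (\<Sum>v | v \<in> PiE {..<7} (\<lambda>_. UNIV) \<and> sum v {..<7} = 0 \<and> (\<Sum>j<7::nat. theta_exp (7 - j) j (v j)) = n.
          \<Prod>j<7::nat. theta_coeff 1 1 1 (v j))"
      unfolding T_def using that by (intro const_term_nth) auto
    also have "{v. v \<in> PiE {..<7} (\<lambda>_. UNIV) \<and> sum v {..<7} = 0 \<and> (\<Sum>j<7::nat. theta_exp (7 - j) j (v j)) = n} = core_vecs n"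
      unfolding core_vecs_def using sum_theta_exp_core by blast
    finally show ?thesis by (simp add: \<Theta>_def)
  qed
  then have "fps_X ^ N dvd \<Theta> - euler 7 ^ 7 * coeff T (7 * N)"
    unfolding X_power_dvd_iff by simp
  then have "fps_X ^ N dvd euler 1 * \<Theta> - euler 1 * (euler 7 ^ 7 * coeff T (7 * N))"
    by (intro dvd_diff_mult) auto
  moreover have "fps_X ^ N dvd euler 1 * coeff T (7 * N) - (1 :: int fps)"
  proof -
    have "fps_X ^ N dvd (fps_X ^ (7 * N) :: int fps)" by (intro le_imp_power_dvd) simp
    also have "\<dots> dvd euler 1 * coeff (triple (fps_X ^ 1) 1 (fps_X ^ 1) (7 * N) (7 * N)) (7 * N)
        - theta_coeff (fps_X ^ 1) 1 (fps_X ^ 1) (int (7 * N) - int (7 * N))"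
      by (rule triple_product_X_adic) auto
    finally show ?thesis unfolding T_def triple_prod_residues by simp
  qed
  then have "fps_X ^ N dvd euler 7 ^ 7 * (euler 1 * coeff T (7 * N)) - euler 7 ^ 7 * 1"
    by (intro dvd_diff_mult) auto
  ultimately show "fps_X ^ N dvd euler 1 * \<Theta> - euler 7 ^ 7"
    by (auto simp: mult.left_commute intro: dvd_diff_trans)
qed

definition vec7 :: "int list \<Rightarrow> nat \<Rightarrow> int" where
  "vec7 xs = (\<lambda>j\<in>{..<7}. xs ! j)"

text \<open>The symmetric matrix below is 7 times a rational orthogonal involution \<open>M\<close>. It is an
  automorphism of the Craig lattice \<open>A\<^sub>6\<^sup>(\<^sup>2\<^sup>)\<close> of all \<open>v \<in> A\<^sub>6\<close> with \<open>moment v \<equiv> 0 (mod 7)\<close>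
  that does not preserve the overlattice \<open>A\<^sub>6\<close>, found by computing images of the minimal vectors.
  With \<open>b = (-3, \<dots>, 3)\<close> the map is \<open>v \<mapsto> M v + b / 7\<close>, and its inverse is \<open>w \<mapsto> M (w - b / 7)\<close>.
  The divisions by 7 are exact on the vectors considered.\<close>

definition isometry :: "(nat \<Rightarrow> int) \<Rightarrow> nat \<Rightarrow> int" where
  "isometry v = vec7 [
    (5 * v 0 + v 1 - 3 * v 2 + 3 * v 4 - v 5 + 2 * v 6 - 3) div 7,
    (v 0 + 3 * v 1 + 5 * v 2 + 2 * v 4 - 3 * v 5 - v 6 - 2) div 7,
    (- 3 * v 0 + 5 * v 1 - v 2 + v 4 + 2 * v 5 + 3 * v 6 - 1) div 7,
    (7 * v 3) div 7,
    (3 * v 0 + 2 * v 1 + v 2 - v 4 + 5 * v 5 - 3 * v 6 + 1) div 7,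
    (- v 0 - 3 * v 1 + 2 * v 2 + 5 * v 4 + 3 * v 5 + v 6 + 2) div 7,
    (2 * v 0 - v 1 + 3 * v 2 - 3 * v 4 + v 5 + 5 * v 6 + 3) div 7]"

definition isometry_inv :: "(nat \<Rightarrow> int) \<Rightarrow> nat \<Rightarrow> int" where
  "isometry_inv w = vec7 [
    (5 * w 0 + w 1 - 3 * w 2 + 3 * w 4 - w 5 + 2 * w 6 + 1) div 7,
    (w 0 + 3 * w 1 + 5 * w 2 + 2 * w 4 - 3 * w 5 - w 6 + 3) div 7,
    (- 3 * w 0 + 5 * w 1 - w 2 + w 4 + 2 * w 5 + 3 * w 6 - 2) div 7,
    (7 * w 3) div 7,
    (3 * w 0 + 2 * w 1 + w 2 - w 4 + 5 * w 5 - 3 * w 6 + 2) div 7,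
    (- w 0 - 3 * w 1 + 2 * w 2 + 5 * w 4 + 3 * w 5 + w 6 - 3) div 7,
    (2 * w 0 - w 1 + 3 * w 2 - 3 * w 4 + w 5 + 5 * w 6 - 1) div 7]"

lemma vec7_in_PiE: "vec7 xs \<in> PiE {..<7} (\<lambda>_. UNIV)"
  by (simp add: vec7_def)

lemma isometry_in_PiE:
  "isometry v \<in> PiE {..<7} (\<lambda>_. UNIV)" "isometry_inv w \<in> PiE {..<7} (\<lambda>_. UNIV)"
  unfolding isometry_def isometry_inv_def by (rule vec7_in_PiE)+

lemma times_div_7: "x = 7 * k \<Longrightarrow> 7 * (x div 7) = (x :: int)"
  by simp

text \<open>The offsets are matched to the class of moment 1: with moment v = 7 t + 1 every
  numerator is a multiple of 7.\<close>

lemma isometry_times_7: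
  assumes "sum v {..<7} = 0" "moment v mod 7 = 1"
  shows
    "7 * isometry v 0 = 5 * v 0 + v 1 - 3 * v 2 + 3 * v 4 - v 5 + 2 * v 6 - 3"
    "7 * isometry v 1 = v 0 + 3 * v 1 + 5 * v 2 + 2 * v 4 - 3 * v 5 - v 6 - 2"
    "7 * isometry v 2 = - 3 * v 0 + 5 * v 1 - v 2 + v 4 + 2 * v 5 + 3 * v 6 - 1"
    "7 * isometry v 3 = 7 * v 3"
    "7 * isometry v 4 = 3 * v 0 + 2 * v 1 + v 2 - v 4 + 5 * v 5 - 3 * v 6 + 1"
    "7 * isometry v 5 = - v 0 - 3 * v 1 + 2 * v 2 + 5 * v 4 + 3 * v 5 + v 6 + 2"
    "7 * isometry v 6 = 2 * v 0 - v 1 + 3 * v 2 - 3 * v 4 + v 5 + 5 * v 6 + 3"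
proof -
  define t where "t = moment v div 7"
  have "moment v = 7 * t + 1" using assms(2) mult_div_mod_eq[of 7 "moment v"] by (simp add: t_def)
  then have m: "v 1 + 2 * v 2 + 3 * v 3 + 4 * v 4 + 5 * v 5 + 6 * v 6 = 7 * t + 1"
    by (simp add: moment_def sum_lessThan_7)
  have s: "v 0 + v 1 + v 2 + v 3 + v 4 + v 5 + v 6 = 0"
    using assms(1) by (simp add: sum_lessThan_7)
  \<comment> \<open>The quotients come from eliminating \<open>v 0\<close> and \<open>v 1\<close> by
    the sum and moment relations.\<close>
  have "5 * v 0 + v 1 - 3 * v 2 + 3 * v 4 - v 5 + 2 * v 6 - 3 = 7 * (v 3 + 2 * v 4 + 2 * v 5 + 3 * v 6 - 4 * t - 1)"
    using s m by algebra
  then have "7 * ((5 * v 0 + v 1 - 3 * v 2 + 3 * v 4 - v 5 + 2 * v 6 - 3) div 7) = 5 * v 0 + v 1 - 3 * v 2 + 3 * v 4 - v 5 + 2 * v 6 - 3" by (rule times_div_7)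
  then show "7 * isometry v 0 = 5 * v 0 + v 1 - 3 * v 2 + 3 * v 4 - v 5 + 2 * v 6 - 3"
    by (simp add: isometry_def vec7_def)
  have "v 0 + 3 * v 1 + 5 * v 2 + 2 * v 4 - 3 * v 5 - v 6 - 2 = 7 * (- v 3 - v 4 - 2 * v 5 - 2 * v 6 + 2 * t)"
    using s m by algebra
  then have "7 * ((v 0 + 3 * v 1 + 5 * v 2 + 2 * v 4 - 3 * v 5 - v 6 - 2) div 7) = v 0 + 3 * v 1 + 5 * v 2 + 2 * v 4 - 3 * v 5 - v 6 - 2" by (rule times_div_7)
  then show "7 * isometry v 1 = v 0 + 3 * v 1 + 5 * v 2 + 2 * v 4 - 3 * v 5 - v 6 - 2"
    by (simp add: isometry_def vec7_def)
  have "- 3 * v 0 + 5 * v 1 - v 2 + v 4 + 2 * v 5 + 3 * v 6 - 1 = 7 * (- 2 * v 2 - 3 * v 3 - 4 * v 4 - 5 * v 5 - 6 * v 6 + 8 * t + 1)"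
    using s m by algebra
  then have "7 * ((- 3 * v 0 + 5 * v 1 - v 2 + v 4 + 2 * v 5 + 3 * v 6 - 1) div 7) = - 3 * v 0 + 5 * v 1 - v 2 + v 4 + 2 * v 5 + 3 * v 6 - 1" by (rule times_div_7)
  then show "7 * isometry v 2 = - 3 * v 0 + 5 * v 1 - v 2 + v 4 + 2 * v 5 + 3 * v 6 - 1"
    by (simp add: isometry_def vec7_def)
  have "7 * v 3 = 7 * (v 3)" ..
  then have "7 * ((7 * v 3) div 7) = 7 * v 3" by (rule times_div_7)
  then show "7 * isometry v 3 = 7 * v 3"
    by (simp add: isometry_def vec7_def)
  have "3 * v 0 + 2 * v 1 + v 2 - v 4 + 5 * v 5 - 3 * v 6 + 1 = 7 * (v 5 - t)"
    using s m by algebra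
  then have "7 * ((3 * v 0 + 2 * v 1 + v 2 - v 4 + 5 * v 5 - 3 * v 6 + 1) div 7) = 3 * v 0 + 2 * v 1 + v 2 - v 4 + 5 * v 5 - 3 * v 6 + 1" by (rule times_div_7)
  then show "7 * isometry v 4 = 3 * v 0 + 2 * v 1 + v 2 - v 4 + 5 * v 5 - 3 * v 6 + 1"
    by (simp add: isometry_def vec7_def)
  have "- v 0 - 3 * v 1 + 2 * v 2 + 5 * v 4 + 3 * v 5 + v 6 + 2 = 7 * (v 2 + v 3 + 2 * v 4 + 2 * v 5 + 2 * v 6 - 2 * t)"
    using s m by algebra
  then have "7 * ((- v 0 - 3 * v 1 + 2 * v 2 + 5 * v 4 + 3 * v 5 + v 6 + 2) div 7) = - v 0 - 3 * v 1 + 2 * v 2 + 5 * v 4 + 3 * v 5 + v 6 + 2" by (rule times_div_7)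
  then show "7 * isometry v 5 = - v 0 - 3 * v 1 + 2 * v 2 + 5 * v 4 + 3 * v 5 + v 6 + 2"
    by (simp add: isometry_def vec7_def)
  have "2 * v 0 - v 1 + 3 * v 2 - 3 * v 4 + v 5 + 5 * v 6 + 3 = 7 * (v 2 + v 3 + v 4 + 2 * v 5 + 3 * v 6 - 3 * t)"
    using s m by algebra
  then have "7 * ((2 * v 0 - v 1 + 3 * v 2 - 3 * v 4 + v 5 + 5 * v 6 + 3) div 7) = 2 * v 0 - v 1 + 3 * v 2 - 3 * v 4 + v 5 + 5 * v 6 + 3" by (rule times_div_7)
  then show "7 * isometry v 6 = 2 * v 0 - v 1 + 3 * v 2 - 3 * v 4 + v 5 + 5 * v 6 + 3"
    by (simp add: isometry_def vec7_def)
qed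

text \<open>The moment class 2 assumed here is the one that \<open>moment_core_vecs\<close>
  supplies.\<close>

lemma isometry_inv_times_7:
  assumes "sum w {..<7} = 0" "moment w mod 7 = 2"
  shows
    "7 * isometry_inv w 0 = 5 * w 0 + w 1 - 3 * w 2 + 3 * w 4 - w 5 + 2 * w 6 + 1"
    "7 * isometry_inv w 1 = w 0 + 3 * w 1 + 5 * w 2 + 2 * w 4 - 3 * w 5 - w 6 + 3"
    "7 * isometry_inv w 2 = - 3 * w 0 + 5 * w 1 - w 2 + w 4 + 2 * w 5 + 3 * w 6 - 2"
    "7 * isometry_inv w 3 = 7 * w 3"
    "7 * isometry_inv w 4 = 3 * w 0 + 2 * w 1 + w 2 - w 4 + 5 * w 5 - 3 * w 6 + 2"
    "7 * isometry_inv w 5 = - w 0 - 3 * w 1 + 2 * w 2 + 5 * w 4 + 3 * w 5 + w 6 - 3"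
    "7 * isometry_inv w 6 = 2 * w 0 - w 1 + 3 * w 2 - 3 * w 4 + w 5 + 5 * w 6 - 1"
proof -
  define t where "t = moment w div 7"
  have "moment w = 7 * t + 2" using assms(2) mult_div_mod_eq[of 7 "moment w"] by (simp add: t_def)
  then have m: "w 1 + 2 * w 2 + 3 * w 3 + 4 * w 4 + 5 * w 5 + 6 * w 6 = 7 * t + 2"
    by (simp add: moment_def sum_lessThan_7)
  have s: "w 0 + w 1 + w 2 + w 3 + w 4 + w 5 + w 6 = 0"
    using assms(1) by (simp add: sum_lessThan_7)
  have "5 * w 0 + w 1 - 3 * w 2 + 3 * w 4 - w 5 + 2 * w 6 + 1 = 7 * (w 3 + 2 * w 4 + 2 * w 5 + 3 * w 6 - 4 * t - 1)"
    using s m by algebra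
  then have "7 * ((5 * w 0 + w 1 - 3 * w 2 + 3 * w 4 - w 5 + 2 * w 6 + 1) div 7) = 5 * w 0 + w 1 - 3 * w 2 + 3 * w 4 - w 5 + 2 * w 6 + 1" by (rule times_div_7)
  then show "7 * isometry_inv w 0 = 5 * w 0 + w 1 - 3 * w 2 + 3 * w 4 - w 5 + 2 * w 6 + 1"
    by (simp add: isometry_inv_def vec7_def)
  have "w 0 + 3 * w 1 + 5 * w 2 + 2 * w 4 - 3 * w 5 - w 6 + 3 = 7 * (- w 3 - w 4 - 2 * w 5 - 2 * w 6 + 2 * t + 1)"
    using s m by algebra
  then have "7 * ((w 0 + 3 * w 1 + 5 * w 2 + 2 * w 4 - 3 * w 5 - w 6 + 3) div 7) = w 0 + 3 * w 1 + 5 * w 2 + 2 * w 4 - 3 * w 5 - w 6 + 3" by (rule times_div_7)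
  then show "7 * isometry_inv w 1 = w 0 + 3 * w 1 + 5 * w 2 + 2 * w 4 - 3 * w 5 - w 6 + 3"
    by (simp add: isometry_inv_def vec7_def)
  have "- 3 * w 0 + 5 * w 1 - w 2 + w 4 + 2 * w 5 + 3 * w 6 - 2 = 7 * (- 2 * w 2 - 3 * w 3 - 4 * w 4 - 5 * w 5 - 6 * w 6 + 8 * t + 2)"
    using s m by algebra
  then have "7 * ((- 3 * w 0 + 5 * w 1 - w 2 + w 4 + 2 * w 5 + 3 * w 6 - 2) div 7) = - 3 * w 0 + 5 * w 1 - w 2 + w 4 + 2 * w 5 + 3 * w 6 - 2" by (rule times_div_7)
  then show "7 * isometry_inv w 2 = - 3 * w 0 + 5 * w 1 - w 2 + w 4 + 2 * w 5 + 3 * w 6 - 2"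
    by (simp add: isometry_inv_def vec7_def)
  have "7 * w 3 = 7 * (w 3)" ..
  then have "7 * ((7 * w 3) div 7) = 7 * w 3" by (rule times_div_7)
  then show "7 * isometry_inv w 3 = 7 * w 3"
    by (simp add: isometry_inv_def vec7_def)
  have "3 * w 0 + 2 * w 1 + w 2 - w 4 + 5 * w 5 - 3 * w 6 + 2 = 7 * (w 5 - t)"
    using s m by algebra
  then have "7 * ((3 * w 0 + 2 * w 1 + w 2 - w 4 + 5 * w 5 - 3 * w 6 + 2) div 7) = 3 * w 0 + 2 * w 1 + w 2 - w 4 + 5 * w 5 - 3 * w 6 + 2" by (rule times_div_7)
  then show "7 * isometry_inv w 4 = 3 * w 0 + 2 * w 1 + w 2 - w 4 + 5 * w 5 - 3 * w 6 + 2"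
    by (simp add: isometry_inv_def vec7_def)
  have "- w 0 - 3 * w 1 + 2 * w 2 + 5 * w 4 + 3 * w 5 + w 6 - 3 = 7 * (w 2 + w 3 + 2 * w 4 + 2 * w 5 + 2 * w 6 - 2 * t - 1)"
    using s m by algebra
  then have "7 * ((- w 0 - 3 * w 1 + 2 * w 2 + 5 * w 4 + 3 * w 5 + w 6 - 3) div 7) = - w 0 - 3 * w 1 + 2 * w 2 + 5 * w 4 + 3 * w 5 + w 6 - 3" by (rule times_div_7)
  then show "7 * isometry_inv w 5 = - w 0 - 3 * w 1 + 2 * w 2 + 5 * w 4 + 3 * w 5 + w 6 - 3"
    by (simp add: isometry_inv_def vec7_def)
  have "2 * w 0 - w 1 + 3 * w 2 - 3 * w 4 + w 5 + 5 * w 6 - 1 = 7 * (w 2 + w 3 + w 4 + 2 * w 5 + 3 * w 6 - 3 * t - 1)"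
    using s m by algebra
  then have "7 * ((2 * w 0 - w 1 + 3 * w 2 - 3 * w 4 + w 5 + 5 * w 6 - 1) div 7) = 2 * w 0 - w 1 + 3 * w 2 - 3 * w 4 + w 5 + 5 * w 6 - 1" by (rule times_div_7)
  then show "7 * isometry_inv w 6 = 2 * w 0 - w 1 + 3 * w 2 - 3 * w 4 + w 5 + 5 * w 6 - 1"
    by (simp add: isometry_inv_def vec7_def)
qed

text \<open>Writing w for the image, 7 w - b is 7 M v and has squared norm 49 |v|^2 by
  orthogonality. Expanding with b_j = j - 3 and |b|^2 = 28 produces the quadratic form of the cores,
  at the value 7 (n + 1) - 2 = 7 n + 5.\<close>

lemma isometry_core_vecs:
  assumes v: "v \<in> shell (Suc n)" "moment v mod 7 = 1"
  shows "isometry v \<in> core_vecs (7 * n + 5)"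
proof -
  let ?y = "isometry v"
  have s: "sum v {..<7} = 0" and n: "(\<Sum>j<7. (v j)\<^sup>2) = 2 * int (Suc n)"
    using v(1) by (simp_all add: shell_def)
  note y = isometry_times_7[OF s v(2)]
  have y0: "sum ?y {..<7} = 0"
    using s y unfolding sum_lessThan_7 by linarith
  have "(7 * ?y 0 + 3)\<^sup>2 + (7 * ?y 1 + 2)\<^sup>2 + (7 * ?y 2 + 1)\<^sup>2 + (7 * ?y 3)\<^sup>2
      + (7 * ?y 4 - 1)\<^sup>2 + (7 * ?y 5 - 2)\<^sup>2 + (7 * ?y 6 - 3)\<^sup>2 = 49 * (\<Sum>j<7. (v j)\<^sup>2)"
    unfolding y sum_lessThan_7 by (simp add: power2_eq_square algebra_simps)
  moreover have "(7 * ?y 0 + 3)\<^sup>2 + (7 * ?y 1 + 2)\<^sup>2 + (7 * ?y 2 + 1)\<^sup>2 + (7 * ?y 3)\<^sup>2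
      + (7 * ?y 4 - 1)\<^sup>2 + (7 * ?y 5 - 2)\<^sup>2 + (7 * ?y 6 - 3)\<^sup>2
      = 49 * (\<Sum>j<7. (?y j)\<^sup>2) - 14 * moment ?y + 42 * sum ?y {..<7} + 28"
    unfolding sum_lessThan_7 moment_def by (simp add: power2_eq_square algebra_simps)
  ultimately have "7 * (\<Sum>j<7. (?y j)\<^sup>2) - 2 * moment ?y = 2 * int (7 * n + 5)"
    using y0 n by simp
  then show ?thesis
    using y0 isometry_in_PiE by (simp add: core_vecs_def)
qed

text \<open>The norm equation read modulo 7; the moment class needed for exact division thus holds
  automatically on these cores.\<close>

lemma moment_core_vecs:
  assumes "w \<in> core_vecs (7 * n + 5)"
  shows "moment w mod 7 = 2"
proof -
  have "7 * (\<Sum>j<7. (w j)\<^sup>2) - 2 * moment w = 2 * int (7 * n + 5)"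
    using assms by (simp add: core_vecs_def)
  then show ?thesis by presburger
qed

lemma isometry_inv_shell:
  assumes w: "w \<in> core_vecs (7 * n + 5)"
  shows "isometry_inv w \<in> shell (Suc n)" "moment (isometry_inv w) mod 7 = 1"
proof -
  let ?y = "isometry_inv w"
  have s: "sum w {..<7} = 0" and n: "7 * (\<Sum>j<7. (w j)\<^sup>2) - 2 * moment w = 2 * int (7 * n + 5)"
    using w by (simp_all add: core_vecs_def)
  note m = moment_core_vecs[OF w]
  note y = isometry_inv_times_7[OF s m]
  have y0: "sum ?y {..<7} = 0"
    using s y unfolding sum_lessThan_7 by linarith
  have "49 * (\<Sum>j<7. (?y j)\<^sup>2) = (\<Sum>j<7. (7 * ?y j)\<^sup>2)"
    by (simp add: sum_distrib_left power_mult_distrib)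
  also have "\<dots> = 49 * (\<Sum>j<7. (w j)\<^sup>2) - 14 * moment w + 42 * sum w {..<7} + 28"
    unfolding sum_lessThan_7 y moment_def by (simp add: power2_eq_square algebra_simps)
  finally have "(\<Sum>j<7. (?y j)\<^sup>2) = 2 * int (Suc n)"
    using s n by simp
  then show "isometry_inv w \<in> shell (Suc n)"
    using y0 isometry_in_PiE by (simp add: shell_def)
  define t where "t = moment w div 7"
  have "moment w = 7 * t + 2" using m mult_div_mod_eq[of 7 "moment w"] by (simp add: t_def)
  \<comment> \<open>The bracket is the coordinate \<open>?y 5\<close>, in the form that division by
    7 gives it.\<close>
  then have "moment ?y = 7 * (w 2 + w 3 + w 4 + 2 * w 5 + 2 * w 6 - 2 * t - 1) + 1"
    using y s unfolding moment_def sum_lessThan_7 by simp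
  then show "moment (isometry_inv w) mod 7 = 1" by presburger
qed

text \<open>M is an involution: composing the numerators gives 49 times the original coordinate, and
  the offsets of the two maps cancel.\<close>

lemma card_core_vecs: "card (core_vecs (7 * n + 5)) = shell_count (Suc n) 1"
proof -
  have "bij_betw isometry {v \<in> shell (Suc n). moment v mod 7 = 1} (core_vecs (7 * n + 5))"
  proof (rule bij_betw_byWitness[where f' = isometry_inv])
    show "\<forall>v\<in>{v \<in> shell (Suc n). moment v mod 7 = 1}. isometry_inv (isometry v) = v"
    proof
      fix v assume "v \<in> {v \<in> shell (Suc n). moment v mod 7 = 1}"
      then have v: "v \<in> shell (Suc n)" "moment v mod 7 = 1" by auto
      then have s: "sum v {..<7} = 0" and e: "v \<in> PiE {..<7} (\<lambda>_. UNIV)" by (simp_all add: shell_def)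
      have w: "isometry v \<in> core_vecs (7 * n + 5)" using isometry_core_vecs[OF v] .
      then have s': "sum (isometry v) {..<7} = 0" by (simp add: core_vecs_def)
      note y = isometry_times_7[OF s v(2)] and z = isometry_inv_times_7[OF s' moment_core_vecs[OF w]]
      have "7 * (7 * isometry_inv (isometry v) 0) = 5 * (7 * isometry v 0) + (7 * isometry v 1) - 3 * (7 * isometry v 2) + 3 * (7 * isometry v 4) - (7 * isometry v 5) + 2 * (7 * isometry v 6) + 7"
        unfolding z by (simp add: algebra_simps)
      also have "\<dots> = 49 * v 0" unfolding y by simp
      finally have e0: "isometry_inv (isometry v) 0 = v 0" by simp
      have "7 * (7 * isometry_inv (isometry v) 1) = (7 * isometry v 0) + 3 * (7 * isometry v 1) + 5 * (7 * isometry v 2) + 2 * (7 * isometry v 4) - 3 * (7 * isometry v 5) - (7 * isometry v 6) + 21"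
        unfolding z by (simp add: algebra_simps)
      also have "\<dots> = 49 * v 1" unfolding y by simp
      finally have e1: "isometry_inv (isometry v) 1 = v 1" by simp
      have "7 * (7 * isometry_inv (isometry v) 2) = - 3 * (7 * isometry v 0) + 5 * (7 * isometry v 1) - (7 * isometry v 2) + (7 * isometry v 4) + 2 * (7 * isometry v 5) + 3 * (7 * isometry v 6) - 14"
        unfolding z by (simp add: algebra_simps)
      also have "\<dots> = 49 * v 2" unfolding y by simp
      finally have e2: "isometry_inv (isometry v) 2 = v 2" by simp
      have "7 * (7 * isometry_inv (isometry v) 3) = 7 * (7 * isometry v 3)"
        unfolding z by (simp add: algebra_simps)
      also have "\<dots> = 49 * v 3" unfolding y by simp
      finally have e3: "isometry_inv (isometry v) 3 = v 3" by simp
      have "7 * (7 * isometry_inv (isometry v) 4) = 3 * (7 * isometry v 0) + 2 * (7 * isometry v 1) + (7 * isometry v 2) - (7 * isometry v 4) + 5 * (7 * isometry v 5) - 3 * (7 * isometry v 6) + 14"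
        unfolding z by (simp add: algebra_simps)
      also have "\<dots> = 49 * v 4" unfolding y by simp
      finally have e4: "isometry_inv (isometry v) 4 = v 4" by simp
      have "7 * (7 * isometry_inv (isometry v) 5) = - (7 * isometry v 0) - 3 * (7 * isometry v 1) + 2 * (7 * isometry v 2) + 5 * (7 * isometry v 4) + 3 * (7 * isometry v 5) + (7 * isometry v 6) - 21"
        unfolding z by (simp add: algebra_simps)
      also have "\<dots> = 49 * v 5" unfolding y by simp
      finally have e5: "isometry_inv (isometry v) 5 = v 5" by simp
      have "7 * (7 * isometry_inv (isometry v) 6) = 2 * (7 * isometry v 0) - (7 * isometry v 1) + 3 * (7 * isometry v 2) - 3 * (7 * isometry v 4) + (7 * isometry v 5) + 5 * (7 * isometry v 6) - 7"
        unfolding z by (simp add: algebra_simps)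
      also have "\<dots> = 49 * v 6" unfolding y by simp
      finally have e6: "isometry_inv (isometry v) 6 = v 6" by simp
      show "isometry_inv (isometry v) = v"
      proof (rule PiE_ext[OF isometry_in_PiE(2) e])
        fix j :: nat assume "j \<in> {..<7}"
        then have "j = 0 \<or> j = 1 \<or> j = 2 \<or> j = 3 \<or> j = 4 \<or> j = 5 \<or> j = 6" by auto
        then show "isometry_inv (isometry v) j = v j" using e0 e1 e2 e3 e4 e5 e6 by (elim disjE) simp_all
      qed
    qed
    show "\<forall>w\<in>core_vecs (7 * n + 5). isometry (isometry_inv w) = w"
    proof
      fix w assume w: "w \<in> core_vecs (7 * n + 5)"
      then have s: "sum w {..<7} = 0" and e: "w \<in> PiE {..<7} (\<lambda>_. UNIV)" by (simp_all add: core_vecs_def)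
      have v: "isometry_inv w \<in> shell (Suc n)" using isometry_inv_shell[OF w] by simp
      then have s': "sum (isometry_inv w) {..<7} = 0" by (simp add: shell_def)
      note y = isometry_inv_times_7[OF s moment_core_vecs[OF w]] and z = isometry_times_7[OF s' isometry_inv_shell(2)[OF w]]
      have "7 * (7 * isometry (isometry_inv w) 0) = 5 * (7 * isometry_inv w 0) + (7 * isometry_inv w 1) - 3 * (7 * isometry_inv w 2) + 3 * (7 * isometry_inv w 4) - (7 * isometry_inv w 5) + 2 * (7 * isometry_inv w 6) - 21"
        unfolding z by (simp add: algebra_simps)
      also have "\<dots> = 49 * w 0" unfolding y by simp
      finally have e0: "isometry (isometry_inv w) 0 = w 0" by simp
      have "7 * (7 * isometry (isometry_inv w) 1) = (7 * isometry_inv w 0) + 3 * (7 * isometry_inv w 1) + 5 * (7 * isometry_inv w 2) + 2 * (7 * isometry_inv w 4) - 3 * (7 * isometry_inv w 5) - (7 * isometry_inv w 6) - 14"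
        unfolding z by (simp add: algebra_simps)
      also have "\<dots> = 49 * w 1" unfolding y by simp
      finally have e1: "isometry (isometry_inv w) 1 = w 1" by simp
      have "7 * (7 * isometry (isometry_inv w) 2) = - 3 * (7 * isometry_inv w 0) + 5 * (7 * isometry_inv w 1) - (7 * isometry_inv w 2) + (7 * isometry_inv w 4) + 2 * (7 * isometry_inv w 5) + 3 * (7 * isometry_inv w 6) - 7"
        unfolding z by (simp add: algebra_simps)
      also have "\<dots> = 49 * w 2" unfolding y by simp
      finally have e2: "isometry (isometry_inv w) 2 = w 2" by simp
      have "7 * (7 * isometry (isometry_inv w) 3) = 7 * (7 * isometry_inv w 3)"
        unfolding z by (simp add: algebra_simps)
      also have "\<dots> = 49 * w 3" unfolding y by simp
      finally have e3: "isometry (isometry_inv w) 3 = w 3" by simp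
      have "7 * (7 * isometry (isometry_inv w) 4) = 3 * (7 * isometry_inv w 0) + 2 * (7 * isometry_inv w 1) + (7 * isometry_inv w 2) - (7 * isometry_inv w 4) + 5 * (7 * isometry_inv w 5) - 3 * (7 * isometry_inv w 6) + 7"
        unfolding z by (simp add: algebra_simps)
      also have "\<dots> = 49 * w 4" unfolding y by simp
      finally have e4: "isometry (isometry_inv w) 4 = w 4" by simp
      have "7 * (7 * isometry (isometry_inv w) 5) = - (7 * isometry_inv w 0) - 3 * (7 * isometry_inv w 1) + 2 * (7 * isometry_inv w 2) + 5 * (7 * isometry_inv w 4) + 3 * (7 * isometry_inv w 5) + (7 * isometry_inv w 6) + 14"
        unfolding z by (simp add: algebra_simps)
      also have "\<dots> = 49 * w 5" unfolding y by simp
      finally have e5: "isometry (isometry_inv w) 5 = w 5" by simp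
      have "7 * (7 * isometry (isometry_inv w) 6) = 2 * (7 * isometry_inv w 0) - (7 * isometry_inv w 1) + 3 * (7 * isometry_inv w 2) - 3 * (7 * isometry_inv w 4) + (7 * isometry_inv w 5) + 5 * (7 * isometry_inv w 6) + 21"
        unfolding z by (simp add: algebra_simps)
      also have "\<dots> = 49 * w 6" unfolding y by simp
      finally have e6: "isometry (isometry_inv w) 6 = w 6" by simp
      show "isometry (isometry_inv w) = w"
      proof (rule PiE_ext[OF isometry_in_PiE(1) e])
        fix j :: nat assume "j \<in> {..<7}"
        then have "j = 0 \<or> j = 1 \<or> j = 2 \<or> j = 3 \<or> j = 4 \<or> j = 5 \<or> j = 6" by auto
        then show "isometry (isometry_inv w) j = w j" using e0 e1 e2 e3 e4 e5 e6 by (elim disjE) simp_all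
      qed
    qed
  qed (use isometry_core_vecs isometry_inv_shell in auto)
  then show ?thesis
    unfolding shell_count_def by (metis (no_types, lifting) bij_betw_same_card)
qed

section \<open>Generalized Frobenius partitions\<close>

lemma colored_less_iff: "colored_less x y \<longleftrightarrow> x < y"
  by (auto simp: colored_less_def prod_less_eq)

lemma frobenius_row_iff:
  "frobenius_row k r \<longleftrightarrow> set r \<subseteq> UNIV \<times> {1..k} \<and> sorted_wrt (<) (rev r)"
  by (auto simp: frobenius_row_def colored_less_iff sorted_wrt_rev)

text \<open>A strictly decreasing row is determined by its set of entries. Taking successors in the
  top row absorbs the number of columns into the weight.\<close>

definition frobenius_sets :: "nat \<Rightarrow> nat \<Rightarrow> (colored set \<times> colored set) set" where
  "frobenius_sets k n = {(A, B). finite A \<and> finite B \<and> A \<subseteq> UNIV \<times> {1..k} \<and> B \<subseteq> UNIV \<times> {1..k} \<and>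
     card A = card B \<and> (\<Sum>x\<in>A. Suc (fst x)) + (\<Sum>x\<in>B. fst x) = n}"

lemma c_phi_eq_card_frobenius_sets: "c_phi k n = card (frobenius_sets k n)"
proof -
  have "bij_betw (\<lambda>(r, s). (set r, set s)) (frobenius_partitions k n) (frobenius_sets k n)"
  proof (rule bij_betw_byWitness[where f' = "\<lambda>(A, B). (rev (sorted_list_of_set A), rev (sorted_list_of_set B))"])
    have inv: "rev (sorted_list_of_set (set r)) = r" if "frobenius_row k r" for r
      using that strict_sorted_equal[OF strict_sorted_list_of_set[of "set r"], of "rev r"]
      by (simp add: frobenius_row_iff) (metis rev_rev_ident)
    show "\<forall>a\<in>frobenius_partitions k n.
        (\<lambda>(A, B). (rev (sorted_list_of_set A), rev (sorted_list_of_set B))) ((\<lambda>(r, s). (set r, set s)) a) = a"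
      using inv by (auto simp: frobenius_partitions_def frobenius_symbol_def)
    show "\<forall>a\<in>frobenius_sets k n.
        (\<lambda>(r, s). (set r, set s)) ((\<lambda>(A, B). (rev (sorted_list_of_set A), rev (sorted_list_of_set B))) a) = a"
      by (auto simp: frobenius_sets_def)
    have row: "distinct r \<and> length r = card (set r) \<and> sum_list (map fst r) = (\<Sum>x\<in>set r. fst x)"
      if "frobenius_row k r" for r
    proof -
      have "distinct (rev r)" using that by (simp add: frobenius_row_iff strict_sorted_iff)
      then have "distinct r" by simp
      then show ?thesis by (simp add: distinct_card sum_list_distinct_conv_sum_set)
    qed
    show "(\<lambda>(r, s). (set r, set s)) ` frobenius_partitions k n \<subseteq> frobenius_sets k n"
    proof safe
      fix r s assume "(r, s) \<in> frobenius_partitions k n"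
      then have rs: "frobenius_row k r" "frobenius_row k s" "length r = length s"
        "length r + sum_list (map fst r) + sum_list (map fst s) = n"
        by (auto simp: frobenius_partitions_def frobenius_symbol_def frobenius_weight_def)
      have "(\<Sum>x\<in>set r. Suc (fst x)) = card (set r) + (\<Sum>x\<in>set r. fst x)"
        by (simp add: sum_Suc)
      then show "(set r, set s) \<in> frobenius_sets k n"
        using rs row[OF rs(1)] row[OF rs(2)] by (simp add: frobenius_sets_def frobenius_row_iff)
    qed
    show "(\<lambda>(A, B). (rev (sorted_list_of_set A), rev (sorted_list_of_set B))) ` frobenius_sets k n
        \<subseteq> frobenius_partitions k n"
    proof safe
      fix A B assume "(A, B) \<in> frobenius_sets k n"
      then have AB: "finite A" "finite B" "A \<subseteq> UNIV \<times> {1..k}" "B \<subseteq> UNIV \<times> {1..k}" "card A = card B"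
        "(\<Sum>x\<in>A. Suc (fst x)) + (\<Sum>x\<in>B. fst x) = n"
        by (auto simp: frobenius_sets_def)
      then have rows: "frobenius_row k (rev (sorted_list_of_set A))" "frobenius_row k (rev (sorted_list_of_set B))"
        by (auto simp: frobenius_row_iff strict_sorted_list_of_set)
      have "(\<Sum>x\<in>A. Suc (fst x)) = card A + (\<Sum>x\<in>A. fst x)"
        by (simp add: sum_Suc)
      then show "(rev (sorted_list_of_set A), rev (sorted_list_of_set B)) \<in> frobenius_partitions k n"
        using AB rows row[OF rows(1)] row[OF rows(2)]
        by (simp add: frobenius_partitions_def frobenius_symbol_def frobenius_weight_def)
    qed
  qed
  then show ?thesis unfolding c_phi_def by (rule bij_betw_same_card)
qed

text \<open>In 1 + q^(l+1) z the term with z puts the entry l into the top row; in q^l + z the term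
  without z puts it into the bottom row. The exponent of z is then |A| + k N - |B|, so the middle
  coefficient selects rows of equal length. Entries are at most n < N, hence the truncation loses
  nothing.\<close>

lemma c_phi_const_term:
  assumes "n < N"
  shows "coeff (triple fps_X 1 fps_X N N ^ k) (k * N) $ n = int (c_phi k n)"
proof -
  define S where "S = {..<N} \<times> {1..k}"
  define w where "w A B = (\<Sum>x\<in>A. Suc (fst x)) + (\<Sum>x\<in>B. fst x)" for A B :: "colored set"
  have finS: "finite S" and cardS: "card S = k * N" by (simp_all add: S_def)
  have "(\<Prod>x\<in>S. [:1, fps_X ^ Suc (fst x) :: int fps:]) = (\<Prod>x\<in>S. [:0, fps_X ^ Suc (fst x):] + 1)"
    by (simp add: one_pCons)
  also have "\<dots> = (\<Sum>A\<in>Pow S. \<Prod>x\<in>A. [:0, fps_X ^ Suc (fst x):])"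
    by (subst prod_add[OF finS]) simp
  also have "\<dots> = (\<Sum>A\<in>Pow S. monom (fps_X ^ (\<Sum>x\<in>A. Suc (fst x))) (card A))"
  proof (intro sum.cong refl)
    fix A assume "A \<in> Pow S"
    then have "finite A" using finS finite_subset by blast
    then show "(\<Prod>x\<in>A. [:0, fps_X ^ Suc (fst x) :: int fps:]) = monom (fps_X ^ (\<Sum>x\<in>A. Suc (fst x))) (card A)"
      by (induction A) (auto simp: power_add monom_Suc mult_ac smult_monom)
  qed
  finally have top: "(\<Prod>x\<in>S. [:1, fps_X ^ Suc (fst x) :: int fps:])
      = (\<Sum>A\<in>Pow S. monom (fps_X ^ (\<Sum>x\<in>A. Suc (fst x))) (card A))" .
  have "(\<Prod>x\<in>S. [:fps_X ^ fst x, 1 :: int fps:]) = (\<Prod>x\<in>S. [:fps_X ^ fst x:] + [:0, 1:])"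
    by simp
  also have "\<dots> = (\<Sum>B\<in>Pow S. (\<Prod>x\<in>B. [:fps_X ^ fst x:]) * (\<Prod>x\<in>S - B. [:0, 1:]))"
    by (rule prod_add[OF finS])
  also have "\<dots> = (\<Sum>B\<in>Pow S. monom (fps_X ^ (\<Sum>x\<in>B. fst x)) (k * N - card B))"
  proof (intro sum.cong refl)
    fix B assume B: "B \<in> Pow S"
    then have "finite B" using finS finite_subset by blast
    then have "(\<Prod>x\<in>B. [:fps_X ^ fst x :: int fps:]) = [:fps_X ^ (\<Sum>x\<in>B. fst x):]"
      by (induction B) (auto simp: power_add one_pCons)
    moreover have "card (S - B) = k * N - card B"
      using B \<open>finite B\<close> cardS by (simp add: card_Diff_subset)
    ultimately show "(\<Prod>x\<in>B. [:fps_X ^ fst x :: int fps:]) * (\<Prod>x\<in>S - B. [:0, 1:])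
        = monom (fps_X ^ (\<Sum>x\<in>B. fst x)) (k * N - card B)"
      by (simp add: monom_altdef)
  qed
  finally have bot: "(\<Prod>x\<in>S. [:fps_X ^ fst x, 1 :: int fps:])
      = (\<Sum>B\<in>Pow S. monom (fps_X ^ (\<Sum>x\<in>B. fst x)) (k * N - card B))" .
  have cart: "(\<Prod>x\<in>S. g (fst x)) = (\<Prod>l<N. g l ^ k)" for g :: "nat \<Rightarrow> int fps poly"
    using prod.cartesian_product[of "\<lambda>l _. g l" "{1..k}" "{..<N}"]
    by (simp add: S_def case_prod_beta)
  have "triple fps_X 1 fps_X N N ^ k
      = (\<Prod>x\<in>S. [:1, fps_X ^ Suc (fst x) :: int fps:]) * (\<Prod>x\<in>S. [:fps_X ^ fst x, 1:])"
    unfolding triple_def cart[of "\<lambda>l. [:1, fps_X ^ Suc l:]"] cart[of "\<lambda>l. [:fps_X ^ l, 1:]"]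
    by (simp add: power_mult_distrib prod_power_distrib)
  also have "\<dots> = (\<Sum>A\<in>Pow S. \<Sum>B\<in>Pow S. monom (fps_X ^ w A B) (card A + (k * N - card B)))"
    unfolding top bot w_def by (simp add: sum_product mult_monom power_add)
  finally have "coeff (triple fps_X 1 fps_X N N ^ k) (k * N) $ n
      = (\<Sum>A\<in>Pow S. \<Sum>B\<in>Pow S. if card A + (k * N - card B) = k * N \<and> w A B = n then 1 else 0 :: int)"
    by (simp add: coeff_sum fps_sum_nth if_distrib[where f = "\<lambda>f. f $ n"] cong: if_cong) (auto intro!: sum.cong)
  also have "\<dots> = (\<Sum>p\<in>Pow S \<times> Pow S. if card (fst p) + (k * N - card (snd p)) = k * N \<and> w (fst p) (snd p) = n then 1 else 0)"
    by (simp add: sum.cartesian_product case_prod_beta)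
  also have "\<dots> = int (card {p \<in> Pow S \<times> Pow S. card (fst p) + (k * N - card (snd p)) = k * N \<and> w (fst p) (snd p) = n})"
    using finS by (simp add: sum.If_cases Int_def)
  also have "{p \<in> Pow S \<times> Pow S. card (fst p) + (k * N - card (snd p)) = k * N \<and> w (fst p) (snd p) = n} = frobenius_sets k n"
  proof -
    \<comment> \<open>This makes the natural-number subtraction from k N exact.\<close>
    have le: "card B \<le> k * N" if "B \<subseteq> S" for B using card_mono[OF finS that] cardS by simp
    have sub: "A \<subseteq> S" "B \<subseteq> S"
      if w: "w A B = n" and AB: "finite A" "finite B" "A \<subseteq> UNIV \<times> {1..k}" "B \<subseteq> UNIV \<times> {1..k}" for A B
    proof -
      have "fst x \<le> n" if "x \<in> A" for x
        using member_le_sum[OF that, of "\<lambda>x. Suc (fst x)"] AB w by (simp add: w_def)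
      moreover have "fst x \<le> n" if "x \<in> B" for x
        using member_le_sum[OF that, of fst] AB w by (simp add: w_def)
      ultimately show "A \<subseteq> S" "B \<subseteq> S" using AB(3,4) assms unfolding S_def by fastforce+
    qed
    have sup: "finite A" "A \<subseteq> UNIV \<times> {1..k}" if "A \<subseteq> S" for A
      using finite_subset[OF that finS] that by (auto simp: S_def)
    have iff: "A \<subseteq> S \<and> B \<subseteq> S \<and> card A + (k * N - card B) = k * N \<and> w A B = n \<longleftrightarrow>
        finite A \<and> finite B \<and> A \<subseteq> UNIV \<times> {1..k} \<and> B \<subseteq> UNIV \<times> {1..k} \<and> card A = card B \<and> w A B = n"
      (is "?L \<longleftrightarrow> ?R") for A B
    proof
      assume L: ?L
      then have "card A = card B" using le[of A] le[of B] by linarith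
      then show ?R using L sup by blast
    next
      assume R: ?R
      then have "A \<subseteq> S" "B \<subseteq> S" using sub by blast+
      then show ?L using R le[of B] by simp
    qed
    show ?thesis
    proof (rule set_eqI)
      fix p :: "colored set \<times> colored set"
      obtain A B where p: "p = (A, B)" by (cases p)
      show "p \<in> {p \<in> Pow S \<times> Pow S. card (fst p) + (k * N - card (snd p)) = k * N \<and> w (fst p) (snd p) = n}
          \<longleftrightarrow> p \<in> frobenius_sets k n"
        using iff[of A B] by (simp add: p frobenius_sets_def w_def)
    qed
  qed
  finally show ?thesis by (simp add: c_phi_eq_card_frobenius_sets)
qed

section \<open>The generating function modulo 7^3\<close>

lemma shell_count_0_1: "shell_count 0 1 = 0"
proof -
  have "moment v mod 7 \<noteq> 1" if "v \<in> shell 0" for v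
  proof -
    have "(\<Sum>j<7. (v j)\<^sup>2) = 0" using that by (simp add: shell_def)
    then have "\<forall>j\<in>{..<7}. (v j)\<^sup>2 = 0" by (subst (asm) sum_nonneg_eq_0_iff) auto
    then have "moment v = 0" unfolding moment_def by (intro sum.neutral) auto
    then show ?thesis by simp
  qed
  then have "{v \<in> shell 0. moment v mod 7 = 1} = {}" by blast
  then show ?thesis unfolding shell_count_def by (simp only: card.empty)
qed

lemma c_phi_7_theta_series:
  "euler 1 ^ 7 * Abs_fps (\<lambda>n. int (c_phi 7 n)) = Abs_fps (\<lambda>n. int (card (shell n)))"
proof (rule fps_ext)
  fix n
  let ?C = "Abs_fps (\<lambda>n. int (c_phi 7 n))" and ?T = "coeff (triple fps_X 1 fps_X (Suc n) (Suc n) ^ 7) (7 * Suc n)"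
  have "fps_X ^ Suc n dvd ?C - ?T"
    unfolding X_power_dvd_iff using c_phi_const_term[of _ "Suc n" 7] by (simp del: mult_Suc_right)
  then have "fps_X ^ Suc n dvd euler 1 ^ 7 * ?C - euler 1 ^ 7 * ?T"
    by (intro dvd_diff_mult) auto
  then have "(euler 1 ^ 7 * ?C) $ n = (euler 1 ^ 7 * ?T) $ n"
    unfolding X_power_dvd_iff by simp
  also have "\<dots> = int (card (shell n))" by (rule shell_theta_series) simp
  finally show "(euler 1 ^ 7 * ?C) $ n = Abs_fps (\<lambda>n. int (card (shell n))) $ n" by simp
qed

text \<open>The comparison takes place after q -> q^7, where N_1 becomes q^2 times part 5 of the
  core series E_7^7 / E_1. As E_7^7 lies in class 0, the extraction acts on 1 / E_1 alone and
  \<open>euler_inverse_part_5\<close> applies.\<close>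

lemma shell_count_1_mod_49:
  "49 dvd Abs_fps (\<lambda>n. int (shell_count n 1)) - 7 * (fps_X * euler 1 ^ 10 * euler 7 ^ 2)"
proof -
  define N1 where "N1 = Abs_fps (\<lambda>n. int (shell_count n 1))"
  define \<Theta> where "\<Theta> = Abs_fps (\<lambda>n. int (card (core_vecs n)))"
  obtain P W :: "int fps" where P: "euler 1 * P = 1" and W: "part 5 P = 7 * W"
    and W7: "7 dvd W - fps_X ^ 5 * euler 49 ^ 2 * euler 7 ^ 3"
    by (rule euler_inverse_part_5)
  have "\<Theta> = (euler 1 * P) * \<Theta>" using P by simp
  also have "\<dots> = (euler 1 * \<Theta>) * P" by (simp add: mult_ac)
  finally have "\<Theta> = euler 7 ^ 7 * P" unfolding \<Theta>_def core_series .
  moreover have "residue_class 0 (euler 7 ^ 7)"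
    using residue_class_power_0[OF residue_class_euler[of 1]] by simp
  ultimately have \<Theta>5: "part 5 \<Theta> = 7 * (euler 7 ^ 7 * W)"
    using part_mult[of "euler 7 ^ 7" 5 P] W by simp
  have "N1 oo fps_X ^ 7 = fps_X ^ 2 * part 5 \<Theta>"
  proof (rule fps_ext)
    fix n
    show "(N1 oo fps_X ^ 7) $ n = (fps_X ^ 2 * part 5 \<Theta>) $ n"
    proof (cases "7 dvd n")
      case True
      then obtain k where k: "n = 7 * k" by (rule dvdE)
      show ?thesis
      proof (cases k)
        \<comment> \<open>At n = 0 the index 7 n - 2 of the core would be negative, so this
          coefficient has to vanish on its own.\<close>
        case 0
        then show ?thesis using k by (simp add: N1_def shell_count_0_1 fps_X_power_mult_nth)
      next
        case (Suc j)
        then have "n - 2 = 7 * j + 5" "n \<ge> 2" using k by auto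
        then show ?thesis using k Suc card_core_vecs[of j]
          by (simp add: fps_compose_X_power_nth fps_X_power_mult_nth part_def N1_def \<Theta>_def add.commute)
      qed
    next
      case False
      then have "n < 2 \<or> (n - 2) mod 7 \<noteq> 5" by presburger
      then show ?thesis using False by (auto simp: fps_compose_X_power_nth fps_X_power_mult_nth part_def)
    qed
  qed
  then have N1: "N1 oo fps_X ^ 7 = 7 * (fps_X ^ 2 * euler 7 ^ 7 * W)"
    unfolding \<Theta>5 by (simp add: mult_ac)
  have X0: "(fps_X ^ 7 :: int fps) $ 0 = 0" by simp
  have "(7 * (fps_X * euler 1 ^ 10 * euler 7 ^ 2)) oo fps_X ^ 7
      = (7 * (fps_X ^ 7 * euler 7 ^ 10 * euler 49 ^ 2) :: int fps)"
    using euler_compose_X_power[of 7 1] euler_compose_X_power[of 7 7] X0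
    by (simp add: fps_compose_mult_distrib fps_compose_power[symmetric] numeral_fps_const)
  then have "(N1 - 7 * (fps_X * euler 1 ^ 10 * euler 7 ^ 2)) oo fps_X ^ 7
      = 7 * (fps_X ^ 2 * euler 7 ^ 7 * W) - 7 * (fps_X ^ 7 * euler 7 ^ 10 * euler 49 ^ 2)"
    by (simp only: fps_compose_sub_distrib N1)
  also have "\<dots> = 7 * (fps_X ^ 2 * euler 7 ^ 7 * (W - fps_X ^ 5 * euler 49 ^ 2 * euler 7 ^ 3))"
    by (simp add: algebra_simps flip: power_add)
  finally have eq: "(N1 - 7 * (fps_X * euler 1 ^ 10 * euler 7 ^ 2)) oo fps_X ^ 7 = \<dots>" .
  have "7 * 7 dvd 7 * (fps_X ^ 2 * euler 7 ^ 7 * (W - fps_X ^ 5 * euler 49 ^ 2 * euler 7 ^ 3))"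
    using W7 by (intro mult_dvd_mono dvd_mult) auto
  then have "49 dvd (N1 - 7 * (fps_X * euler 1 ^ 10 * euler 7 ^ 2)) oo fps_X ^ 7"
    unfolding eq by simp
  then have "49 dvd ((N1 - 7 * (fps_X * euler 1 ^ 10 * euler 7 ^ 2)) oo fps_X ^ 7) $ (7 * n)" for n
    unfolding numeral_dvd_fps_iff by blast
  then show ?thesis
    unfolding N1_def[symmetric] numeral_dvd_fps_iff by (simp add: fps_compose_X_power_nth)
qed

text \<open>N_1 is known modulo 49 and enters with the factor 7. Dividing by the unit E_1^7 keeps
  the congruence, sends N_0 - N_1 to 1 / E_7, and lowers E_1^10 to E_1^3.\<close>

theorem c_phi_7_series_mod_343:
  assumes "euler 7 * I = 1"
  shows "343 dvd Abs_fps (\<lambda>n. int (c_phi 7 n)) - I - 49 * (fps_X * euler 1 ^ 3 * euler 7 ^ 2)"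
proof -
  define C where "C = Abs_fps (\<lambda>n. int (c_phi 7 n))"
  define N1 where "N1 = Abs_fps (\<lambda>n. int (shell_count n 1))"
  define D where "D = Abs_fps (\<lambda>n. int (shell_count n 0) - int (shell_count n 1))"
  have "D = (euler 7 * I) * D" using assms by simp
  also have "\<dots> = euler 1 ^ 7 * I" using shell_count_diff_series by (simp add: D_def mult_ac)
  finally have D: "D = euler 1 ^ 7 * I" .
  have "euler 1 ^ 7 * C = D + 7 * N1"
    unfolding C_def c_phi_7_theta_series by (simp add: D_def N1_def card_shell fps_eq_iff numeral_fps_const)
  then have "euler 1 ^ 7 * (C - I - 49 * (fps_X * euler 1 ^ 3 * euler 7 ^ 2))
      = 7 * (N1 - 7 * (fps_X * euler 1 ^ 10 * euler 7 ^ 2))"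
    unfolding D by (simp add: algebra_simps flip: power_add)
  moreover have "7 * 49 dvd 7 * (N1 - 7 * (fps_X * euler 1 ^ 10 * euler 7 ^ 2))"
    using shell_count_1_mod_49 unfolding N1_def by (intro mult_dvd_mono) auto
  ultimately have "343 dvd euler 1 ^ 7 * (C - I - 49 * (fps_X * euler 1 ^ 3 * euler 7 ^ 2))" by simp
  moreover have "euler 1 ^ 7 dvd (1 :: int fps)"
    using dvd_power_same[OF euler_unit[of 1, where ?'a = int], of 7] by simp
  ultimately show ?thesis unfolding C_def using unit_dvd_cancel by blast
qed

lemma c_phi_7_mod_343:
  assumes r: "m mod 7 = 3 \<or> m mod 7 = 5 \<or> m mod 7 = 6"
  shows "[c_phi 7 m = 0] (mod 7 ^ 3)"
proof -
  obtain I where I: "euler 7 * I = (1 :: int fps)"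
    using euler_unit[of 7, where ?'a = int] by (metis dvdE)
  have cls: "residue_class 0 (euler 7)" using residue_class_euler[of 1] by simp
  have "residue_class 0 I" using residue_class_inverse[OF cls I] .
  then have I0: "I $ m = 0" using r by (auto simp: residue_class_def)
  have "part (m mod 7) (fps_X * euler 1 ^ 3) = 0"
  proof (rule fps_ext)
    fix n
    show "part (m mod 7) (fps_X * euler 1 ^ 3) $ n = 0 $ n"
    proof (cases "n mod 7 = m mod 7")
      case True
      then obtain k where k: "n = Suc k" using r by (cases n) auto
      have "(euler 1 ^ 3) $ k = (0 :: int)"
      proof -
        \<comment> \<open>The factor q moves the classes 3, 5, 6 back to 2, 4, 5, which are missing
          from E_1^3.\<close>
        have "Suc k mod 7 = 3 \<or> Suc k mod 7 = 5 \<or> Suc k mod 7 = 6" using True r unfolding k by simp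
        then have "k mod 7 = 2 \<or> k mod 7 = 4 \<or> k mod 7 = 5" by presburger
        then show ?thesis
          using arg_cong[OF euler_cube_parts(1), of "\<lambda>f. f $ k"] arg_cong[OF euler_cube_parts(2), of "\<lambda>f. f $ k"]
            arg_cong[OF euler_cube_parts(3), of "\<lambda>f. f $ k"] by (auto simp: part_def)
      qed
      then show ?thesis by (simp add: part_def k)
    qed (simp add: part_def)
  qed
  then have "part (m mod 7) (euler 7 ^ 2 * (fps_X * euler 1 ^ 3)) = 0"
    using part_mult[OF residue_class_power_0[OF cls], of "m mod 7" 2] by simp
  then have "part (m mod 7) (euler 7 ^ 2 * (fps_X * euler 1 ^ 3)) $ m = 0" by (simp only: fps_zero_nth)
  then have "(euler 7 ^ 2 * (fps_X * euler 1 ^ 3) :: int fps) $ m = 0" by (simp add: part_def)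
  moreover have "(49 * (fps_X * euler 1 ^ 3 * euler 7 ^ 2) :: int fps)
      = fps_const 49 * (euler 7 ^ 2 * (fps_X * euler 1 ^ 3))"
    by (simp only: numeral_fps_const mult_ac)
  ultimately have "(49 * (fps_X * euler 1 ^ 3 * euler 7 ^ 2) :: int fps) $ m = 0"
    by (simp only: fps_mult_left_const_nth mult_zero_right)
  moreover have "343 dvd (Abs_fps (\<lambda>n. int (c_phi 7 n)) - I - 49 * (fps_X * euler 1 ^ 3 * euler 7 ^ 2)) $ m"
    using c_phi_7_series_mod_343[OF I] unfolding numeral_dvd_fps_iff by blast
  ultimately have "343 dvd int (c_phi 7 m)" using I0 by simp
  then have "343 dvd c_phi 7 m" by (metis int_dvd_int_iff of_nat_numeral)
  then show ?thesis by (simp add: cong_0_iff)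
qed

theorem theorem3p4:
  fixes n :: nat
  shows "[c_phi 7 (7 * n + 3) = 0] (mod 7 ^ 3) \<and>
         [c_phi 7 (7 * n + 5) = 0] (mod 7 ^ 3) \<and>
         [c_phi 7 (7 * n + 6) = 0] (mod 7 ^ 3)"
  by (intro conjI c_phi_7_mod_343) auto

end
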